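(* Let $f_1,\dots,f_m$ be smooth vector fields on $\mathbb{R}^d$ satisfying (F1) and Chow's condition (that is, the Lie algebra generated by $f_1,\dots,f_m$ spans $\mathbb{R}^d$ at every point $x\in\mathbb{R}^d$), let $L\in C^2(\mathbb{R}^d\times\mathbb{R}^m;\mathbb{R})$ satisfy (L1), (L2) and (L3'), and let $\chi$ be the critical solution described in the context (a locally uniform limit of $v_{\lambda_n}$ along a sequence $\lambda_n\downarrow0$). Then there exists a continuous function $\overline\chi:\mathbb{R}^d\to\mathbb{R}$ such that $$\lim_{t\to\infty}T_t\chi(x)=\overline\chi(x)\quad\text{uniformly on }\overline{B}_R\text{ for every }R\ge0.$$ Moreover, $\overline\chi(x)=T_t\overline\chi(x)$ for all $t\ge0$ and $x\in\mathbb{R}^d$, and $\overline\chi$ satisfies $H(x,D\overline\chi(x))=0$, $x\in\mathbb{R}^d$, in the viscosity sense.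
   Context: Notation: $\overline{B}_R$ is the closed Euclidean ball of radius $R$ centered at $0$. $F(x)=[f_1(x)|\cdots|f_m(x)]$ is the $d\times m$ matrix with columns $f_i(x)$, and the control system is $\dot\gamma(t)=F(\gamma(t))u(t)$. For $s_0<s_1$, $x,y\in\mathbb{R}^d$, $\Gamma_{s_0,s_1}^{x\to}$ is the set of $(\gamma,u)\in AC([s_0,s_1];\mathbb{R}^d)\times L^2(s_0,s_1;\mathbb{R}^m)$ solving the system a.e. with $\gamma(s_0)=x$; $\Gamma_{s_0,s_1}^{\to y}$ is the same with $\gamma(s_1)=y$ instead. Hamiltonian: $H(x,p)=\sup_{u\in\mathbb{R}^m}\{\langle p,F(x)u\rangle-L(x,u)\}$. Lax–Oleinik operator: for a function $\varphi$ on $\mathbb{R}^d$, $t\ge0$, $x\in\mathbb{R}^d$, $T_t\varphi(x)=\inf_{(\gamma,u)\in\Gamma_{0,t}^{\to x}}\{\varphi(\gamma(0))+\int_0^tL(\gamma(s),u(s))\,ds\}$, with $T_0\varphi=\varphi$. Discounted value function: for $\lambda>0$, $v_\lambda(x)=\inf\int_0^{\infty}e^{-\lambda t}L(\gamma(t),u(t))\,dt$ over the set of pairs $(\gamma,u)\in L^\infty_{loc}(0,\infty;\mathbb{R}^d)\times L^2_{loc}(0,\infty;\mathbb{R}^m)$ whose restriction to $[0,T]$ lies in $\Gamma_{0,T}^{x\to}$ for all $T>0$ and with $\int_0^\infty e^{-\lambda t}|u(t)|^2dt<\infty$. The function $\chi$: under the assumptions below there are a continuous function $\chi:\mathbb{R}^d\to\mathbb{R}$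 and a sequence $\lambda_n\downarrow0$ with $v_{\lambda_n}\to\chi$ uniformly on $\overline{B}_R$ for every $R\ge0$; $\chi$ denotes this function. Assumptions: (F1) There is $c_f\ge1$ with $|f_i(x)|\le c_f(1+|x|)$ for all $x\in\mathbb{R}^d$, $i=1,\dots,m$. (Chow's condition) The Lie algebra generated by $f_1,\dots,f_m$ spans $\mathbb{R}^d$ at every point $x\in\mathbb{R}^d$. (L1) There are a nondecreasing $\beta:[0,\infty)\to\mathbb{R}$ and $\ell_1>0$ such that for all $(x,u)$: $L(x,u)\le\beta(|x|)(1+|u|^2)$, $|D_xL(x,u)|\le\ell_1(1+|u|^2)$, $D_u^2L(x,u)\ge\frac1{\ell_1}$ (as quadratic forms). (L2) (with $u^*=0$) $L(x,u)\ge L(x,0)$ for all $(x,u)$. (L3') There is a compact set $\mathcal{K}\subset\mathbb{R}^d$ with $\min_{x\in\mathcal{K}}L(x,0)=0$ and $\inf_{x\in\mathbb{R}^d\setminus\mathcal{K}}L(x,0)>0$.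
   Formalization: In the definition of T_t the infimum is over trajectories ending at x (γ(t)=x, the set Γ_{0,t}^{→x}) instead of those with γ(0)=x as printed; with the printed set, T_tχ̄=χ̄ fails wherever L(x,0)>0. *)

theory Defs
  imports "HOL-Analysis.Analysis"
begin

section \<open>Smoothness and Lie brackets\<close>

text \<open>On a Euclidean space, \<open>C_k k g\<close> says that \<open>g\<close> is of class \<open>C\<^sup>k\<close> on the whole space:
  \<open>g\<close> is Frechet differentiable everywhere and each directional derivative is of class
  \<open>C\<^sup>k\<^sup>-\<^sup>1\<close>.\<close>

primrec C_k :: "nat \<Rightarrow> ('a::real_normed_vector \<Rightarrow> 'b::real_normed_vector) \<Rightarrow> bool" where
  "C_k 0 g \<longleftrightarrow> continuous_on UNIV g"
| "C_k (Suc k) g \<longleftrightarrow>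
     (\<forall>x. g differentiable (at x)) \<and> (\<forall>v. C_k k (\<lambda>x. frechet_derivative g (at x) v))"

definition smooth :: "('a::real_normed_vector \<Rightarrow> 'b::real_normed_vector) \<Rightarrow> bool" where
  "smooth g \<longleftrightarrow> (\<forall>k. C_k k g)"

definition lie_bracket ::
  "('a::real_normed_vector \<Rightarrow> 'a) \<Rightarrow> ('a \<Rightarrow> 'a) \<Rightarrow> 'a \<Rightarrow> 'a" where
  "lie_bracket X Y x =
     frechet_derivative Y (at x) (X x) - frechet_derivative X (at x) (Y x)"

inductive_set lie_algebra_generated ::
  "('a::real_normed_vector \<Rightarrow> 'a) set \<Rightarrow> ('a \<Rightarrow> 'a) set" for S where
  gen: "X \<in> S \<Longrightarrow> X \<in> lie_algebra_generated S"
| zero: "(\<lambda>x. 0) \<in> lie_algebra_generated S"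
| add: "X \<in> lie_algebra_generated S \<Longrightarrow> Y \<in> lie_algebra_generated S
    \<Longrightarrow> (\<lambda>x. X x + Y x) \<in> lie_algebra_generated S"
| scale: "X \<in> lie_algebra_generated S \<Longrightarrow> (\<lambda>x. c *\<^sub>R X x) \<in> lie_algebra_generated S"
| bracket: "X \<in> lie_algebra_generated S \<Longrightarrow> Y \<in> lie_algebra_generated S
    \<Longrightarrow> lie_bracket X Y \<in> lie_algebra_generated S"

definition chow_condition :: "('m::finite \<Rightarrow> real^'d \<Rightarrow> real^'d) \<Rightarrow> bool" where
  "chow_condition f \<longleftrightarrow>
     (\<forall>x. span {X x | X. X \<in> lie_algebra_generated (range f)} = UNIV)"

section \<open>The control system\<close>

definition control_matrix :: "('m::finite \<Rightarrow> real^'d \<Rightarrow> real^'d) \<Rightarrow> real^'d \<Rightarrow> real^'m^'d" where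
  "control_matrix f x = (\<chi> i j. f j x $ i)"

definition absolutely_continuous_on_Icc ::
  "real \<Rightarrow> real \<Rightarrow> (real \<Rightarrow> 'a::real_normed_vector) \<Rightarrow> bool" where
  "absolutely_continuous_on_Icc a b g \<longleftrightarrow>
     (\<forall>\<epsilon>>0. \<exists>\<delta>>0. \<forall>(n::nat) (s::nat \<Rightarrow> real) t.
        (\<forall>i<n. a \<le> s i \<and> s i \<le> t i \<and> t i \<le> b) \<and>
        disjoint_family_on (\<lambda>i. {s i<..<t i}) {..<n} \<and>
        (\<Sum>i<n. t i - s i) < \<delta>
        \<longrightarrow> (\<Sum>i<n. norm (g (t i) - g (s i))) < \<epsilon>)"

definition L2_on :: "real set \<Rightarrow> (real \<Rightarrow> 'a::euclidean_space) \<Rightarrow> bool" where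
  "L2_on I u \<longleftrightarrow> u \<in> borel_measurable (lebesgue_on I) \<and>
     integrable (lebesgue_on I) (\<lambda>s. (norm (u s))\<^sup>2)"

text \<open>Trajectory-control pairs are represented by functions on all of \<open>real\<close>; only their values
  on the time interval in question matter.\<close>

definition admissible ::
  "('m::finite \<Rightarrow> real^'d \<Rightarrow> real^'d) \<Rightarrow> real \<Rightarrow> real
     \<Rightarrow> ((real \<Rightarrow> real^'d) \<times> (real \<Rightarrow> real^'m)) set" where
  "admissible f s0 s1 = {(\<gamma>, u).
     absolutely_continuous_on_Icc s0 s1 \<gamma> \<and> L2_on {s0..s1} u \<and>
     (AE s in lebesgue_on {s0..s1}.
        (\<gamma> has_vector_derivative (control_matrix f (\<gamma> s) *v u s)) (at s within {s0..s1}))}"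

definition admissible_from ::
  "('m::finite \<Rightarrow> real^'d \<Rightarrow> real^'d) \<Rightarrow> real \<Rightarrow> real \<Rightarrow> real^'d
     \<Rightarrow> ((real \<Rightarrow> real^'d) \<times> (real \<Rightarrow> real^'m)) set" where
  "admissible_from f s0 s1 x = {(\<gamma>, u) \<in> admissible f s0 s1. \<gamma> s0 = x}"

definition admissible_to ::
  "('m::finite \<Rightarrow> real^'d \<Rightarrow> real^'d) \<Rightarrow> real \<Rightarrow> real \<Rightarrow> real^'d
     \<Rightarrow> ((real \<Rightarrow> real^'d) \<times> (real \<Rightarrow> real^'m)) set" where
  "admissible_to f s0 s1 y = {(\<gamma>, u) \<in> admissible f s0 s1. \<gamma> s1 = y}"

text \<open>Admissibility on every \<open>{0..T}\<close> already makes \<open>\<gamma>\<close> locally bounded and \<open>u\<close> locally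
  square integrable.\<close>

definition admissible_discounted ::
  "('m::finite \<Rightarrow> real^'d \<Rightarrow> real^'d) \<Rightarrow> real \<Rightarrow> real^'d
     \<Rightarrow> ((real \<Rightarrow> real^'d) \<times> (real \<Rightarrow> real^'m)) set" where
  "admissible_discounted f lam x = {(\<gamma>, u).
     (\<forall>T>0. (\<gamma>, u) \<in> admissible_from f 0 T x) \<and>
     integrable (lebesgue_on {0..}) (\<lambda>t. exp (- lam * t) * (norm (u t))\<^sup>2)}"

section \<open>Value functions\<close>

text \<open>The cost along an admissible pair may be \<open>\<infinity>\<close> on the half-line, where a Bochner integral would
  silently be \<open>0\<close>.\<close>

definition ext_integral :: "'a measure \<Rightarrow> ('a \<Rightarrow> real) \<Rightarrow> ereal" where
  "ext_integral M g =
     enn2ereal (\<integral>\<^sup>+ s. ennreal (g s) \<partial>M) - enn2ereal (\<integral>\<^sup>+ s. ennreal (- g s) \<partial>M)"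

text \<open>The initial cost is paid at time \<open>0\<close>, so the trajectories compared are those that
  end at \<open>x\<close> at time \<open>t\<close>.\<close>

definition lax_oleinik ::
  "('m::finite \<Rightarrow> real^'d \<Rightarrow> real^'d) \<Rightarrow> (real^'d \<Rightarrow> real^'m \<Rightarrow> real)
     \<Rightarrow> real \<Rightarrow> (real^'d \<Rightarrow> real) \<Rightarrow> real^'d \<Rightarrow> ereal" where
  "lax_oleinik f L t \<phi> x =
     (if t = 0 then ereal (\<phi> x)
      else INF (\<gamma>, u) \<in> admissible_to f 0 t x.
        ereal (\<phi> (\<gamma> 0)) + ext_integral (lebesgue_on {0..t}) (\<lambda>s. L (\<gamma> s) (u s)))"

definition discounted_value ::
  "('m::finite \<Rightarrow> real^'d \<Rightarrow> real^'d) \<Rightarrow> (real^'d \<Rightarrow> real^'m \<Rightarrow> real)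
     \<Rightarrow> real \<Rightarrow> real^'d \<Rightarrow> ereal" where
  "discounted_value f L lam x =
     (INF (\<gamma>, u) \<in> admissible_discounted f lam x.
        ext_integral (lebesgue_on {0..}) (\<lambda>t. exp (- lam * t) * L (\<gamma> t) (u t)))"

text \<open>Uniform convergence on \<open>S\<close> of extended-real functions to a real one; in particular the
  functions are eventually finite on \<open>S\<close>. (\<open>uniform_limit\<close> needs a metric space.)\<close>

definition ereal_uniform_limit ::
  "'a set \<Rightarrow> ('i \<Rightarrow> 'a \<Rightarrow> ereal) \<Rightarrow> ('a \<Rightarrow> real) \<Rightarrow> 'i filter \<Rightarrow> bool" where
  "ereal_uniform_limit S g l F \<longleftrightarrow>
     (\<forall>\<epsilon>>0. \<forall>\<^sub>F i in F. \<forall>x\<in>S. \<bar>g i x - ereal (l x)\<bar> < ereal \<epsilon>)"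

definition critical_solution ::
  "('m::finite \<Rightarrow> real^'d \<Rightarrow> real^'d) \<Rightarrow> (real^'d \<Rightarrow> real^'m \<Rightarrow> real)
     \<Rightarrow> (real^'d \<Rightarrow> real) \<Rightarrow> bool" where
  "critical_solution f L chi \<longleftrightarrow> continuous_on UNIV chi \<and>
     (\<exists>lam::nat \<Rightarrow> real. (\<forall>n. lam n > 0) \<and> decseq lam \<and> lam \<longlonglongrightarrow> 0 \<and>
        (\<forall>R\<ge>0. ereal_uniform_limit (cball 0 R) (\<lambda>n. discounted_value f L (lam n)) chi sequentially))"

section \<open>The Hamilton-Jacobi equation\<close>

definition hamiltonian ::
  "('m::finite \<Rightarrow> real^'d \<Rightarrow> real^'d) \<Rightarrow> (real^'d \<Rightarrow> real^'m \<Rightarrow> real)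
     \<Rightarrow> real^'d \<Rightarrow> real^'d \<Rightarrow> ereal" where
  "hamiltonian f L x p = (SUP u. ereal (p \<bullet> (control_matrix f x *v u) - L x u))"

definition gradient :: "('a::real_inner \<Rightarrow> real) \<Rightarrow> 'a \<Rightarrow> 'a" where
  "gradient g x = (THE D. GDERIV g x :> D)"

definition viscosity_subsolution ::
  "('a::euclidean_space \<Rightarrow> 'a \<Rightarrow> ereal) \<Rightarrow> ('a \<Rightarrow> real) \<Rightarrow> bool" where
  "viscosity_subsolution H w \<longleftrightarrow> (\<forall>\<phi> x. C_k 1 \<phi> \<and>
     (\<forall>\<^sub>F y in nhds x. w y - \<phi> y \<le> w x - \<phi> x) \<longrightarrow> H x (gradient \<phi> x) \<le> 0)"

definition viscosity_supersolution ::
  "('a::euclidean_space \<Rightarrow> 'a \<Rightarrow> ereal) \<Rightarrow> ('a \<Rightarrow> real) \<Rightarrow> bool" where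
  "viscosity_supersolution H w \<longleftrightarrow> (\<forall>\<phi> x. C_k 1 \<phi> \<and>
     (\<forall>\<^sub>F y in nhds x. w y - \<phi> y \<ge> w x - \<phi> x) \<longrightarrow> H x (gradient \<phi> x) \<ge> 0)"

text \<open>Continuous viscosity solutions of \<open>H(x, Dw(x)) = 0\<close> on the whole space.\<close>

definition viscosity_solution ::
  "('a::euclidean_space \<Rightarrow> 'a \<Rightarrow> ereal) \<Rightarrow> ('a \<Rightarrow> real) \<Rightarrow> bool" where
  "viscosity_solution H w \<longleftrightarrow>
     continuous_on UNIV w \<and> viscosity_subsolution H w \<and> viscosity_supersolution H w"

section \<open>Standing assumptions\<close>

definition assumption_F1 :: "('m::finite \<Rightarrow> real^'d \<Rightarrow> real^'d) \<Rightarrow> bool" where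
  "assumption_F1 f \<longleftrightarrow> (\<exists>c\<ge>1. \<forall>x i. norm (f i x) \<le> c * (1 + norm x))"

definition assumption_L1 :: "(real^'d \<Rightarrow> real^'m::finite \<Rightarrow> real) \<Rightarrow> bool" where
  "assumption_L1 L \<longleftrightarrow>
     (\<exists>(\<beta>::real \<Rightarrow> real) l. mono_on {0..} \<beta> \<and> l > 0 \<and>
       (\<forall>x u. L x u \<le> \<beta> (norm x) * (1 + (norm u)\<^sup>2) \<and>
          norm (gradient (\<lambda>y. L y u) x) \<le> l * (1 + (norm u)\<^sup>2) \<and>
          (\<forall>w. frechet_derivative (\<lambda>v. frechet_derivative (L x) (at v) w) (at u) w
                 \<ge> 1 / l * (norm w)\<^sup>2)))"

definition assumption_L2 :: "(real^'d \<Rightarrow> real^'m::finite \<Rightarrow> real) \<Rightarrow> bool" where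
  "assumption_L2 L \<longleftrightarrow> (\<forall>x u. L x u \<ge> L x 0)"

definition assumption_L3' :: "(real^'d \<Rightarrow> real^'m::finite \<Rightarrow> real) \<Rightarrow> bool" where
  "assumption_L3' L \<longleftrightarrow>
     (\<exists>K. compact K \<and> (\<exists>x\<in>K. L x 0 = 0) \<and> (\<forall>x\<in>K. 0 \<le> L x 0) \<and>
        (INF x\<in>-K. ereal (L x 0)) > 0)"

end

(*
Since L(x,u) >= L(x,0) >= 0, the function chi is nonnegative and vanishes on the rest set
A = {a. L(a,0) = 0}, which lies in the compact set K. Let D(x) be the infimum of the costs of
trajectories going from A to x in arbitrary time. Waiting at a point of A is free, so a trajectory
that starts in A can be prolonged to any larger time and limsup T_t chi <= D. Conversely, a
trajectory of bounded cost on [0,t] satisfies L(gamma(s),0) <= C/t for some s, so for large t it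
passes close to A, where D is small; hence liminf T_t chi >= D. No compactness of minimisers is needed:
everything rests on the fact that points close to each other are connected at small cost.

This local controllability is proved for a fixed point z as follows. Call a vector field Z
realizable if for every eta and eps, for all small s, one can move y near z to y + s Z(y) up to eta |s|,
continuously in s and y, with time and cost at most eps (not: proportional to s). The flows of the
f_i are realizable. If Z is realizable, so is [f_i, Z]: for a fixed small a, conjugate the motion
along Z for the time s/a by the flow of f_i for the time a. By the Jacobi identity these brackets
span the Lie algebra, so all directions at z are realizable, and Brouwer's theorem turns the
approximate motion into an exact one.

D is a fixed point of T_t by the same waiting argument. It is a viscosity subsolution by testing
with constant controls and a supersolution by testing with almost optimal trajectories on short
times, which stay near their end point because L >= |u|^2 / (2 l).
*)

theory Submission
  imports Defs
begin

section \<open>Calculus of smooth vector fields\<close>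

text \<open>The usual commutator of flows moves a point by s in a bracket direction in a time of
  order sqrt |s|, needs different loops for the two signs of s, and iterates badly because the roots
  pile up. Here the flow time a stays fixed and only the motion along Z is scaled. The loop is: -b
  along Z, a along X, b along Z, -a along X. It ends near y + a b [X,Z](y), linear in b for both
  signs; the first leg cancels the term b Z(y) that a mere conjugation would leave. The error is of
  order |b| (\<eta>' + a^2 + |b|), with \<eta>' the relative accuracy of the motion along Z.
  Compared with |s| = a |b| this is \<eta>'/a + a + |b|/a, so a is fixed first, and \<eta>' and the
  range of b afterwards. The price is a travelling time 2 a that does not shrink with s; it is
  harmless, because steering to nearby points only has to respect a small total budget, not one
  comparable to the distance. Continuity in (s, y) is carried through all constructions, because it
  is what Brouwer's theorem asks for.\<close>

lemma C_k_SucI: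
  assumes "\<And>x. (g has_derivative g' x) (at x)" "\<And>v. C_k k (\<lambda>x. g' x v)"
  shows "C_k (Suc k) g"
proof -
  have "frechet_derivative g (at x) = g' x" for x
    using frechet_derivative_at[OF assms(1)[of x]] by simp
  then show ?thesis
    using assms by (auto simp: differentiable_def)
qed

lemma C_k_has_derivative:
  assumes "C_k (Suc k) g"
  shows "(g has_derivative frechet_derivative g (at x)) (at x)"
  using assms by (simp add: frechet_derivative_works)

lemma C_k_Suc_imp: "C_k (Suc k) g \<Longrightarrow> C_k k g"
proof (induction k arbitrary: g)
  case 0
  then show ?case
    by (simp add: continuous_at_imp_continuous_on differentiable_imp_continuous_within)
next
  case (Suc k)
  then show ?case by (metis C_k.simps(2))
qed

lemma C_k_continuous: "C_k k g \<Longrightarrow> continuous_on S g"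
proof (induction k)
  case 0
  then show ?case using continuous_on_subset by auto
next
  case (Suc k)
  then show ?case using C_k_Suc_imp by blast
qed

lemma C_k_const: "C_k k (\<lambda>x. c)"
proof (induction k arbitrary: c)
  case (Suc k)
  then show ?case by (intro C_k_SucI[where g' = "\<lambda>_ _. 0"]) auto
qed auto

lemma C_k_add: "C_k k g \<Longrightarrow> C_k k h \<Longrightarrow> C_k k (\<lambda>x. g x + h x)"
proof (induction k arbitrary: g h)
  case 0
  then show ?case by (auto intro: continuous_on_add)
next
  case (Suc k)
  show ?case
    by (rule C_k_SucI[OF has_derivative_add[OF C_k_has_derivative[OF Suc.prems(1)]
            C_k_has_derivative[OF Suc.prems(2)]]])
      (use Suc in auto)
qed

lemma C_k_sum: "(\<And>i. i \<in> I \<Longrightarrow> C_k k (g i)) \<Longrightarrow> C_k k (\<lambda>x. \<Sum>i\<in>I. g i x)"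
  by (induction I rule: infinite_finite_induct) (auto intro: C_k_const C_k_add)

lemma C_k_bounded_linear:
  assumes "bounded_linear T"
  shows "C_k k g \<Longrightarrow> C_k k (\<lambda>x. T (g x))"
proof (induction k arbitrary: g)
  case 0
  then show ?case using assms linear_continuous_on_compose by (auto simp: bounded_linear.continuous_on)
next
  case (Suc k)
  show ?case
    by (rule C_k_SucI[OF bounded_linear.has_derivative[OF assms C_k_has_derivative[OF Suc.prems]]])
      (use Suc in auto)
qed

lemma C_k_scaleR:
  fixes g :: "'a::real_normed_vector \<Rightarrow> real"
  shows "C_k k g \<Longrightarrow> C_k k h \<Longrightarrow> C_k k (\<lambda>x. g x *\<^sub>R h x)"
proof (induction k arbitrary: g h)
  case 0
  then show ?case by (auto intro: continuous_on_scaleR)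
next
  case (Suc k)
  show ?case
    by (rule C_k_SucI[OF has_derivative_scaleR[OF C_k_has_derivative[OF Suc.prems(1)]
            C_k_has_derivative[OF Suc.prems(2)]]])
      (use Suc C_k_Suc_imp[OF Suc.prems(1)] C_k_Suc_imp[OF Suc.prems(2)] in \<open>auto intro!: C_k_add\<close>)
qed

text \<open>\<open>C_k\<close> speaks of fixed directions only. Expanding a direction in the basis
  is how uniform bounds over all directions, and derivatives in a direction that varies with x, are
  obtained from finitely many fixed ones.\<close>

lemma frechet_derivative_Basis:
  fixes g :: "'a::euclidean_space \<Rightarrow> 'b::real_normed_vector"
  assumes "g differentiable (at x)"
  shows "frechet_derivative g (at x) v = (\<Sum>b\<in>Basis. (v \<bullet> b) *\<^sub>R frechet_derivative g (at x) b)"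
proof -
  interpret linear "frechet_derivative g (at x)"
    using assms by (rule linear_frechet_derivative)
  have "frechet_derivative g (at x) v = frechet_derivative g (at x) (\<Sum>b\<in>Basis. (v \<bullet> b) *\<^sub>R b)"
    by (simp add: euclidean_representation)
  then show ?thesis by (simp add: sum scaleR)
qed

lemma C_k_directional:
  fixes g :: "'a::euclidean_space \<Rightarrow> 'b::real_normed_vector"
  assumes "C_k (Suc k) g" "C_k k h"
  shows "C_k k (\<lambda>x. frechet_derivative g (at x) (h x))"
proof -
  have "(\<lambda>x. frechet_derivative g (at x) (h x)) =
      (\<lambda>x. \<Sum>b\<in>Basis. (h x \<bullet> b) *\<^sub>R frechet_derivative g (at x) b)"
    using assms(1) by (auto intro!: frechet_derivative_Basis)
  moreover have "C_k k (\<lambda>x. \<Sum>b\<in>Basis. (h x \<bullet> b) *\<^sub>R frechet_derivative g (at x) b)"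
    using assms by (auto intro!: C_k_sum C_k_scaleR C_k_bounded_linear[OF bounded_linear_inner_left])
  ultimately show ?thesis by simp
qed

lemma smooth_directional:
  fixes g :: "'a::euclidean_space \<Rightarrow> 'b::real_normed_vector"
  assumes "smooth g" "smooth h"
  shows "smooth (\<lambda>x. frechet_derivative g (at x) (h x))"
  using assms C_k_directional unfolding smooth_def by blast

lemma smooth_add: "smooth g \<Longrightarrow> smooth h \<Longrightarrow> smooth (\<lambda>x. g x + h x)"
  by (auto simp: smooth_def intro: C_k_add)

lemma smooth_scale: "smooth g \<Longrightarrow> smooth (\<lambda>x. c *\<^sub>R g x)"
  by (auto simp: smooth_def intro: C_k_bounded_linear[OF bounded_linear_scaleR_right])

lemma smooth_lie_bracket:
  fixes X :: "'a::euclidean_space \<Rightarrow> 'a"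
  assumes "smooth X" "smooth Y"
  shows "smooth (lie_bracket X Y)"
proof -
  have "smooth (\<lambda>x. frechet_derivative Y (at x) (X x) + (-1) *\<^sub>R frechet_derivative X (at x) (Y x))"
    by (intro smooth_add smooth_scale smooth_directional assms)
  moreover have "lie_bracket X Y =
      (\<lambda>x. frechet_derivative Y (at x) (X x) + (-1) *\<^sub>R frechet_derivative X (at x) (Y x))"
    by (auto simp: lie_bracket_def)
  ultimately show ?thesis by simp
qed

section \<open>Uniform first and second order bounds on balls\<close>

lemma C_k_cball_bound:
  fixes g :: "'a::euclidean_space \<Rightarrow> 'b::real_normed_vector"
  assumes "C_k 1 g"
  obtains M where "M > 0" "\<And>x v. x \<in> cball z r \<Longrightarrow> norm (frechet_derivative g (at x) v) \<le> M * norm v"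
    "\<And>x y. x \<in> cball z r \<Longrightarrow> y \<in> cball z r \<Longrightarrow> norm (g y - g x) \<le> M * norm (y - x)"
    "\<And>x. x \<in> cball z r \<Longrightarrow> norm (g x) \<le> M"
proof -
  have D: "(g has_derivative frechet_derivative g (at x)) (at x)" for x
    using assms C_k_has_derivative by (metis One_nat_def)
  have "\<exists>B. \<forall>x\<in>cball z r. norm (frechet_derivative g (at x) b) \<le> B" for b
  proof -
    have "continuous_on (cball z r) (\<lambda>x. frechet_derivative g (at x) b)"
      using assms by (auto intro: continuous_on_subset)
    then have "bounded ((\<lambda>x. frechet_derivative g (at x) b) ` cball z r)"
      by (intro compact_imp_bounded compact_continuous_image) auto
    then show ?thesis by (auto simp: bounded_iff)
  qed
  then obtain B where B: "\<And>b x. x \<in> cball z r \<Longrightarrow> norm (frechet_derivative g (at x) b) \<le> B b"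
    by metis
  have "bounded (g ` cball z r)"
    using assms C_k_continuous[of 1 g]
    by (intro compact_imp_bounded compact_continuous_image) auto
  then obtain C where C: "\<And>x. x \<in> cball z r \<Longrightarrow> norm (g x) \<le> C"
    unfolding bounded_iff by (metis imageI)
  \<comment> \<open>The last summand keeps \<open>M\<close> positive even if g vanishes. The sum
    over the basis bounds the operator norm, since every coordinate of v is at most |v|.\<close>
  define M where "M = \<bar>C\<bar> + (\<Sum>b\<in>Basis. \<bar>B b\<bar>) + 1"
  have Mpos: "M > 0" unfolding M_def by (smt (verit) abs_ge_zero sum_nonneg)
  have 1: "norm (frechet_derivative g (at x) v) \<le> M * norm v" if "x \<in> cball z r" for x v
  proof -
    have "g differentiable (at x)" using D differentiable_def by blast
    then have "norm (frechet_derivative g (at x) v) \<le>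
        (\<Sum>b\<in>Basis. norm ((v \<bullet> b) *\<^sub>R frechet_derivative g (at x) b))"
      by (subst frechet_derivative_Basis) (assumption, rule norm_sum)
    also have "\<dots> \<le> (\<Sum>b\<in>Basis. norm v * \<bar>B b\<bar>)"
      by (intro sum_mono) (auto intro!: mult_mono Basis_le_norm order_trans[OF B[OF that] abs_ge_self])
    also have "\<dots> \<le> M * norm v"
      unfolding sum_distrib_left[symmetric] M_def by (simp add: algebra_simps)
    finally show ?thesis .
  qed
  show ?thesis
  proof (rule that[OF Mpos 1])
    show "norm (g y - g x) \<le> M * norm (y - x)" if "x \<in> cball z r" "y \<in> cball z r" for x y
    proof (rule differentiable_bound[of "cball z r"])
      show "onorm (frechet_derivative g (at x)) \<le> M" if "x \<in> cball z r" for x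
        by (rule onorm_bound) (use Mpos 1[OF that] in auto)
    qed (use D that in \<open>auto intro: has_derivative_at_withinI\<close>)
    show "norm (g x) \<le> M" if "x \<in> cball z r" for x
      using C[OF that] unfolding M_def by (smt (verit) abs_ge_zero sum_nonneg)
  qed
qed

text \<open>One constant for values, Lipschitz bounds and Taylor remainder, so that the many error
  terms of a commutator can be collected as powers of a single number.\<close>

definition C2_bound ::
  "('a::real_normed_vector \<Rightarrow> 'b::real_normed_vector) \<Rightarrow> 'a set \<Rightarrow> real \<Rightarrow> bool" where
  "C2_bound g B M \<longleftrightarrow> M > 0 \<and> (\<forall>x\<in>B. norm (g x) \<le> M) \<and>
    (\<forall>x\<in>B. \<forall>v. norm (frechet_derivative g (at x) v) \<le> M * norm v) \<and>
    (\<forall>x\<in>B. \<forall>y\<in>B. norm (g y - g x) \<le> M * norm (y - x) \<and>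
      norm (g y - g x - frechet_derivative g (at x) (y - x)) \<le> M * (norm (y - x))\<^sup>2 \<and>
      (\<forall>v. norm (frechet_derivative g (at y) v - frechet_derivative g (at x) v) \<le> M * norm (y - x) * norm v))"

lemma C2_boundD:
  assumes "C2_bound g B M"
  shows "M > 0"
    and "x \<in> B \<Longrightarrow> norm (g x) \<le> M"
    and "x \<in> B \<Longrightarrow> norm (frechet_derivative g (at x) v) \<le> M * norm v"
    and "x \<in> B \<Longrightarrow> y \<in> B \<Longrightarrow> norm (g y - g x) \<le> M * norm (y - x)"
    and "x \<in> B \<Longrightarrow> y \<in> B \<Longrightarrow>
      norm (g y - g x - frechet_derivative g (at x) (y - x)) \<le> M * (norm (y - x))\<^sup>2"
    and "x \<in> B \<Longrightarrow> y \<in> B \<Longrightarrow>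
      norm (frechet_derivative g (at y) v - frechet_derivative g (at x) v) \<le> M * norm (y - x) * norm v"
  using assms unfolding C2_bound_def by blast+

text \<open>Allows two vector fields to share one constant, the maximum of their own.\<close>

lemma C2_bound_mono:
  assumes g: "C2_bound g B M" and "M \<le> N"
  shows "C2_bound g B N"
proof -
  have up: "t \<le> N * x" if "t \<le> M * x" "x \<ge> 0" for t x
    using that mult_right_mono[OF \<open>M \<le> N\<close>] by (meson order_trans)
  have up': "t \<le> N * x * y" if "t \<le> M * x * y" "x \<ge> 0" "y \<ge> 0" for t x y
    using up[of t "x * y"] that by (simp add: mult.assoc)
  show ?thesis
    unfolding C2_bound_def
  proof (intro conjI ballI allI)
    show "N > 0" using C2_boundD(1)[OF g] \<open>M \<le> N\<close> by linarith
  qed (use C2_boundD(2)[OF g] \<open>M \<le> N\<close> in force,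
      (rule up up' C2_boundD[OF g] norm_ge_zero zero_le_power2 | assumption)+)
qed

lemma C_2_cball_bound:
  fixes g :: "'a::euclidean_space \<Rightarrow> 'b::real_normed_vector"
  assumes "C_k 2 g"
  shows "\<exists>M. C2_bound g (cball z r) M"
proof -
  have g2: "C_k (Suc (Suc 0)) g" using assms by (simp add: numeral_2_eq_2)
  then have g1: "C_k 1 g" using C_k_Suc_imp by (metis One_nat_def)
  have D: "(g has_derivative frechet_derivative g (at x)) (at x)" for x
    using g2 C_k_has_derivative by blast
  have diff: "g differentiable (at x)" for x using D differentiable_def by blast
  obtain M1 where M1: "M1 > 0" "\<And>x v. x \<in> cball z r \<Longrightarrow> norm (frechet_derivative g (at x) v) \<le> M1 * norm v"
    "\<And>x y. x \<in> cball z r \<Longrightarrow> y \<in> cball z r \<Longrightarrow> norm (g y - g x) \<le> M1 * norm (y - x)"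
    "\<And>x. x \<in> cball z r \<Longrightarrow> norm (g x) \<le> M1"
    using C_k_cball_bound[OF g1, of z r] by metis
  have "\<exists>B>0. \<forall>x\<in>cball z r. \<forall>y\<in>cball z r.
      norm (frechet_derivative g (at y) b - frechet_derivative g (at x) b) \<le> B * norm (y - x)" for b
  proof -
    have "C_k 1 (\<lambda>x. frechet_derivative g (at x) b)" using g2 by simp
    from C_k_cball_bound[OF this, of z r] show ?thesis by metis
  qed
  then obtain B where B: "\<And>b x y. x \<in> cball z r \<Longrightarrow> y \<in> cball z r \<Longrightarrow>
      norm (frechet_derivative g (at y) b - frechet_derivative g (at x) b) \<le> B b * norm (y - x)"
    and Bpos: "\<And>b. B b > 0"
    by metis
  define M where "M = M1 + (\<Sum>b\<in>Basis. B b)"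
  have SB: "(\<Sum>b\<in>Basis. B b) \<ge> 0" using Bpos by (meson less_imp_le sum_nonneg)
  have M: "M > 0" "M1 \<le> M" using M1(1) SB by (auto simp: M_def)
  have lip: "norm (frechet_derivative g (at y) v - frechet_derivative g (at x) v) \<le> M * norm (y - x) * norm v"
    if "x \<in> cball z r" "y \<in> cball z r" for x y v
  proof -
    have "frechet_derivative g (at y) v - frechet_derivative g (at x) v =
        (\<Sum>b\<in>Basis. (v \<bullet> b) *\<^sub>R (frechet_derivative g (at y) b - frechet_derivative g (at x) b))"
      using frechet_derivative_Basis[OF diff, of y v] frechet_derivative_Basis[OF diff, of x v]
      by (simp add: scaleR_diff_right sum_subtractf)
    also have "norm \<dots> \<le> (\<Sum>b\<in>Basis. norm v * (B b * norm (y - x)))"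
      using B[OF that] by (intro sum_norm_le) (auto intro!: mult_mono Basis_le_norm)
    also have "\<dots> = (\<Sum>b\<in>Basis. B b) * norm (y - x) * norm v"
      unfolding sum_distrib_left sum_distrib_right by (simp add: mult_ac)
    also have "\<dots> \<le> M * norm (y - x) * norm v"
      using M1 by (intro mult_right_mono) (auto simp: M_def)
    finally show ?thesis .
  qed
  have "C2_bound g (cball z r) M"
    unfolding C2_bound_def
  proof (intro conjI ballI allI lip M(1))
    show "norm (frechet_derivative g (at x) v) \<le> M * norm v" if "x \<in> cball z r" for x v
      using M1(2)[OF that, of v] M(2) by (meson mult_right_mono norm_ge_zero order_trans)
    show "norm (g y - g x) \<le> M * norm (y - x)" if "x \<in> cball z r" "y \<in> cball z r" for x y
      using M1(3)[OF that] M(2) by (meson mult_right_mono norm_ge_zero order_trans)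
    show "norm (g x) \<le> M" if "x \<in> cball z r" for x
      using M1(4)[OF that] M(2) by simp
    show "norm (g y - g x - frechet_derivative g (at x) (y - x)) \<le> M * (norm (y - x))\<^sup>2"
      if "x \<in> cball z r" "y \<in> cball z r" for x y
    proof -
      \<comment> \<open>On the segment |w - x| \<le> |y - x|, so the derivative varies by at most
        \<open>M * norm (y - x)\<close>. On the whole ball only the diameter would appear, and the
        remainder would not be quadratic.\<close>
      have cs: "closed_segment x y \<subseteq> cball z r"
        using that by (simp add: closed_segment_subset)
      have "norm (g y - g x - frechet_derivative g (at x) (y - x)) \<le> norm (y - x) * (M * norm (y - x))"
      proof (rule differentiable_bound_linearization[where S = "closed_segment x y" and f' = "\<lambda>x. frechet_derivative g (at x)"])
        show "x + t *\<^sub>R (y - x) \<in> closed_segment x y" if "t \<in> {0..1}" for t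
          using that by (force simp: closed_segment_def algebra_simps)
        show "onorm (frechet_derivative g (at w) - frechet_derivative g (at x)) \<le> M * norm (y - x)"
          if "w \<in> closed_segment x y" for w
        proof (rule onorm_bound)
          fix v :: 'a
          have "norm (w - x) \<le> norm (y - x)"
            using segment_bound(1)[OF that] by simp
          then have "M * norm (w - x) * norm v \<le> M * norm (y - x) * norm v"
            using M(1) by (intro mult_right_mono mult_left_mono) auto
          then show "norm ((frechet_derivative g (at w) - frechet_derivative g (at x)) v) \<le> M * norm (y - x) * norm v"
            using lip[of x w v] cs that \<open>x \<in> _\<close> by auto
        qed (use M(1) in auto)
      qed (use D in \<open>auto intro: has_derivative_at_withinI\<close>)
      then show ?thesis by (simp add: power2_eq_square mult_ac)
    qed
  qed
  then show ?thesis ..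
qed

section \<open>Symmetry of second derivatives and the Jacobi identity\<close>

lemma has_derivative_frechet_derivative_apply:
  fixes Z :: "'a::euclidean_space \<Rightarrow> 'b::real_normed_vector"
  assumes "C_k 2 Z" and W: "(W has_derivative W') (at x)"
  shows "((\<lambda>y. frechet_derivative Z (at y) (W y)) has_derivative
    (\<lambda>v. frechet_derivative (\<lambda>y. frechet_derivative Z (at y) (W x)) (at x) v
        + frechet_derivative Z (at x) (W' v))) (at x)"
proof -
  have Z2: "C_k (Suc (Suc 0)) Z" using assms by (simp add: numeral_2_eq_2)
  have diff: "Z differentiable (at x)" for x using Z2 by simp
  have Zb: "((\<lambda>y. frechet_derivative Z (at y) b) has_derivative
      frechet_derivative (\<lambda>y. frechet_derivative Z (at y) b) (at x)) (at x)" for b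
    using Z2 by (intro C_k_has_derivative[where k=0]) simp
  have eq: "(\<lambda>y. frechet_derivative Z (at y) (W y)) =
      (\<lambda>y. \<Sum>b\<in>Basis. (W y \<bullet> b) *\<^sub>R frechet_derivative Z (at y) b)" for W
    using frechet_derivative_Basis[OF diff] by blast
  have "((\<lambda>y. \<Sum>b\<in>Basis. (w \<bullet> b) *\<^sub>R frechet_derivative Z (at y) b) has_derivative
      (\<lambda>v. \<Sum>b\<in>Basis. (w \<bullet> b) *\<^sub>R frechet_derivative (\<lambda>y. frechet_derivative Z (at y) b) (at x) v)) (at x)" for w
    by (intro has_derivative_sum has_derivative_scaleR_right Zb)
  from frechet_derivative_at[OF this]
  have 1: "frechet_derivative (\<lambda>y. frechet_derivative Z (at y) w) (at x) =
      (\<lambda>v. \<Sum>b\<in>Basis. (w \<bullet> b) *\<^sub>R frechet_derivative (\<lambda>y. frechet_derivative Z (at y) b) (at x) v)" for w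
    using eq[of "\<lambda>_. w"] by simp
  have 2: "((\<lambda>y. frechet_derivative Z (at y) (W y)) has_derivative
      (\<lambda>v. \<Sum>b\<in>Basis. (W x \<bullet> b) *\<^sub>R frechet_derivative (\<lambda>y. frechet_derivative Z (at y) b) (at x) v
         + (W' v \<bullet> b) *\<^sub>R frechet_derivative Z (at x) b)) (at x)"
    unfolding eq[of W] by (intro has_derivative_sum has_derivative_scaleR has_derivative_inner_left W Zb)
  show ?thesis
    by (rule has_derivative_eq_rhs[OF 2])
      (simp only: 1[of "W x"] frechet_derivative_Basis[OF diff, of x "W' _"] sum.distrib)
qed

text \<open>A curve with velocity w has the derivative t \<mapsto> t w. This turns a speed bound
  into the form that the mean value inequality expects.\<close>

lemma onorm_scaleR_left_le: "norm w \<le> e \<Longrightarrow> onorm (\<lambda>t::real. t *\<^sub>R w) \<le> e"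
  by (intro onorm_le) (metis mult.commute mult_left_mono norm_ge_zero norm_scaleR real_norm_def)

text \<open>The mean value inequality is applied twice, inside in the direction u and outside in the
  direction v. The second difference is symmetric in u and v, while c is not visibly so; the
  symmetry of second derivatives comes from this.\<close>

lemma second_derivative_approx:
  fixes g :: "'a::euclidean_space \<Rightarrow> 'b::real_normed_vector" and x u v :: 'a
  assumes g: "C_k 2 g" and "e > 0"
  defines "c \<equiv> frechet_derivative (\<lambda>y. frechet_derivative g (at y) v) (at x) u"
  shows "\<forall>\<^sub>F s in at_right 0.
    norm (g (x + s *\<^sub>R u + s *\<^sub>R v) - g (x + s *\<^sub>R v) - g (x + s *\<^sub>R u) + g x - s\<^sup>2 *\<^sub>R c) \<le> e * s\<^sup>2"
proof -
  have g2: "C_k (Suc (Suc 0)) g" using assms by (simp add: numeral_2_eq_2)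
  define k where "k y = frechet_derivative (\<lambda>y. frechet_derivative g (at y) v) (at y) u" for y
  have "continuous_on UNIV k" using g2 by (simp add: k_def)
  then have "isCont k x" by (simp add: continuous_on_eq_continuous_at)
  then obtain d where d: "d > 0" "\<And>y. dist y x < d \<Longrightarrow> dist (k y) c < e"
    unfolding continuous_at_eps_delta c_def using \<open>e > 0\<close> by (metis k_def)
  have Dg: "(g has_derivative frechet_derivative g (at y)) (at y)" for y
    using g2 C_k_has_derivative by blast
  have Dv: "((\<lambda>y. frechet_derivative g (at y) v) has_derivative
      frechet_derivative (\<lambda>y. frechet_derivative g (at y) v) (at y)) (at y)" for y
    using g2 by (intro C_k_has_derivative[where k=0]) simp
  \<comment> \<open>The added 1 keeps \<open>n\<close> positive for u = v = 0. For s < d / n the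
    whole parallelogram spanned by s u and s v lies within distance d of x.\<close>
  define n where "n = norm u + norm v + 1"
  have npos: "n > 0" by (auto simp: n_def add_nonneg_pos)
  have main: "norm (g (x + s *\<^sub>R u + s *\<^sub>R v) - g (x + s *\<^sub>R v) - g (x + s *\<^sub>R u) + g x - s\<^sup>2 *\<^sub>R c) \<le> e * s\<^sup>2"
    if s: "0 < s" "s < d / n" for s
  proof -
    have near: "dist (x + r *\<^sub>R u + t *\<^sub>R v) x < d" if "0 \<le> r" "r \<le> s" "0 \<le> t" "t \<le> s" for r t
    proof -
      have "norm (r *\<^sub>R u + t *\<^sub>R v) \<le> s * norm u + s * norm v"
        by (rule order_trans[OF norm_triangle_ineq]) (use that in \<open>auto intro!: add_mono mult_right_mono\<close>)
      also have "\<dots> \<le> s * n" using s by (simp add: n_def algebra_simps)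
      also have "\<dots> < d" using s npos by (simp add: field_simps)
      finally show ?thesis by (simp add: dist_norm add.assoc)
    qed
    \<comment> \<open>\<open>w t\<close> is the derivative of \<open>?p\<close> at t. The inner mean
      value inequality, in the direction u, shows that it is at most e s.\<close>
    define w where "w t = frechet_derivative g (at (x + s *\<^sub>R u + t *\<^sub>R v)) v
        - frechet_derivative g (at (x + t *\<^sub>R v)) v - s *\<^sub>R c" for t
    have w: "norm (w t) \<le> e * s" if t: "0 \<le> t" "t \<le> s" for t
    proof -
      let ?q = "\<lambda>r. frechet_derivative g (at (x + r *\<^sub>R u + t *\<^sub>R v)) v - r *\<^sub>R c"
      have lin: "linear (frechet_derivative (\<lambda>y. frechet_derivative g (at y) v) (at y))" for y
        using Dv has_derivative_linear by blast
      have q: "(?q has_derivative (\<lambda>r'. r' *\<^sub>R (k (x + r *\<^sub>R u + t *\<^sub>R v) - c))) (at r within {0..s})" for r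
      proof -
        have "((\<lambda>r. x + r *\<^sub>R u + t *\<^sub>R v) has_derivative (\<lambda>r'. r' *\<^sub>R u)) (at r within {0..s})"
          by (auto intro!: derivative_eq_intros)
        from has_derivative_compose[OF this Dv]
        have "((\<lambda>r. frechet_derivative g (at (x + r *\<^sub>R u + t *\<^sub>R v)) v) has_derivative
          (\<lambda>r'. r' *\<^sub>R k (x + r *\<^sub>R u + t *\<^sub>R v))) (at r within {0..s})"
          by (simp add: k_def linear_scale[OF lin])
        then show ?thesis
          by (auto intro!: derivative_eq_intros simp: scaleR_diff_right)
      qed
      have "norm (?q s - ?q 0) \<le> e * norm (s - 0)"
      proof (rule differentiable_bound[OF _ q])
        show "onorm (\<lambda>r'. r' *\<^sub>R (k (x + r *\<^sub>R u + t *\<^sub>R v) - c)) \<le> e" if "r \<in> {0..s}" for r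
          using d(2)[OF near[of r t]] that t
          by (intro onorm_scaleR_left_le) (auto simp: dist_norm)
      qed (use s in auto)
      then show ?thesis using s by (simp add: w_def algebra_simps)
    qed
    let ?p = "\<lambda>t. g (x + s *\<^sub>R u + t *\<^sub>R v) - g (x + t *\<^sub>R v) - (t * s) *\<^sub>R c"
    have lin: "linear (frechet_derivative g (at y))" for y
      using Dg has_derivative_linear by blast
    have p: "(?p has_derivative (\<lambda>t'. t' *\<^sub>R w t)) (at t within {0..s})" for t
    proof -
      have "((\<lambda>t. z + t *\<^sub>R v) has_derivative (\<lambda>t'. t' *\<^sub>R v)) (at t within {0..s})" for z
        by (auto intro!: derivative_eq_intros)
      from has_derivative_compose[OF this Dg]
      have "((\<lambda>t. g (z + t *\<^sub>R v)) has_derivative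
          (\<lambda>t'. t' *\<^sub>R frechet_derivative g (at (z + t *\<^sub>R v)) v)) (at t within {0..s})" for z
        by (simp add: linear_scale[OF lin])
      note 1 = has_derivative_diff[OF this[of "x + s *\<^sub>R u"] this[of x]]
      have "((\<lambda>t. (t * s) *\<^sub>R c) has_derivative (\<lambda>t'. (t' * s) *\<^sub>R c)) (at t within {0..s})"
        by (intro bounded_linear_imp_has_derivative bounded_linear_intros)
      from has_derivative_diff[OF 1 this] show ?thesis
        by (simp add: w_def scaleR_diff_right)
    qed
    have "norm (?p s - ?p 0) \<le> (e * s) * norm (s - 0)"
    proof (rule differentiable_bound[OF _ p])
      show "onorm (\<lambda>t'. t' *\<^sub>R w t) \<le> e * s" if "t \<in> {0..s}" for t
        using w[of t] that by (intro onorm_scaleR_left_le) auto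
    qed (use s in auto)
    then have "norm (?p s - ?p 0) \<le> e * s\<^sup>2"
      using s by (simp only: power2_eq_square mult.assoc real_norm_def diff_0_right abs_of_pos)
    moreover have "?p s - ?p 0 = g (x + s *\<^sub>R u + s *\<^sub>R v) - g (x + s *\<^sub>R v) - g (x + s *\<^sub>R u) + g x - s\<^sup>2 *\<^sub>R c"
      by (simp add: power2_eq_square)
    ultimately show ?thesis by (simp only:)
  qed
  show ?thesis
    unfolding eventually_at_right_field
    by (rule exI[of _ "d / n"]) (use main d npos in auto)
qed

lemma symmetric_second_derivative:
  fixes g :: "'a::euclidean_space \<Rightarrow> 'b::real_normed_vector"
  assumes "C_k 2 g"
  shows "frechet_derivative (\<lambda>y. frechet_derivative g (at y) v) (at x) u =
    frechet_derivative (\<lambda>y. frechet_derivative g (at y) u) (at x) v" (is "?c = ?c'")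
proof (rule ccontr)
  assume "?c \<noteq> ?c'"
  \<comment> \<open>Both candidates are within e of the same second difference divided by s^2, so
    any e with 2 e < |c - c'| gives a contradiction.\<close>
  define e where "e = norm (?c - ?c') / 3"
  have e: "e > 0" using \<open>?c \<noteq> ?c'\<close> by (simp add: e_def)
  have "\<forall>\<^sub>F s in at_right 0. s > (0::real)" by (simp add: eventually_at_right_less)
  with second_derivative_approx[OF assms e, of x u v] second_derivative_approx[OF assms e, of x v u]
  have "\<forall>\<^sub>F s in at_right (0::real). False"
  proof eventually_elim
    case (elim s)
    let ?D = "g (x + s *\<^sub>R u + s *\<^sub>R v) - g (x + s *\<^sub>R v) - g (x + s *\<^sub>R u) + g x"
    have 1: "norm (?D - s\<^sup>2 *\<^sub>R ?c) \<le> e * s\<^sup>2" using elim by simp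
    have 2: "norm (?D - s\<^sup>2 *\<^sub>R ?c') \<le> e * s\<^sup>2" using elim by (simp add: algebra_simps)
    have "s\<^sup>2 *\<^sub>R (?c - ?c') = (?D - s\<^sup>2 *\<^sub>R ?c') - (?D - s\<^sup>2 *\<^sub>R ?c)"
      by (simp add: scaleR_diff_right)
    then have "s\<^sup>2 * norm (?c - ?c') \<le> e * s\<^sup>2 + e * s\<^sup>2"
      using 1 2 by (smt (verit) norm_scaleR norm_triangle_ineq4 zero_le_power2)
    then have "norm (?c - ?c') \<le> 2 * e" using elim(3) by (simp add: field_simps)
    then show ?case using e by (simp add: e_def)
  qed
  then show False by simp
qed

lemma frechet_derivative_lie_bracket:
  fixes W :: "'a::euclidean_space \<Rightarrow> 'a"
  assumes W: "C_k 2 W" and Z: "C_k 2 Z"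
  shows "frechet_derivative (lie_bracket W Z) (at x) v =
    frechet_derivative (\<lambda>y. frechet_derivative Z (at y) (W x)) (at x) v
    + frechet_derivative Z (at x) (frechet_derivative W (at x) v)
    - frechet_derivative (\<lambda>y. frechet_derivative W (at y) (Z x)) (at x) v
    - frechet_derivative W (at x) (frechet_derivative Z (at x) v)"
proof -
  have D: "(g has_derivative frechet_derivative g (at x)) (at x)" if "C_k 2 g" for g :: "'a \<Rightarrow> 'a"
    using that by (intro C_k_has_derivative[where k=1]) (simp add: numeral_2_eq_2)
  have "(lie_bracket W Z has_derivative (\<lambda>v. (frechet_derivative (\<lambda>y. frechet_derivative Z (at y) (W x)) (at x) v
    + frechet_derivative Z (at x) (frechet_derivative W (at x) v))
    - (frechet_derivative (\<lambda>y. frechet_derivative W (at y) (Z x)) (at x) v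
    + frechet_derivative W (at x) (frechet_derivative Z (at x) v)))) (at x)"
    unfolding lie_bracket_def[abs_def]
    by (intro has_derivative_diff has_derivative_frechet_derivative_apply W Z D)
  from frechet_derivative_at[OF this] show ?thesis
    by (metis (no_types, lifting) diff_diff_eq)
qed

text \<open>Second derivatives cancel in pairs by symmetry, and the compositions of first
  derivatives cancel by linearity. In this form a bracket as left factor is traded for brackets with
  simpler left factors.\<close>

lemma lie_bracket_Jacobi:
  fixes X :: "'a::euclidean_space \<Rightarrow> 'a"
  assumes X: "C_k 2 X" and W: "C_k 2 W" and Z: "C_k 2 Z"
  shows "lie_bracket (lie_bracket X W) Z =
    (\<lambda>x. lie_bracket X (lie_bracket W Z) x - lie_bracket W (lie_bracket X Z) x)"
proof
  fix x
  have lin: "linear (frechet_derivative g (at x))" if "C_k 2 g" for g :: "'a \<Rightarrow> 'a"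
    using that by (intro linear_frechet_derivative) (simp add: numeral_2_eq_2)
  note s = symmetric_second_derivative
  show "lie_bracket (lie_bracket X W) Z x =
    lie_bracket X (lie_bracket W Z) x - lie_bracket W (lie_bracket X Z) x"
    unfolding lie_bracket_def[of "lie_bracket _ _"] lie_bracket_def[of _ "lie_bracket _ _"]
      frechet_derivative_lie_bracket[OF W Z] frechet_derivative_lie_bracket[OF X Z]
      frechet_derivative_lie_bracket[OF X W]
    using s[OF X, of "W x" x "Z x"] s[OF W, of "X x" x "Z x"] s[OF Z, of "X x" x "W x"]
    by (simp add: lie_bracket_def linear_diff[OF lin[OF X]] linear_diff[OF lin[OF W]] linear_diff[OF lin[OF Z]])
qed

text \<open>Only generators may stand on the left of a bracket. Their flows are trajectories of the
  control system, whereas other elements of the Lie algebra are only followed approximately, and the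
  bracket step of the controllability argument uses one exact flow.\<close>

inductive_set left_normed_brackets ::
  "('a::real_normed_vector \<Rightarrow> 'a) set \<Rightarrow> ('a \<Rightarrow> 'a) set" for S where
  gen: "X \<in> S \<Longrightarrow> X \<in> left_normed_brackets S"
| zero: "(\<lambda>x. 0) \<in> left_normed_brackets S"
| add: "X \<in> left_normed_brackets S \<Longrightarrow> Y \<in> left_normed_brackets S
    \<Longrightarrow> (\<lambda>x. X x + Y x) \<in> left_normed_brackets S"
| scale: "X \<in> left_normed_brackets S \<Longrightarrow> (\<lambda>x. c *\<^sub>R X x) \<in> left_normed_brackets S"
| bracket: "X \<in> S \<Longrightarrow> Z \<in> left_normed_brackets S \<Longrightarrow> lie_bracket X Z \<in> left_normed_brackets S"

lemma smooth_left_normed_brackets: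
  fixes S :: "('a::euclidean_space \<Rightarrow> 'a) set"
  assumes "\<And>X. X \<in> S \<Longrightarrow> smooth X" "Z \<in> left_normed_brackets S"
  shows "smooth Z"
  using assms(2)
  by induction (auto intro: assms(1) smooth_add smooth_scale smooth_lie_bracket
      simp: smooth_def[of "\<lambda>x. 0"] C_k_const)

text \<open>Induction on the left factor with the right one arbitrary: for [[X,W],Z] the Jacobi
  identity leads to [W,[X,Z]], where the hypothesis on W is applied to the new right factor
  [X,Z].\<close>

lemma lie_bracket_in_left_normed_brackets:
  fixes S :: "('a::euclidean_space \<Rightarrow> 'a) set"
  assumes S: "\<And>X. X \<in> S \<Longrightarrow> smooth X"
    and "X \<in> left_normed_brackets S" "Z \<in> left_normed_brackets S"
  shows "lie_bracket X Z \<in> left_normed_brackets S"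
  using assms(2,3)
proof (induction arbitrary: Z)
  case (gen X)
  then show ?case by (rule left_normed_brackets.bracket)
next
  case zero
  have "linear (frechet_derivative Z (at x))" for x
    using smooth_left_normed_brackets[OF S zero] unfolding smooth_def
    by (metis C_k.simps(2) linear_frechet_derivative)
  then have "lie_bracket (\<lambda>x. 0) Z = (\<lambda>x. 0)"
    by (auto simp: lie_bracket_def linear_0)
  then show ?case by (simp add: left_normed_brackets.zero)
next
  case (add X Y)
  have d: "W differentiable (at x)" if "W \<in> left_normed_brackets S" for W x
    using smooth_left_normed_brackets[OF S that] unfolding smooth_def by (metis C_k.simps(2))
  have D: "frechet_derivative (\<lambda>x. X x + Y x) (at x) =
      (\<lambda>v. frechet_derivative X (at x) v + frechet_derivative Y (at x) v)" for x
    using d[OF add.hyps(1)] d[OF add.hyps(2)]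
    by (intro frechet_derivative_at[symmetric] has_derivative_add) (auto simp: frechet_derivative_works)
  have "lie_bracket (\<lambda>x. X x + Y x) Z = (\<lambda>x. lie_bracket X Z x + lie_bracket Y Z x)"
    by (auto simp: lie_bracket_def D linear_add[OF linear_frechet_derivative[OF d[OF add.prems]]])
  with add show ?case by (simp add: left_normed_brackets.add)
next
  case (scale X c)
  have d: "W differentiable (at x)" if "W \<in> left_normed_brackets S" for W x
    using smooth_left_normed_brackets[OF S that] unfolding smooth_def by (metis C_k.simps(2))
  have D: "frechet_derivative (\<lambda>x. c *\<^sub>R X x) (at x) = (\<lambda>v. c *\<^sub>R frechet_derivative X (at x) v)" for x
    using d[OF scale.hyps(1)]
    by (intro frechet_derivative_at[symmetric] has_derivative_scaleR_right) (auto simp: frechet_derivative_works)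
  have "lie_bracket (\<lambda>x. c *\<^sub>R X x) Z = (\<lambda>x. c *\<^sub>R lie_bracket X Z x)"
    by (auto simp: lie_bracket_def D linear_scale[OF linear_frechet_derivative[OF d[OF scale.prems]]] scaleR_diff_right)
  with scale show ?case by (simp add: left_normed_brackets.scale)
next
  case (bracket X W)
  have C: "C_k 2 V" if "V \<in> left_normed_brackets S" for V
    using smooth_left_normed_brackets[OF S that] by (simp add: smooth_def)
  have "(\<lambda>x. lie_bracket X (lie_bracket W Z) x + (-1) *\<^sub>R lie_bracket W (lie_bracket X Z) x)
      \<in> left_normed_brackets S"
    using bracket by (intro left_normed_brackets.add left_normed_brackets.scale)
      (auto intro: left_normed_brackets.bracket)
  moreover have "lie_bracket (lie_bracket X W) Z =
      (\<lambda>x. lie_bracket X (lie_bracket W Z) x + (-1) *\<^sub>R lie_bracket W (lie_bracket X Z) x)"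
    using bracket by (subst lie_bracket_Jacobi) (auto intro: C left_normed_brackets.gen)
  ultimately show ?case by simp
qed

lemma lie_algebra_generated_left_normed:
  fixes S :: "('a::euclidean_space \<Rightarrow> 'a) set"
  assumes S: "\<And>X. X \<in> S \<Longrightarrow> smooth X"
    and "X \<in> lie_algebra_generated S"
  shows "X \<in> left_normed_brackets S"
  using assms(2)
  by induction (auto intro: left_normed_brackets.intros lie_bracket_in_left_normed_brackets[OF S])

section \<open>Local flows\<close>

text \<open>Picard's fixed point argument in the complete space of bounded continuous functions on
  the whole line. The contraction estimate allows two different initial points at once; at the fixed
  points it yields Lipschitz dependence with constant 2.\<close>

lemma lipschitz_flow_exists:
  fixes G :: "'a::euclidean_space \<Rightarrow> 'a"
  assumes lip: "\<And>x y. norm (G x - G y) \<le> K * norm (x - y)"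
    and K: "0 < K" and h: "0 < h" "h * K \<le> 1/6"
  shows "\<exists>E. (\<forall>w. E 0 w = w) \<and>
    (\<forall>w. \<forall>t\<in>{-h..h}. ((\<lambda>s. E s w) has_vector_derivative G (E t w)) (at t within {-h..h})) \<and>
    (\<forall>w w' t. norm (E t w - E t w') \<le> 2 * norm (w - w'))"
proof -
  have Gcont: "continuous_on UNIV G"
    using lipschitz_on_continuous_on[OF lipschitz_onI, of UNIV G K] lip K by (simp add: dist_norm)
  \<comment> \<open>Time is clamped to [-h, h]: the curves are constant beyond it and therefore
    bounded.\<close>
  define cl where "cl t = max (-h) (min h t)" for t :: real
  have cl: "-h \<le> cl t" "cl t \<le> h" for t using h by (auto simp: cl_def)
  have cl_id: "cl t = t" if "t \<in> {-h..h}" for t using that by (auto simp: cl_def)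
  have cl_cont: "continuous_on UNIV cl" unfolding cl_def[abs_def] by (intro continuous_intros)
  \<comment> \<open>The integral from 0 to t is a difference of integrals starting at -h, which
    covers negative t as well. The two lengths of integration add up to at most 3 h, whence
    \<open>h * K \<le> 1/6\<close> for the contraction factor 1/2.\<close>
  define F where "F w y t = w + integral {-h..cl t} (\<lambda>s. G (y s)) - integral {-h..0} (\<lambda>s. G (y s))"
    for w and y :: "real \<Rightarrow> 'a" and t
  have Gy: "continuous_on S (\<lambda>s. G (apply_bcontfun y s))" for S and y :: "real \<Rightarrow>\<^sub>C 'a"
    by (rule continuous_on_compose2[OF Gcont]) auto
  have int: "(\<lambda>s. G (apply_bcontfun y s)) integrable_on {a..b}" for a b and y :: "real \<Rightarrow>\<^sub>C 'a"
    by (intro integrable_continuous_interval Gy)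
  have cont: "continuous_on {-h..h} (\<lambda>c. integral {-h..c} (\<lambda>s. G (apply_bcontfun y s)))" for y :: "real \<Rightarrow>\<^sub>C 'a"
    by (intro indefinite_integral_continuous_1 int)
  have Fb: "F w (apply_bcontfun y) \<in> bcontfun" for w and y :: "real \<Rightarrow>\<^sub>C 'a"
  proof -
    have c: "continuous_on UNIV (F w (apply_bcontfun y))"
      unfolding F_def by (intro continuous_intros continuous_on_compose2[OF cont cl_cont]) (use cl in auto)
    have "range (F w (apply_bcontfun y)) \<subseteq> F w (apply_bcontfun y) ` {-h..h}"
      using cl cl_id unfolding F_def by (auto intro!: image_eqI[where x = "cl _"])
    moreover have "bounded (F w (apply_bcontfun y) ` {-h..h})"
      using c by (intro compact_imp_bounded compact_continuous_image) (auto intro: continuous_on_subset)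
    ultimately show ?thesis using c bounded_subset by (auto simp: bcontfun_def)
  qed
  define P where "P w y = Bcontfun (F w (apply_bcontfun y))" for w y
  have P: "apply_bcontfun (P w y) t = F w (apply_bcontfun y) t" for w y t
    unfolding P_def by (simp add: Bcontfun_inverse Fb)
  have diffint: "norm (integral {-h..c} (\<lambda>s. G (apply_bcontfun y s)) - integral {-h..c} (\<lambda>s. G (apply_bcontfun y' s)))
      \<le> K * dist y y' * (c + h)" if "-h \<le> c" for c y y'
  proof -
    have "integral {-h..c} (\<lambda>s. G (apply_bcontfun y s)) - integral {-h..c} (\<lambda>s. G (apply_bcontfun y' s))
       = integral {-h..c} (\<lambda>s. G (apply_bcontfun y s) - G (apply_bcontfun y' s))"
      by (rule integral_diff[symmetric]) (rule int)+
    also have "norm \<dots> \<le> K * dist y y' * (c - (-h))"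
    proof (rule integral_bound[OF that])
      show "continuous_on {-h..c} (\<lambda>s. G (apply_bcontfun y s) - G (apply_bcontfun y' s))"
        by (intro continuous_on_diff Gy)
      show "norm (G (apply_bcontfun y s) - G (apply_bcontfun y' s)) \<le> K * dist y y'" for s
        using lip[of "apply_bcontfun y s" "apply_bcontfun y' s"] dist_bounded[of y s y'] K
        by (smt (verit) dist_norm mult_left_mono)
    qed
    finally show ?thesis by simp
  qed
  have contr: "dist (P w y) (P w' y') \<le> norm (w - w') + 1/2 * dist y y'" for w w' y y'
  proof (rule dist_bound)
    fix t
    let ?D = "\<lambda>c. integral {-h..c} (\<lambda>s. G (apply_bcontfun y s)) - integral {-h..c} (\<lambda>s. G (apply_bcontfun y' s))"
    have 1: "norm (?D (cl t)) \<le> K * dist y y' * (2 * h)"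
      using diffint[OF cl(1)[of t], of y y'] cl(2)[of t] K
      by (smt (verit) mult_left_mono mult_nonneg_nonneg zero_le_dist)
    have 2: "norm (?D 0) \<le> K * dist y y' * h"
      using diffint[of 0 y y'] h by simp
    have "dist (P w y t) (P w' y' t) = norm ((w - w') + ?D (cl t) - ?D 0)"
      unfolding P F_def dist_norm by (simp add: algebra_simps)
    also have "\<dots> \<le> norm (w - w') + norm (?D (cl t)) + norm (?D 0)"
      by (meson add_right_mono norm_triangle_ineq norm_triangle_ineq4 order_trans)
    also have "\<dots> \<le> norm (w - w') + K * dist y y' * (3 * h)" using 1 2 by (simp add: algebra_simps)
    also have "K * dist y y' * (3 * h) = (h * K) * (3 * dist y y')" by simp
    also have "\<dots> \<le> 1/6 * (3 * dist y y')" by (intro mult_right_mono h) auto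
    finally show "dist (P w y t) (P w' y' t) \<le> norm (w - w') + 1/2 * dist y y'" by simp
  qed
  have "\<exists>!y. P w y = y" for w
    using contr[of w _ w] by (intro banach_fix_type[where c = "1/2"]) auto
  then obtain Y where Y: "\<And>w. P w (Y w) = Y w" by metis
  define E where "E t w = apply_bcontfun (Y w) t" for t w
  have E: "E t w = F w (apply_bcontfun (Y w)) t" for t w
    unfolding E_def P[symmetric] Y ..
  show ?thesis
  proof (intro exI[of _ E] conjI allI ballI)
    show "E 0 w = w" for w unfolding E F_def using h by (simp add: cl_def)
    show "norm (E t w - E t w') \<le> 2 * norm (w - w')" for t w w'
      using contr[of w "Y w" w' "Y w'"] dist_bounded[of "Y w" t "Y w'"]
      unfolding Y E_def dist_norm by simp
    show "((\<lambda>s. E s w) has_vector_derivative G (E t w)) (at t within {-h..h})" if t: "t \<in> {-h..h}" for w t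
    proof (rule has_vector_derivative_transform[OF t])
      show "E s w = w + integral {-h..s} (\<lambda>s. G (E s w)) - integral {-h..0} (\<lambda>s. G (E s w))"
        if "s \<in> {-h..h}" for s
        using cl_id[OF that] by (subst E) (simp add: F_def E_def)
      show "((\<lambda>s. w + integral {-h..s} (\<lambda>s. G (E s w)) - integral {-h..0} (\<lambda>s. G (E s w)))
        has_vector_derivative G (E t w)) (at t within {-h..h})"
        using integral_has_vector_derivative[of "-h" h "\<lambda>s. G (E s w)" t] t Gy
        by (auto intro!: derivative_eq_intros simp: E_def)
    qed
  qed
qed

text \<open>On so short an interval the maximal deviation N of the two solutions satisfies N \<le> K
  N (b - a) \<le> N / 2. The common point c may lie anywhere, so times before and after it are
  treated together.\<close>

lemma lipschitz_ode_unique: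
  fixes G :: "'a::euclidean_space \<Rightarrow> 'a"
  assumes lip: "\<And>x y. norm (G x - G y) \<le> K * norm (x - y)" and "0 < K"
    and len: "(b - a) * K \<le> 1/2" and c: "c \<in> {a..b}" "y c = z c"
    and y: "\<And>t. t \<in> {a..b} \<Longrightarrow> (y has_vector_derivative G (y t)) (at t within {a..b})"
    and z: "\<And>t. t \<in> {a..b} \<Longrightarrow> (z has_vector_derivative G (z t)) (at t within {a..b})"
    and t: "t \<in> {a..b}"
  shows "y t = z t"
proof -
  have "continuous_on {a..b} (\<lambda>t. norm (y t - z t))"
    using y z by (intro continuous_intros continuous_on_vector_derivative)
  then obtain m where m: "m \<in> {a..b}" "\<And>t. t \<in> {a..b} \<Longrightarrow> norm (y t - z t) \<le> norm (y m - z m)"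
    using continuous_attains_sup[of "{a..b}" "\<lambda>t. norm (y t - z t)"] c by auto
  let ?N = "norm (y m - z m)"
  have "norm ((y m - z m) - (y c - z c)) \<le> (K * ?N) * norm (m - c)"
  proof (rule differentiable_bound[where S = "{a..b}"])
    show "((\<lambda>t. y t - z t) has_derivative (\<lambda>s. s *\<^sub>R (G (y t) - G (z t)))) (at t within {a..b})"
      if "t \<in> {a..b}" for t
      using has_vector_derivative_diff[OF y[OF that] z[OF that]] by (simp add: has_vector_derivative_def)
    show "onorm (\<lambda>s. s *\<^sub>R (G (y t) - G (z t))) \<le> K * ?N" if "t \<in> {a..b}" for t
      using lip[of "y t" "z t"] m(2)[OF that] \<open>0 < K\<close>
      by (intro onorm_scaleR_left_le) (smt (verit) mult_left_mono)
  qed (use m c in auto)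
  also have "\<dots> \<le> (K * ?N) * (b - a)"
    using m(1) c \<open>0 < K\<close> by (intro mult_left_mono) auto
  also have "\<dots> = ((b - a) * K) * ?N" by simp
  also have "\<dots> \<le> 1/2 * ?N" by (intro mult_right_mono len) auto
  finally have "?N \<le> 0" using c by simp
  then show ?thesis using m(2)[OF t] by simp
qed

text \<open>Models the flow of a globally Lipschitz truncation of X. Hence continuity, Lipschitz
  dependence and the inverse law are stated for all points, but the equation with X itself only for
  starting points in the ball of radius r, whose orbits stay in the ball of radius 2 r.\<close>

definition local_flow_of ::
  "('a::euclidean_space \<Rightarrow> 'a) \<Rightarrow> 'a \<Rightarrow> real \<Rightarrow> real \<Rightarrow> (real \<Rightarrow> 'a \<Rightarrow> 'a) \<Rightarrow> bool" where
  "local_flow_of X z r h E \<longleftrightarrow> h > 0 \<and> (\<forall>w. E 0 w = w) \<and>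
    (\<forall>t\<in>{-h..h}. \<forall>w\<in>cball z r. E t w \<in> cball z (2 * r) \<and>
       ((\<lambda>s. E s w) has_vector_derivative X (E t w)) (at t within {-h..h})) \<and>
    continuous_on ({-h..h} \<times> UNIV) (\<lambda>(t, w). E t w) \<and>
    (\<forall>t w w'. norm (E t w - E t w') \<le> 2 * norm (w - w')) \<and>
    (\<forall>t\<in>{-h..h}. \<forall>w. E (- t) (E t w) = w)"

lemma local_flow_of_exists:
  fixes X :: "'a::euclidean_space \<Rightarrow> 'a"
  assumes X: "C_k 1 X" and r: "r > 0"
  shows "\<exists>h E. local_flow_of X z r h E"
proof -
  obtain M where M: "M > 0"
    "\<And>x y. x \<in> cball z (2*r) \<Longrightarrow> y \<in> cball z (2*r) \<Longrightarrow> norm (X y - X x) \<le> M * norm (y - x)"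
    "\<And>x. x \<in> cball z (2*r) \<Longrightarrow> norm (X x) \<le> M"
    using C_k_cball_bound[OF X, of z "2*r"] by metis
  \<comment> \<open>Composing X with the projection onto the larger ball makes it globally Lipschitz
    and bounded without changing it on that ball.\<close>
  define \<pi> where "\<pi> = closest_point (cball z (2*r))"
  have pi: "\<pi> x \<in> cball z (2*r)" for x
    unfolding \<pi>_def using r by (intro closest_point_in_set) auto
  have pi_id: "\<pi> x = x" if "x \<in> cball z (2*r)" for x
    using closest_point_self[OF that] by (simp add: \<pi>_def)
  have pi_lip: "norm (\<pi> x - \<pi> y) \<le> norm (x - y)" for x y
    using closest_point_lipschitz[of "cball z (2*r)" x y] r by (simp add: \<pi>_def dist_norm)
  define G where "G x = X (\<pi> x)" for x
  have lip: "norm (G x - G y) \<le> M * norm (x - y)" for x y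
    using M(2)[OF pi[of y] pi[of x]] pi_lip[of x y] M(1) unfolding G_def
    by (smt (verit) mult_left_mono)
  have GM: "norm (G x) \<le> M" for x unfolding G_def using M(3) pi by blast
  \<comment> \<open>The bound r / M keeps orbits that start in \<open>cball z r\<close> inside
    \<open>cball z (2 * r)\<close>, where the truncation is invisible; 1 / (6 M) serves the fixed
    point argument.\<close>
  define h where "h = min (r / M) (1 / (6 * M))"
  have h: "h > 0" "h * M \<le> 1/6" "h * M \<le> r"
    using M(1) r by (auto simp: h_def min_def field_simps)
  obtain E where E0: "\<And>w. E 0 w = w"
    and E: "\<And>w t. t\<in>{-h..h} \<Longrightarrow> ((\<lambda>s. E s w) has_vector_derivative G (E t w)) (at t within {-h..h})"
    and El: "\<And>w w' t. norm (E t w - E t w') \<le> 2 * norm (w - w')"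
    using lipschitz_flow_exists[OF lip M(1) h(1,2)] by blast
  have Et: "norm (E t w - E s w) \<le> M * norm (t - s)" if "t \<in> {-h..h}" "s \<in> {-h..h}" for t s w
  proof (rule differentiable_bound[where S = "{-h..h}"])
    show "((\<lambda>s. E s w) has_derivative (\<lambda>s. s *\<^sub>R G (E t w))) (at t within {-h..h})" if "t \<in> {-h..h}" for t
      using E[OF that] by (simp add: has_vector_derivative_def)
    show "onorm (\<lambda>s. s *\<^sub>R G (E t w)) \<le> M" for t
      by (rule onorm_scaleR_left_le[OF GM])
  qed (use that in auto)
  have near: "E t w \<in> cball z (2 * r)" if t: "t \<in> {-h..h}" and w: "w \<in> cball z r" for t w
  proof -
    have "norm (E t w - w) \<le> M * norm t"
      using Et[OF t, of 0 w] h E0 by simp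
    also have "\<dots> \<le> M * h" using t M(1) by (intro mult_left_mono) auto
    also have "\<dots> \<le> r" using h(3) by (simp add: mult.commute)
    finally have "dist w (E t w) \<le> r" by (metis dist_norm dist_commute)
    then show ?thesis using w dist_triangle[of z "E t w" w] by simp
  qed
  have "local_flow_of X z r h E"
    unfolding local_flow_of_def
  proof (intro conjI ballI allI)
    show "((\<lambda>s. E s w) has_vector_derivative X (E t w)) (at t within {-h..h})"
      if "t \<in> {-h..h}" "w \<in> cball z r" for t w
      using E[OF that(1), of w] pi_id[OF near[OF that]] by (simp add: G_def)
    show "continuous_on ({-h..h} \<times> UNIV) (\<lambda>(t, w). E t w)"
    proof (rule lipschitz_on_continuous_on[of "M + 2"], rule lipschitz_onI)
      fix p q assume pq: "p \<in> {-h..h} \<times> (UNIV::'a set)" "q \<in> {-h..h} \<times> (UNIV::'a set)"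
      obtain t w s v where [simp]: "p = (t, w)" "q = (s, v)" by (cases p, cases q)
      have "dist (E t w) (E s v) \<le> norm (E t w - E s w) + norm (E s w - E s v)"
        using norm_triangle_ineq[of "E t w - E s w" "E s w - E s v"] by (simp add: dist_norm)
      also have "\<dots> \<le> M * dist t s + 2 * dist w v"
        using Et[of t s w] El[of s w v] pq by (auto simp: dist_norm intro: add_mono)
      also have "\<dots> \<le> M * dist p q + 2 * dist p q"
        using M(1) dist_fst_le[of p q] dist_snd_le[of p q] by (intro add_mono mult_left_mono) auto
      finally show "dist (case p of (t, w) \<Rightarrow> E t w) (case q of (t, w) \<Rightarrow> E t w) \<le> (M + 2) * dist p q"
        by (simp add: algebra_simps)
    qed (use M in auto)
    show "E (- t) (E t w) = w" if t: "t \<in> {-h..h}" for t w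
    proof -
      \<comment> \<open>The interval between 0 and -t for either sign of t. On it E (t + s) w and E
        s (E t w), as functions of s, solve the same equation and agree at s = 0; at s = -t this is
        the inverse law.\<close>
      let ?I = "{min 0 (-t)..max 0 (-t)}"
      have len: "(max 0 (-t) - min 0 (-t)) * M \<le> 1/2"
      proof -
        have "(max 0 (-t) - min 0 (-t)) * M \<le> h * M" using t M(1) by (intro mult_right_mono) auto
        then show ?thesis using h by simp
      qed
      have sub: "(\<lambda>s. t + s) ` ?I \<subseteq> {-h..h}" "?I \<subseteq> {-h..h}" using t by auto
      have "E (t + (- t)) w = E (- t) (E t w)"
      proof (rule lipschitz_ode_unique[OF lip M(1) len, of 0 "\<lambda>s. E (t + s) w" "\<lambda>s. E s (E t w)"])
        show "((\<lambda>s. E (t + s) w) has_vector_derivative G (E (t + s) w)) (at s within ?I)" if "s \<in> ?I" for s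
        proof -
          have "((\<lambda>s. E s w) \<circ> (\<lambda>s. t + s) has_vector_derivative 1 *\<^sub>R G (E (t + s) w)) (at s within ?I)"
          proof (rule vector_diff_chain_within)
            show "((\<lambda>s. t + s) has_vector_derivative 1) (at s within ?I)"
              by (auto intro!: derivative_eq_intros)
            show "((\<lambda>s. E s w) has_vector_derivative G (E (t + s) w)) (at (t + s) within (\<lambda>s. t + s) ` ?I)"
              by (rule has_vector_derivative_within_subset[OF E sub(1)]) (use that sub in auto)
          qed
          then show ?thesis by (simp add: o_def)
        qed
        show "((\<lambda>s. E s (E t w)) has_vector_derivative G (E s (E t w))) (at s within ?I)" if "s \<in> ?I" for s
          by (rule has_vector_derivative_within_subset[OF E sub(2)]) (use that sub in auto)
      qed (use E0 in auto)
      then show ?thesis by (simp add: E0)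
    qed
  qed (use h E0 near El in auto)
  then show ?thesis by blast
qed

lemma norm_add3_le: "norm (a + b + c) \<le> norm a + norm b + norm c"
  for a b c :: "'a::real_normed_vector"
  by (meson add_right_mono norm_triangle_ineq order_trans)

text \<open>Along the orbit the velocity differs from X w by at most M times the distance M |t|
  travelled; the mean value inequality turns this into the quadratic remainder.\<close>

lemma local_flow_expansion:
  fixes X :: "'a::euclidean_space \<Rightarrow> 'a"
  assumes E: "local_flow_of X z r h E" and M: "M > 0"
    and XM: "\<And>x. x \<in> cball z (2*r) \<Longrightarrow> norm (X x) \<le> M"
    and XL: "\<And>x y. x \<in> cball z (2*r) \<Longrightarrow> y \<in> cball z (2*r) \<Longrightarrow> norm (X y - X x) \<le> M * norm (y - x)"
    and w: "w \<in> cball z r"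
  shows "s \<in> {-h..h} \<Longrightarrow> t \<in> {-h..h} \<Longrightarrow> norm (E t w - E s w) \<le> M * \<bar>t - s\<bar>"
    and "t \<in> {-h..h} \<Longrightarrow> norm (E t w - w - t *\<^sub>R X w) \<le> M\<^sup>2 * t\<^sup>2"
proof -
  have h: "h > 0" and E0: "E 0 w = w" using E by (auto simp: local_flow_of_def)
  have D: "((\<lambda>s. E s w) has_derivative (\<lambda>s. s *\<^sub>R X (E t w))) (at t within {-h..h})"
    and B: "E t w \<in> cball z (2*r)" if "t \<in> {-h..h}" for t
    using E that w by (auto simp: local_flow_of_def has_vector_derivative_def)
  show *: "norm (E t w - E s w) \<le> M * \<bar>t - s\<bar>" if "s \<in> {-h..h}" "t \<in> {-h..h}" for s t
    using differentiable_bound[of "{-h..h}", OF _ D onorm_scaleR_left_le[OF XM[OF B]] that(2,1)] by simp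
  show "norm (E t w - w - t *\<^sub>R X w) \<le> M\<^sup>2 * t\<^sup>2" if t: "t \<in> {-h..h}"
  proof -
    let ?I = "{min 0 t..max 0 t}"
    have I: "?I \<subseteq> {-h..h}" using t by auto
    have "norm ((E t w - t *\<^sub>R X w) - (E 0 w - 0 *\<^sub>R X w)) \<le> (M * (M * \<bar>t\<bar>)) * norm (t - 0)"
    proof (rule differentiable_bound[where S = ?I])
      show "((\<lambda>s. E s w - s *\<^sub>R X w) has_derivative (\<lambda>s'. s' *\<^sub>R (X (E s w) - X w))) (at s within ?I)"
        if "s \<in> ?I" for s
      proof -
        have s: "s \<in> {-h..h}" using that I by blast
        have "((\<lambda>s. s *\<^sub>R X w) has_derivative (\<lambda>s'. s' *\<^sub>R X w)) (at s within ?I)"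
          by (intro bounded_linear_imp_has_derivative bounded_linear_scaleR_left)
        from has_derivative_diff[OF has_derivative_subset[OF D[OF s] I] this]
        show ?thesis by (simp add: scaleR_diff_right)
      qed
      show "onorm (\<lambda>s'. s' *\<^sub>R (X (E s w) - X w)) \<le> M * (M * \<bar>t\<bar>)" if "s \<in> ?I" for s
      proof (rule onorm_scaleR_left_le)
        have s: "s \<in> {-h..h}" using that I by blast
        have "norm (X (E s w) - X w) \<le> M * norm (E s w - w)"
          using XL[of w "E s w"] B[OF s] B[of 0] E0 h by simp
        also have "norm (E s w - w) \<le> M * \<bar>s\<bar>"
          using *[of 0 s] s h E0 by simp
        also have "M * \<bar>s\<bar> \<le> M * \<bar>t\<bar>"
          using that M by (intro mult_left_mono) auto
        finally show "norm (X (E s w) - X w) \<le> M * (M * \<bar>t\<bar>)" using M by simp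
      qed
    qed auto
    then show ?thesis by (simp add: E0 power2_eq_square algebra_simps)
  qed
qed

text \<open>Pushing the displacement \<open>d\<close> at \<open>E a w\<close> back along the flow multiplies it by
  \<open>I - a DX(w)\<close> up to terms of higher order; this is where the brackets come from.\<close>

lemma local_flow_pull_back:
  fixes X :: "'a::euclidean_space \<Rightarrow> 'a"
  assumes E: "local_flow_of X z r h E" and C2: "C2_bound X (cball z (2 * r)) M"
    and lin: "\<And>x. linear (frechet_derivative X (at x))"
    and w: "w \<in> cball z r" and a: "0 \<le> a" "a \<le> h" and Ea: "E a w \<in> cball z r"
    and d: "E a w + d \<in> cball z r"
  shows "norm (E (- a) (E a w + d) - w - d + a *\<^sub>R frechet_derivative X (at w) d)
    \<le> a * (4 * M * (norm d)\<^sup>2 + 4 * M\<^sup>2 * a * norm d)"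
proof -
  note M = C2_boundD(1)[OF C2] and XM = C2_boundD(2)[OF C2] and XD = C2_boundD(3)[OF C2]
    and XL = C2_boundD(4)[OF C2] and XT = C2_boundD(5)[OF C2] and XDL = C2_boundD(6)[OF C2]
  \<comment> \<open>Two backward orbits: \<open>q\<close> retraces the flow from E a w to w, and
    \<open>p\<close> starts at the displaced point. Their difference is d at time 0, and its value
    at time a is wanted.\<close>
  define p where "p t = E (- t) (E a w + d)" for t
  define q where "q t = E (- t) (E a w)" for t
  have h: "h > 0" and E0: "E 0 w = w" for w using E by (auto simp: local_flow_of_def)
  have qa: "q a = w" and p0: "p 0 = E a w + d" and q0: "q 0 = E a w"
    using E a E0 by (auto simp: local_flow_of_def p_def q_def)
  have wB: "w \<in> cball z (2*r)" using w zero_le_dist[of z w] unfolding mem_cball by linarith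
  have DE: "((\<lambda>s. E (- s) v) has_derivative (\<lambda>s. s *\<^sub>R (- X (E (- t) v)))) (at t within {0..a})"
    and BE: "E (- t) v \<in> cball z (2*r)" if v: "v \<in> cball z r" and t: "t \<in> {0..a}" for v t
  proof -
    have t': "- t \<in> {-h..h}" using t a by auto
    show "E (- t) v \<in> cball z (2*r)" using E v t' by (auto simp: local_flow_of_def)
    have "((\<lambda>s. E s v) \<circ> uminus has_vector_derivative (-1) *\<^sub>R X (E (- t) v)) (at t within {0..a})"
    proof (rule vector_diff_chain_within)
      show "((\<lambda>s. E s v) has_vector_derivative X (E (- t) v)) (at (- t) within uminus ` {0..a})"
        by (rule has_vector_derivative_within_subset[where S = "{-h..h}"])
          (use E v t' a in \<open>auto simp: local_flow_of_def\<close>)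
    qed (auto intro!: derivative_eq_intros)
    then show "((\<lambda>s. E (- s) v) has_derivative (\<lambda>s. s *\<^sub>R (- X (E (- t) v)))) (at t within {0..a})"
      by (simp add: has_vector_derivative_def o_def)
  qed
  note Dp = DE[OF d, folded p_def] and pB = BE[OF d, folded p_def]
  note Dq = DE[OF Ea, folded q_def] and qB = BE[OF Ea, folded q_def]
  have pq: "norm (p t - q t) \<le> 2 * norm d" for t
    using E unfolding p_def q_def local_flow_of_def by (metis add_diff_cancel_left')
  have qw: "norm (q t - w) \<le> M * a" if t: "t \<in> {0..a}" for t
  proof -
    have "norm (q t - q a) \<le> M * norm (t - a)"
    proof (rule differentiable_bound[OF _ Dq])
      show "onorm (\<lambda>s. s *\<^sub>R - X (q t)) \<le> M" if "t \<in> {0..a}" for t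
        using XM[OF qB[OF that]] by (intro onorm_scaleR_left_le) simp
    qed (use t a in auto)
    also have "\<dots> \<le> M * a" using t M by (intro mult_left_mono) auto
    finally show ?thesis by (simp add: qa)
  qed
  have pqd: "norm (p t - q t - d) \<le> 2 * M * a * norm d" if t: "t \<in> {0..a}" for t
  proof -
    have "norm ((p t - q t) - (p 0 - q 0)) \<le> (2 * M * norm d) * norm (t - 0)"
    proof (rule differentiable_bound[where S = "{0..a}"])
      show "((\<lambda>t. p t - q t) has_derivative (\<lambda>s. s *\<^sub>R (X (q t) - X (p t)))) (at t within {0..a})"
        if "t \<in> {0..a}" for t
        by (rule has_derivative_eq_rhs[OF has_derivative_diff[OF Dp[OF that] Dq[OF that]]]) (simp add: scaleR_diff_right)
      show "onorm (\<lambda>s. s *\<^sub>R (X (q t) - X (p t))) \<le> 2 * M * norm d" if t: "t \<in> {0..a}" for t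
      proof (rule onorm_scaleR_left_le)
        have "norm (X (q t) - X (p t)) \<le> M * norm (p t - q t)"
          using XL[OF pB[OF t] qB[OF t]] by (simp add: norm_minus_commute)
        also have "\<dots> \<le> M * (2 * norm d)" using pq M by (intro mult_left_mono) auto
        finally show "norm (X (q t) - X (p t)) \<le> 2 * M * norm d" by simp
      qed
    qed (use t in auto)
    also have "\<dots> \<le> (2 * M * norm d) * a" using t M by (intro mult_left_mono) auto
    finally show ?thesis by (simp add: p0 q0 mult_ac)
  qed
  \<comment> \<open>If the difference moved with the constant velocity given by the linearisation at
    w applied to d, \<open>?g\<close> would be constant. Its derivative is therefore the error of
    that approximation.\<close>
  let ?g = "\<lambda>t. p t - q t + t *\<^sub>R frechet_derivative X (at w) d"
  have n: "norm (?g a - ?g 0) \<le> (4 * M * (norm d)\<^sup>2 + 4 * M\<^sup>2 * a * norm d) * norm (a - 0)"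
  proof (rule differentiable_bound[where S = "{0..a}"])
    show "(?g has_derivative (\<lambda>s. s *\<^sub>R (X (q t) - X (p t) + frechet_derivative X (at w) d))) (at t within {0..a})"
      if "t \<in> {0..a}" for t
    proof -
      have "((\<lambda>s. s *\<^sub>R frechet_derivative X (at w) d) has_derivative
          (\<lambda>s'. s' *\<^sub>R frechet_derivative X (at w) d)) (at t within {0..a})"
        by (intro bounded_linear_imp_has_derivative bounded_linear_scaleR_left)
      from has_derivative_add[OF has_derivative_diff[OF Dp[OF that] Dq[OF that]] this]
      show ?thesis by (rule has_derivative_eq_rhs) (simp add: scaleR_diff_right scaleR_add_right)
    qed
    show "onorm (\<lambda>s. s *\<^sub>R (X (q t) - X (p t) + frechet_derivative X (at w) d))
      \<le> 4 * M * (norm d)\<^sup>2 + 4 * M\<^sup>2 * a * norm d" if t: "t \<in> {0..a}" for t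
    proof (rule onorm_scaleR_left_le)
      \<comment> \<open>The error splits into the Taylor remainder at q t, the change of base point
        from q t to w, and the change of argument from p t - q t to d.\<close>
      let ?\<delta> = "p t - q t"
      let ?A = "X (p t) - X (q t) - frechet_derivative X (at (q t)) ?\<delta>"
      let ?B = "frechet_derivative X (at (q t)) ?\<delta> - frechet_derivative X (at w) ?\<delta>"
      let ?C = "frechet_derivative X (at w) (?\<delta> - d)"
      have "norm ?A \<le> M * (norm ?\<delta>)\<^sup>2" by (rule XT[OF qB[OF t] pB[OF t]])
      also have "\<dots> \<le> M * (2 * norm d)\<^sup>2" using pq M by (intro mult_left_mono power_mono) auto
      finally have A: "norm ?A \<le> 4 * M * (norm d)\<^sup>2" by (simp add: power_mult_distrib)
      have "norm ?B \<le> M * norm (q t - w) * norm ?\<delta>" by (rule XDL[OF wB qB[OF t]])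
      also have "\<dots> \<le> M * (M * a) * (2 * norm d)"
        using pq[of t] qw[OF t] M a by (intro mult_mono) auto
      finally have B: "norm ?B \<le> 2 * M\<^sup>2 * a * norm d" by (simp add: power2_eq_square mult_ac)
      have "norm ?C \<le> M * norm (?\<delta> - d)" by (rule XD[OF wB])
      also have "\<dots> \<le> M * (2 * M * a * norm d)" using pqd[OF t] M by (intro mult_left_mono) auto
      finally have C: "norm ?C \<le> 2 * M\<^sup>2 * a * norm d" by (simp add: power2_eq_square mult_ac)
      have eq: "- (X (q t) - X (p t) + frechet_derivative X (at w) d) = ?A + ?B + ?C"
        by (simp add: linear_diff[OF lin])
      have "norm (X (q t) - X (p t) + frechet_derivative X (at w) d) \<le> norm ?A + norm ?B + norm ?C"
        by (subst norm_minus_cancel[symmetric], subst eq) (rule norm_add3_le)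
      with A B C show "norm (X (q t) - X (p t) + frechet_derivative X (at w) d)
        \<le> 4 * M * (norm d)\<^sup>2 + 4 * M\<^sup>2 * a * norm d" by linarith
    qed
  qed (use a in auto)
  have eq: "?g a - ?g 0 = E (- a) (E a w + d) - w - d + a *\<^sub>R frechet_derivative X (at w) d"
    by (simp add: p0 q0 qa) (simp add: p_def)
  show ?thesis using n a unfolding eq by (simp add: mult.commute)
qed

section \<open>Local controllability\<close>

text \<open>\<open>R e x y\<close> is meant to say that \<open>y\<close> can be reached from \<open>x\<close> with time and cost at most \<open>e\<close>.\<close>

locale local_control =
  fixes R :: "real \<Rightarrow> 'a::euclidean_space \<Rightarrow> 'a \<Rightarrow> bool" and S :: "('a \<Rightarrow> 'a) set"
  assumes R_refl: "R 0 x x"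
    and R_trans: "R e x y \<Longrightarrow> R e' y w \<Longrightarrow> R (e + e') x w"
    and R_mono: "R e x y \<Longrightarrow> e \<le> e' \<Longrightarrow> R e' x y"
    and smooth_S: "X \<in> S \<Longrightarrow> smooth X"
    and R_flow: "X \<in> S \<Longrightarrow> local_flow_of X z r h E \<Longrightarrow>
      \<exists>c>0. \<forall>t\<in>{-h..h}. \<forall>w\<in>cball z r. R (c * \<bar>t\<bar>) w (E t w)"
begin

text \<open>The motion prescribed by \<open>Z s\<close> can be realised near \<open>z\<close> up to an error that is small
  compared to \<open>s\<close>, on an arbitrarily small budget and depending continuously on \<open>s\<close>. The
  budget need not be proportional to \<open>s\<close>: this is what makes brackets easy.\<close>

definition realizes ::
  "'a \<Rightarrow> real \<Rightarrow> ('p::euclidean_space \<Rightarrow> 'a \<Rightarrow> 'a) \<Rightarrow> real \<Rightarrow> real \<Rightarrow> real \<Rightarrow> ('p \<Rightarrow> 'a \<Rightarrow> 'a) \<Rightarrow> bool" where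
  "realizes z r Z \<eta> e \<rho> \<psi> \<longleftrightarrow> \<rho> > 0 \<and>
     continuous_on (cball 0 \<rho> \<times> cball z r) (\<lambda>(s, y). \<psi> s y) \<and>
     (\<forall>s\<in>cball 0 \<rho>. \<forall>y\<in>cball z r. norm (\<psi> s y - y - Z s y) \<le> \<eta> * norm s \<and> R e y (\<psi> s y))"

definition realizable :: "'a \<Rightarrow> ('p::euclidean_space \<Rightarrow> 'a \<Rightarrow> 'a) \<Rightarrow> bool" where
  "realizable z Z \<longleftrightarrow> (\<exists>r>0. \<forall>\<eta>>0. \<forall>e>0. \<exists>\<rho> \<psi>. realizes z r Z \<eta> e \<rho> \<psi>)"

section \<open>Realizable motions: change of parameter, sums, generators\<close>

lemma realizableI:
  assumes "r > 0" "\<And>\<eta> e. \<eta> > 0 \<Longrightarrow> e > 0 \<Longrightarrow> \<exists>\<rho> \<psi>. realizes z r Z \<eta> e \<rho> \<psi>"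
  shows "realizable z Z"
  using assms unfolding realizable_def by blast

lemma realizableE:
  assumes "realizable z Z"
  obtains r where "r > 0" "\<And>\<eta> e. \<eta> > 0 \<Longrightarrow> e > 0 \<Longrightarrow> \<exists>\<rho> \<psi>. realizes z r Z \<eta> e \<rho> \<psi>"
  using assms unfolding realizable_def by blast

lemma realizesD:
  assumes "realizes z r Z \<eta> e \<rho> \<psi>"
  shows "\<rho> > 0" "continuous_on (cball 0 \<rho> \<times> cball z r) (\<lambda>(s, y). \<psi> s y)"
    and "s \<in> cball 0 \<rho> \<Longrightarrow> y \<in> cball z r \<Longrightarrow> norm (\<psi> s y - y - Z s y) \<le> \<eta> * norm s"
    and "s \<in> cball 0 \<rho> \<Longrightarrow> y \<in> cball z r \<Longrightarrow> R e y (\<psi> s y)"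
  using assms unfolding realizes_def by blast+

lemma realizable_zero: "realizable z (\<lambda>s y. 0)"
proof (rule realizableI[of 1])
  fix \<eta> e :: real assume "\<eta> > 0" "e > 0"
  then have "realizes z 1 (\<lambda>s y. 0) \<eta> e 1 (\<lambda>s y. y)"
    using R_mono[OF R_refl] by (simp add: realizes_def case_prod_unfold continuous_on_snd)
  then show "\<exists>\<rho> \<psi>. realizes z 1 (\<lambda>s y. 0) \<eta> e \<rho> \<psi>" by blast
qed simp

text \<open>Used with T a multiplication by a scalar, to rescale a field, and with T a coordinate,
  to let a vector parameter drive a single field. The accuracy \<eta> / K makes up for |T q| \<le> K
  |q|.\<close>

lemma realizable_compose:
  fixes T :: "'q::euclidean_space \<Rightarrow> 'p::euclidean_space"
  assumes Z: "realizable z Z" and T: "bounded_linear T"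
  shows "realizable z (\<lambda>q. Z (T q))"
proof -
  obtain r where r: "r > 0" and Zr: "\<And>\<eta> e. \<eta> > 0 \<Longrightarrow> e > 0 \<Longrightarrow> \<exists>\<rho> \<psi>. realizes z r Z \<eta> e \<rho> \<psi>"
    by (rule realizableE[OF Z]) blast
  obtain K where K: "K > 0" "\<And>q. norm (T q) \<le> norm q * K"
    using bounded_linear.pos_bounded[OF T] by blast
  show ?thesis
  proof (rule realizableI[OF r])
    fix \<eta> e :: real assume "\<eta> > 0" "e > 0"
    then obtain \<rho> \<psi> where "realizes z r Z (\<eta> / K) e \<rho> \<psi>"
      using Zr[of "\<eta> / K" e] K(1) by auto
    note \<rho> = realizesD(1)[OF this] and c = realizesD(2)[OF this] and \<psi> = realizesD(3,4)[OF this]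
    have Tq: "T q \<in> cball 0 \<rho>" if "q \<in> cball 0 (\<rho> / K)" for q
      using K(2)[of q] that K(1) by (simp add: field_simps)
    have "realizes z r (\<lambda>q. Z (T q)) \<eta> e (\<rho> / K) (\<lambda>q y. \<psi> (T q) y)"
      unfolding realizes_def
    proof (intro conjI ballI)
      have "continuous_on (cball 0 (\<rho> / K) \<times> cball z r) (\<lambda>p. (\<lambda>(s, y). \<psi> s y) (T (fst p), snd p))"
      proof (rule continuous_on_compose2[OF c])
        show "continuous_on (cball 0 (\<rho> / K) \<times> cball z r) (\<lambda>p. (T (fst p), snd p))"
          by (intro continuous_intros bounded_linear.continuous_on[OF T])
      qed (use Tq in auto)
      then show "continuous_on (cball 0 (\<rho> / K) \<times> cball z r) (\<lambda>(s, y). \<psi> (T s) y)"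
        by (simp add: case_prod_unfold)
      fix s :: 'q and y assume sy: "s \<in> cball 0 (\<rho> / K)" "y \<in> cball z r"
      have "norm (\<psi> (T s) y - y - Z (T s) y) \<le> \<eta> / K * norm (T s)"
        by (rule \<psi>(1)[OF Tq[OF sy(1)] sy(2)])
      also have "\<dots> \<le> \<eta> / K * (norm s * K)"
        using K \<open>\<eta> > 0\<close> by (intro mult_left_mono) auto
      finally show "norm (\<psi> (T s) y - y - Z (T s) y) \<le> \<eta> * norm s" using K(1) by simp
      show "R e y (\<psi> (T s) y)" by (rule \<psi>(2)[OF Tq[OF sy(1)] sy(2)])
    qed (use \<rho> K in auto)
    then show "\<exists>\<rho> \<psi>. realizes z r (\<lambda>q. Z (T q)) \<eta> e \<rho> \<psi>" by blast
  qed
qed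

text \<open>The two motions are performed in succession. The second one starts at the end of the
  first instead of at y; by the Lipschitz bound this costs only an error quadratic in s, which is
  absorbed for small s.\<close>

lemma realizable_add:
  fixes Z1 Z2 :: "'p::euclidean_space \<Rightarrow> 'a \<Rightarrow> 'a"
  assumes Z1: "realizable z Z1" and Z2: "realizable z Z2"
    and lip: "\<And>r. \<exists>M>0. \<forall>x\<in>cball z r. \<forall>y\<in>cball z r. \<forall>s.
      norm (Z1 s x) \<le> M * norm s \<and> norm (Z2 s y - Z2 s x) \<le> M * norm s * norm (y - x)"
  shows "realizable z (\<lambda>s y. Z1 s y + Z2 s y)"
proof -
  obtain r1 where r1: "r1 > 0" and Z1r: "\<And>\<eta> e. \<eta> > 0 \<Longrightarrow> e > 0 \<Longrightarrow> \<exists>\<rho> \<psi>. realizes z r1 Z1 \<eta> e \<rho> \<psi>"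
    by (rule realizableE[OF Z1]) blast
  obtain r2 where r2: "r2 > 0" and Z2r: "\<And>\<eta> e. \<eta> > 0 \<Longrightarrow> e > 0 \<Longrightarrow> \<exists>\<rho> \<psi>. realizes z r2 Z2 \<eta> e \<rho> \<psi>"
    by (rule realizableE[OF Z2]) blast
  define r where "r = min r1 r2 / 2"
  have r: "r > 0" "r \<le> r1" "2 * r \<le> r2" using r1 r2 by (auto simp: r_def)
  obtain M where M: "M > 0"
    and M1: "\<And>x s. x\<in>cball z (2*r) \<Longrightarrow> norm (Z1 s x) \<le> M * norm s"
    and M2: "\<And>x y s. x\<in>cball z (2*r) \<Longrightarrow> y\<in>cball z (2*r) \<Longrightarrow> norm (Z2 s y - Z2 s x) \<le> M * norm s * norm (y - x)"
    using lip[of "2*r"] by metis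
  show ?thesis
  proof (rule realizableI[OF r(1)])
    fix \<eta>0 e :: real assume "\<eta>0 > 0" and e: "e > 0"
    \<comment> \<open>One third for each motion and one for the shifted starting point. The bound
      \<eta> \<le> 1 limits the first displacement to (M + 1) |s|.\<close>
    define \<eta> where "\<eta> = min (\<eta>0 / 3) 1"
    have \<eta>: "\<eta> > 0" "\<eta> \<le> 1" "3 * \<eta> \<le> \<eta>0" using \<open>\<eta>0 > 0\<close> by (auto simp: \<eta>_def)
    obtain \<rho>1 \<psi>1 where "realizes z r1 Z1 \<eta> (e/2) \<rho>1 \<psi>1" using Z1r[of \<eta> "e/2"] \<eta> e by auto
    note \<rho>1 = realizesD(1)[OF this] and c1 = realizesD(2)[OF this] and \<psi>1 = realizesD(3,4)[OF this]
    obtain \<rho>2 \<psi>2 where "realizes z r2 Z2 \<eta> (e/2) \<rho>2 \<psi>2" using Z2r[of \<eta> "e/2"] \<eta> e by auto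
    note \<rho>2 = realizesD(1)[OF this] and c2 = realizesD(2)[OF this] and \<psi>2 = realizesD(3,4)[OF this]
    \<comment> \<open>r / (M + 1) keeps the intermediate point in the domain of the second motion,
      and \<eta> / (M (M + 1)) makes the quadratic error at most \<eta> |s|.\<close>
    define \<rho> where "\<rho> = Min {\<rho>1, \<rho>2, r / (M + 1), \<eta> / (M * (M + 1))}"
    have \<rho>: "\<rho> > 0" "\<rho> \<le> \<rho>1" "\<rho> \<le> \<rho>2" "\<rho> * (M + 1) \<le> r" "\<rho> * (M * (M + 1)) \<le> \<eta>"
      using \<rho>1 \<rho>2 r \<eta> M by (simp_all add: \<rho>_def flip: pos_le_divide_eq)
    have step: "norm (\<psi>1 s y - y) \<le> (M + 1) * norm s" "\<psi>1 s y \<in> cball z (2*r)"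
      if s: "s \<in> cball 0 \<rho>" and y: "y \<in> cball z r" for s y
    proof -
      have "norm (\<psi>1 s y - y) \<le> norm (\<psi>1 s y - y - Z1 s y) + norm (Z1 s y)"
        using norm_triangle_ineq[of "\<psi>1 s y - y - Z1 s y" "Z1 s y"] by simp
      also have "\<dots> \<le> \<eta> * norm s + M * norm s"
        using \<psi>1(1)[of s y] M1[of y s] s y r \<rho> by (intro add_mono) auto
      also have "\<dots> \<le> 1 * norm s + M * norm s" using \<eta> by (intro add_mono mult_right_mono) auto
      finally show *: "norm (\<psi>1 s y - y) \<le> (M + 1) * norm s" by (simp add: algebra_simps)
      also have "\<dots> \<le> (M + 1) * \<rho>" using s M by (intro mult_left_mono) auto
      also have "\<dots> \<le> r" using \<rho>(4) by (simp add: mult.commute)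
      finally have "dist y (\<psi>1 s y) \<le> r" by (simp add: dist_norm norm_minus_commute)
      then show "\<psi>1 s y \<in> cball z (2*r)" using y dist_triangle[of z "\<psi>1 s y" y] by simp
    qed
    have "realizes z r (\<lambda>s y. Z1 s y + Z2 s y) \<eta>0 e \<rho> (\<lambda>s y. \<psi>2 s (\<psi>1 s y))"
      unfolding realizes_def
    proof (intro conjI ballI)
      have c1': "continuous_on (cball 0 \<rho> \<times> cball z r) (\<lambda>p. (\<lambda>(s, y). \<psi>1 s y) p)"
        by (rule continuous_on_subset[OF c1]) (use \<rho> r in auto)
      have "continuous_on (cball 0 \<rho> \<times> cball z r) (\<lambda>p. (\<lambda>(s, y). \<psi>2 s y) (fst p, (\<lambda>(s, y). \<psi>1 s y) p))"
      proof (rule continuous_on_compose2[OF c2])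
        show "continuous_on (cball 0 \<rho> \<times> cball z r) (\<lambda>p. (fst p, (\<lambda>(s, y). \<psi>1 s y) p))"
          by (intro continuous_intros c1')
        show "(\<lambda>p. (fst p, (\<lambda>(s, y). \<psi>1 s y) p)) ` (cball 0 \<rho> \<times> cball z r) \<subseteq> cball 0 \<rho>2 \<times> cball z r2"
          using step(2) r(3) \<rho>(3) by force
      qed
      then show "continuous_on (cball 0 \<rho> \<times> cball z r) (\<lambda>(s, y). \<psi>2 s (\<psi>1 s y))"
        by (simp add: case_prod_unfold)
      fix s :: 'p and y assume s: "s \<in> cball 0 \<rho>" and y: "y \<in> cball z r"
      let ?y1 = "\<psi>1 s y"
      have y1: "?y1 \<in> cball z r2" "y \<in> cball z (2 * r)" using step(2)[OF s y] r y by auto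
      have A: "norm (\<psi>2 s ?y1 - ?y1 - Z2 s ?y1) \<le> \<eta> * norm s \<and> R (e/2) ?y1 (\<psi>2 s ?y1)"
        using s \<rho> y1 by (intro conjI \<psi>2) auto
      have B: "norm (?y1 - y - Z1 s y) \<le> \<eta> * norm s \<and> R (e/2) y ?y1"
        using s \<rho> y r by (intro conjI \<psi>1) auto
      have "norm (Z2 s ?y1 - Z2 s y) \<le> M * norm s * norm (?y1 - y)"
        by (rule M2[OF y1(2) step(2)[OF s y]])
      also have "\<dots> \<le> M * norm s * ((M + 1) * norm s)"
        using M step(1)[OF s y] by (intro mult_left_mono) auto
      also have "\<dots> = (norm s * (M * (M + 1))) * norm s" by simp
      also have "\<dots> \<le> (\<rho> * (M * (M + 1))) * norm s"
        using s M by (intro mult_right_mono) auto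
      also have "\<dots> \<le> \<eta> * norm s" using \<rho> by (intro mult_right_mono) auto
      finally have C: "norm (Z2 s ?y1 - Z2 s y) \<le> \<eta> * norm s" .
      have eq: "\<psi>2 s ?y1 - y - (Z1 s y + Z2 s y) =
        (\<psi>2 s ?y1 - ?y1 - Z2 s ?y1) + (?y1 - y - Z1 s y) + (Z2 s ?y1 - Z2 s y)" by simp
      have "norm (\<psi>2 s ?y1 - y - (Z1 s y + Z2 s y)) \<le>
        norm (\<psi>2 s ?y1 - ?y1 - Z2 s ?y1) + norm (?y1 - y - Z1 s y) + norm (Z2 s ?y1 - Z2 s y)"
        unfolding eq by (rule norm_add3_le)
      also have "\<dots> \<le> \<eta> * norm s + \<eta> * norm s + \<eta> * norm s"
        using A B C by (intro add_mono) auto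
      also have "\<dots> = (3 * \<eta>) * norm s" by simp
      also have "\<dots> \<le> \<eta>0 * norm s" using \<eta> by (intro mult_right_mono) auto
      finally show "norm (\<psi>2 s ?y1 - y - (Z1 s y + Z2 s y)) \<le> \<eta>0 * norm s" .
      show "R e y (\<psi>2 s ?y1)" using R_trans[of "e/2" y ?y1 "e/2"] A B by simp
    qed (use \<rho> in auto)
    then show "\<exists>\<rho> \<psi>. realizes z r (\<lambda>s y. Z1 s y + Z2 s y) \<eta>0 e \<rho> \<psi>" by blast
  qed
qed

lemma realizable_generator:
  assumes X: "X \<in> S"
  shows "realizable z (\<lambda>s y. s *\<^sub>R X y)"
proof -
  have X1: "C_k 1 X" using smooth_S[OF X] by (simp add: smooth_def del: C_k.simps)
  obtain h E where E: "local_flow_of X z 1 h E"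
    using local_flow_of_exists[OF X1, of 1 z] by auto
  obtain c where c: "c > 0" "\<And>t w. t\<in>{-h..h} \<Longrightarrow> w \<in> cball z 1 \<Longrightarrow> R (c * \<bar>t\<bar>) w (E t w)"
    using R_flow[OF X E] by blast
  obtain M where M: "M > 0"
    "\<And>x y. x \<in> cball z (2*1) \<Longrightarrow> y \<in> cball z (2*1) \<Longrightarrow> norm (X y - X x) \<le> M * norm (y - x)"
    "\<And>x. x \<in> cball z (2*1) \<Longrightarrow> norm (X x) \<le> M"
    using C_k_cball_bound[OF X1, of z "2*1"] by metis
  have exp: "norm (E s y - y - s *\<^sub>R X y) \<le> M\<^sup>2 * s\<^sup>2" if "s \<in> {-h..h}" "y \<in> cball z 1" for s y
    by (rule local_flow_expansion(2)[OF E M(1) _ _ that(2,1)]) (use M in auto)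
  show ?thesis
  proof (rule realizableI[of 1])
    fix \<eta> e :: real assume \<eta>: "\<eta> > 0" and e: "e > 0"
    \<comment> \<open>The entries serve the existence of the flow, the remainder M^2 s^2 \<le>
      \<eta> |s| and the budget c |s| \<le> e.\<close>
    define \<rho> where "\<rho> = Min {h, \<eta> / M\<^sup>2, e / c}"
    have h: "h > 0" using E by (simp add: local_flow_of_def)
    have \<rho>: "\<rho> > 0" "\<rho> \<le> h" "\<rho> * M\<^sup>2 \<le> \<eta>" "\<rho> * c \<le> e"
      using h \<eta> e c M by (simp_all add: \<rho>_def flip: pos_le_divide_eq)
    have "realizes z 1 (\<lambda>s y. s *\<^sub>R X y) \<eta> e \<rho> E"
      unfolding realizes_def
    proof (intro conjI ballI)
      have "continuous_on ({-h..h} \<times> UNIV) (\<lambda>(t, w). E t w)" using E by (simp add: local_flow_of_def)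
      then show "continuous_on (cball 0 \<rho> \<times> cball z 1) (\<lambda>(s, y). E s y)"
        by (rule continuous_on_subset) (use \<rho> in auto)
      fix s :: real and y assume s: "s \<in> cball 0 \<rho>" and y: "y \<in> cball z 1"
      have sh: "s \<in> {-h..h}" using s \<rho> by auto
      have "norm (E s y - y - s *\<^sub>R X y) \<le> M\<^sup>2 * s\<^sup>2" by (rule exp[OF sh y])
      also have "\<dots> = (\<bar>s\<bar> * M\<^sup>2) * norm s" by (simp add: power2_eq_square)
      also have "\<dots> \<le> (\<rho> * M\<^sup>2) * norm s" using s by (intro mult_right_mono) auto
      also have "\<dots> \<le> \<eta> * norm s" using \<rho> by (intro mult_right_mono) auto
      finally show "norm (E s y - y - s *\<^sub>R X y) \<le> \<eta> * norm s" .
      have "c * \<bar>s\<bar> \<le> c * \<rho>" using s c by (intro mult_left_mono) auto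
      also have "\<dots> \<le> e" using \<rho> by (simp add: mult.commute)
      finally show "R e y (E s y)" by (rule R_mono[OF c(2)[OF sh y]])
    qed (use \<rho> in auto)
    then show "\<exists>\<rho> \<psi>. realizes z 1 (\<lambda>s y. s *\<^sub>R X y) \<eta> e \<rho> \<psi>" by blast
  qed auto
qed

end

text \<open>The algebra of the loop, separated from the dynamics: y goes to w by -b along Z, w to v
  by the flow of X for the time a, v to v + d by b along Z, and v + d to u by the reversed flow. The
  hypotheses \<open>e1\<close> to \<open>e5\<close> record the accuracy of these legs.\<close>

lemma lie_bracket_estimate:
  fixes X Z :: "'a::euclidean_space \<Rightarrow> 'a"
  assumes X: "C2_bound X B M" and Z: "C2_bound Z B M"
    and linX: "\<And>x. linear (frechet_derivative X (at x))"
    and linZ: "\<And>x. linear (frechet_derivative Z (at x))"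
    and yB: "y \<in> B" and wB: "w \<in> B" and vB: "v \<in> B"
    and a: "0 \<le> a" "a \<le> 1" and \<eta>: "0 \<le> \<eta>" "\<eta> \<le> 1"
    and e1: "norm (w - y + b *\<^sub>R Z y) \<le> \<eta> * \<bar>b\<bar>"
    and e2: "norm (d - b *\<^sub>R Z v) \<le> \<eta> * \<bar>b\<bar>"
    and e3: "norm (v - w - a *\<^sub>R X w) \<le> M\<^sup>2 * a\<^sup>2"
    and e4: "norm (v - w) \<le> M * a"
    and e5: "norm (u - w - d + a *\<^sub>R frechet_derivative X (at w) d) \<le> a * (4 * M * (norm d)\<^sup>2 + 4 * M\<^sup>2 * a * norm d)"
  shows "norm (u - y - (a * b) *\<^sub>R lie_bracket X Z y) \<le> 9 * (M + 1) ^ 4 * \<bar>b\<bar> * (\<eta> + a\<^sup>2 + \<bar>b\<bar>)"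
proof -
  note M = C2_boundD(1)[OF X] and XM = C2_boundD(2)[OF X] and XD = C2_boundD(3)[OF X]
    and XL = C2_boundD(4)[OF X] and XDL = C2_boundD(6)[OF X]
  note ZM = C2_boundD(2)[OF Z] and ZD = C2_boundD(3)[OF Z] and ZL = C2_boundD(4)[OF Z]
    and ZT = C2_boundD(5)[OF Z] and ZDL = C2_boundD(6)[OF Z]
  \<comment> \<open>Since \<eta> \<le> 1, both motions along Z have length at most N |b|.\<close>
  define N where "N = M + 1"
  define K where "K = N ^ 4"
  define \<beta> where "\<beta> = \<bar>b\<bar>"
  have \<beta>: "\<beta> \<ge> 0" by (simp add: \<beta>_def)
  have N: "1 \<le> N" "M \<le> N" "0 \<le> N" using M by (auto simp: N_def)
  have mono: "M ^ i * N ^ j \<le> K" if "i + j \<le> 4" for i j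
  proof -
    have "M ^ i * N ^ j \<le> N ^ i * N ^ j" using M N by (intro mult_right_mono power_mono) auto
    also have "\<dots> \<le> K" unfolding K_def power_add[symmetric] using N that by (intro power_increasing) auto
    finally show ?thesis .
  qed
  have k: "M * N\<^sup>2 \<le> K" "M\<^sup>2 * N \<le> K" "M ^ 3 \<le> K" "M * N \<le> K" "M \<le> K" "1 \<le> K"
    using mono[of 1 2] mono[of 2 1] mono[of 3 0] mono[of 1 1] mono[of 1 0] mono[of 0 0] by auto
  have aa: "a * a \<le> a" using a by (simp add: mult_left_le)
  have wy: "norm (w - y) \<le> N * \<beta>"
  proof -
    have "norm (w - y) \<le> norm (w - y + b *\<^sub>R Z y) + norm (b *\<^sub>R Z y)"
      using norm_triangle_ineq4[of "w - y + b *\<^sub>R Z y" "b *\<^sub>R Z y"] by simp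
    also have "\<dots> \<le> \<eta> * \<beta> + \<beta> * M"
      using e1 ZM[OF yB] by (auto simp: \<beta>_def intro!: add_mono mult_left_mono)
    also have "\<dots> \<le> 1 * \<beta> + \<beta> * M" using \<eta> \<beta> M by (intro add_mono mult_right_mono) auto
    finally show ?thesis by (simp add: N_def algebra_simps)
  qed
  have dn: "norm d \<le> N * \<beta>"
  proof -
    have "norm d \<le> norm (d - b *\<^sub>R Z v) + norm (b *\<^sub>R Z v)"
      using norm_triangle_ineq[of "d - b *\<^sub>R Z v" "b *\<^sub>R Z v"] by simp
    also have "\<dots> \<le> \<eta> * \<beta> + \<beta> * M"
      using e2 ZM[OF vB] by (auto simp: \<beta>_def intro!: add_mono mult_left_mono)
    also have "\<dots> \<le> 1 * \<beta> + \<beta> * M" using \<eta> \<beta> M by (intro add_mono mult_right_mono) auto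
    finally show ?thesis by (simp add: N_def algebra_simps)
  qed
  have vy: "norm (v - y) \<le> M * a + N * \<beta>"
    using norm_triangle_ineq[of "v - w" "w - y"] e4 wy by simp
  \<comment> \<open>A telescoping sum: \<open>t1\<close> to \<open>t3\<close> are the errors of the
    legs, \<open>t4\<close> to \<open>t6\<close> expand Z(v) around w and move Z(w) to Z(y),
    \<open>t7\<close> and \<open>t8\<close> move DZ X from w to y, and \<open>t9\<close> and
    \<open>t10\<close> replace d by b Z(y) and move DX to y.\<close>
  define t1 where "t1 = u - w - d + a *\<^sub>R frechet_derivative X (at w) d"
  define t2 where "t2 = w - y + b *\<^sub>R Z y"
  define t3 where "t3 = d - b *\<^sub>R Z v"
  define t4 where "t4 = b *\<^sub>R (Z v - Z w - frechet_derivative Z (at w) (v - w))"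
  define t5 where "t5 = b *\<^sub>R frechet_derivative Z (at w) (v - w - a *\<^sub>R X w)"
  define t6 where "t6 = b *\<^sub>R (Z w - Z y)"
  define t7 where "t7 = (a * b) *\<^sub>R (frechet_derivative Z (at w) (X w) - frechet_derivative Z (at y) (X w))"
  define t8 where "t8 = (a * b) *\<^sub>R frechet_derivative Z (at y) (X w - X y)"
  define t9 where "t9 = (- a) *\<^sub>R frechet_derivative X (at w) (d - b *\<^sub>R Z y)"
  define t10 where "t10 = (- (a * b)) *\<^sub>R (frechet_derivative X (at w) (Z y) - frechet_derivative X (at y) (Z y))"
  have eq: "u - y - (a * b) *\<^sub>R lie_bracket X Z y = t1 + t2 + t3 + t4 + t5 + t6 + t7 + t8 + t9 + t10"
    unfolding t1_def t2_def t3_def t4_def t5_def t6_def t7_def t8_def t9_def t10_def lie_bracket_def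
    by (simp add: linear_diff[OF linX] linear_diff[OF linZ] linear_add[OF linX] linear_add[OF linZ] linear_scale[OF linX] linear_scale[OF linZ] algebra_simps)
  have n1: "norm t1 \<le> 4 * K * (\<beta> * \<beta>) + 4 * K * (a\<^sup>2 * \<beta>)"
  proof -
    have "norm t1 \<le> a * (4 * M * (norm d)\<^sup>2 + 4 * M\<^sup>2 * a * norm d)" using e5 by (simp add: t1_def)
    also have "\<dots> \<le> a * (4 * M * (N * \<beta>)\<^sup>2 + 4 * M\<^sup>2 * a * (N * \<beta>))"
      using dn M a by (intro mult_left_mono add_mono power_mono) auto
    also have "\<dots> = a * (4 * (M * N\<^sup>2) * (\<beta> * \<beta>)) + 4 * (M\<^sup>2 * N) * (a\<^sup>2 * \<beta>)"
      by (simp add: power2_eq_square algebra_simps)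
    also have "a * (4 * (M * N\<^sup>2) * (\<beta> * \<beta>)) \<le> 1 * (4 * K * (\<beta> * \<beta>))"
      using a k M N \<beta> by (intro mult_mono) auto
    also have "4 * (M\<^sup>2 * N) * (a\<^sup>2 * \<beta>) \<le> 4 * K * (a\<^sup>2 * \<beta>)"
      using k \<beta> by (intro mult_right_mono) auto
    finally show ?thesis by simp
  qed
  have K1: "x \<le> K * x" if "x \<ge> 0" for x using k(6) that by (simp add: mult_le_cancel_right1)
  have n2: "norm t2 \<le> K * (\<eta> * \<beta>)" "norm t3 \<le> K * (\<eta> * \<beta>)"
    using e1 e2 K1[of "\<eta> * \<beta>"] \<eta> \<beta> by (auto simp: t2_def t3_def \<beta>_def)
  have n4: "norm t4 \<le> K * (a\<^sup>2 * \<beta>)"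
  proof -
    have "norm t4 \<le> \<beta> * (M * (norm (v - w))\<^sup>2)"
      using ZT[OF wB vB] by (auto simp: t4_def \<beta>_def intro!: mult_left_mono)
    also have "\<dots> \<le> \<beta> * (M * (M * a)\<^sup>2)" using e4 M \<beta> by (intro mult_left_mono power_mono) auto
    also have "\<dots> = M ^ 3 * (a\<^sup>2 * \<beta>)" by (simp add: power2_eq_square power3_eq_cube)
    also have "\<dots> \<le> K * (a\<^sup>2 * \<beta>)" using k \<beta> by (intro mult_right_mono) auto
    finally show ?thesis .
  qed
  have n5: "norm t5 \<le> K * (a\<^sup>2 * \<beta>)"
  proof -
    have "norm t5 \<le> \<beta> * (M * norm (v - w - a *\<^sub>R X w))"
      using ZD[OF wB] by (auto simp: t5_def \<beta>_def intro!: mult_left_mono)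
    also have "\<dots> \<le> \<beta> * (M * (M\<^sup>2 * a\<^sup>2))" using e3 M \<beta> by (intro mult_left_mono) auto
    also have "\<dots> = M ^ 3 * (a\<^sup>2 * \<beta>)" by (simp add: power2_eq_square power3_eq_cube)
    also have "\<dots> \<le> K * (a\<^sup>2 * \<beta>)" using k \<beta> by (intro mult_right_mono) auto
    finally show ?thesis .
  qed
  have n6: "norm t6 \<le> K * (\<beta> * \<beta>)"
  proof -
    have "norm t6 \<le> \<beta> * (M * norm (w - y))"
      using ZL[OF yB wB] by (auto simp: t6_def \<beta>_def intro!: mult_left_mono)
    also have "\<dots> \<le> \<beta> * (M * (N * \<beta>))" using wy M \<beta> by (intro mult_left_mono) auto
    also have "\<dots> = (M * N) * (\<beta> * \<beta>)" by simp
    also have "\<dots> \<le> K * (\<beta> * \<beta>)" using k \<beta> by (intro mult_right_mono) auto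
    finally show ?thesis .
  qed
  have common: "a * \<beta> * (M * (N * \<beta>) * M) \<le> K * (\<beta> * \<beta>)"
  proof -
    have "a * \<beta> * (M * (N * \<beta>) * M) = a * ((M\<^sup>2 * N) * (\<beta> * \<beta>))" by (simp add: power2_eq_square)
    also have "\<dots> \<le> 1 * (K * (\<beta> * \<beta>))" using k \<beta> a M N by (intro mult_mono) auto
    finally show ?thesis by simp
  qed
  have n7: "norm t7 \<le> K * (\<beta> * \<beta>)"
  proof -
    have "norm t7 \<le> a * \<beta> * (M * norm (w - y) * norm (X w))"
      using ZDL[OF yB wB, of "X w"] a by (auto simp: t7_def \<beta>_def abs_mult intro!: mult_left_mono)
    also have "\<dots> \<le> a * \<beta> * (M * (N * \<beta>) * M)" using wy XM[OF wB] M \<beta> a N by (intro mult_mono) auto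
    finally show ?thesis using common by simp
  qed
  have n8: "norm t8 \<le> K * (\<beta> * \<beta>)"
  proof -
    have "norm t8 \<le> a * \<beta> * (M * norm (X w - X y))"
      using ZD[OF yB, of "X w - X y"] a by (auto simp: t8_def \<beta>_def abs_mult intro!: mult_left_mono)
    also have "\<dots> \<le> a * \<beta> * (M * (M * (N * \<beta>)))"
    proof -
      have "norm (X w - X y) \<le> M * (N * \<beta>)"
        using XL[OF yB wB] mult_left_mono[OF wy, of M] M by linarith
      then show ?thesis using M \<beta> a by (intro mult_left_mono) auto
    qed
    finally show ?thesis using common by (simp add: mult_ac)
  qed
  have n9: "norm t9 \<le> K * (\<eta> * \<beta>) + K * (a\<^sup>2 * \<beta>) + K * (\<beta> * \<beta>)"
  proof -
    have "norm (d - b *\<^sub>R Z y) \<le> norm (d - b *\<^sub>R Z v) + norm (b *\<^sub>R (Z v - Z y))"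
      using norm_triangle_ineq[of "d - b *\<^sub>R Z v" "b *\<^sub>R (Z v - Z y)"] by (simp add: scaleR_diff_right)
    also have "\<dots> \<le> \<eta> * \<beta> + \<beta> * (M * norm (v - y))"
      using e2 ZL[OF yB vB] by (auto simp: \<beta>_def intro!: add_mono mult_left_mono)
    also have "\<dots> \<le> \<eta> * \<beta> + \<beta> * (M * (M * a + N * \<beta>))"
      using vy M \<beta> \<eta> by (intro add_mono mult_left_mono) auto
    finally have *: "norm (d - b *\<^sub>R Z y) \<le> \<eta> * \<beta> + \<beta> * (M * (M * a + N * \<beta>))" .
    have "norm t9 \<le> a * (M * norm (d - b *\<^sub>R Z y))"
      using XD[OF wB] a by (auto simp: t9_def intro!: mult_left_mono)
    also have "\<dots> \<le> a * (M * (\<eta> * \<beta> + \<beta> * (M * (M * a + N * \<beta>))))"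
      using * M a by (intro mult_left_mono) auto
    also have "\<dots> = a * (M * (\<eta> * \<beta>)) + M ^ 3 * (a\<^sup>2 * \<beta>) + a * ((M\<^sup>2 * N) * (\<beta> * \<beta>))"
      by (simp add: power2_eq_square power3_eq_cube algebra_simps)
    also have "\<dots> \<le> 1 * (K * (\<eta> * \<beta>)) + K * (a\<^sup>2 * \<beta>) + 1 * (K * (\<beta> * \<beta>))"
      using k \<beta> a M N \<eta> by (intro add_mono mult_mono) auto
    finally show ?thesis by simp
  qed
  have n10: "norm t10 \<le> K * (\<beta> * \<beta>)"
  proof -
    have "norm t10 \<le> a * \<beta> * (M * norm (w - y) * norm (Z y))"
      using XDL[OF yB wB, of "Z y"] a by (auto simp: t10_def \<beta>_def abs_mult intro!: mult_left_mono)
    also have "\<dots> \<le> a * \<beta> * (M * (N * \<beta>) * M)" using wy ZM[OF yB] M \<beta> a N by (intro mult_mono) auto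
    finally show ?thesis using common by simp
  qed
  have "norm (t1 + t2 + t3 + t4 + t5 + t6 + t7 + t8 + t9 + t10) \<le>
    norm t1 + norm t2 + norm t3 + norm t4 + norm t5 + norm t6 + norm t7 + norm t8 + norm t9 + norm t10"
    by (intro norm_triangle_le add_mono order_refl)
  \<comment> \<open>The counts: \<eta> |b| once in each of \<open>t2\<close>, \<open>t3\<close>,
    \<open>t9\<close>; a^2 |b| four times in \<open>t1\<close> and once in each of
    \<open>t4\<close>, \<open>t5\<close>, \<open>t9\<close>; b^2 four times in \<open>t1\<close> and
    once in each of \<open>t6\<close> to \<open>t10\<close>. The largest count is the 9 of the
    claim.\<close>
  also have "\<dots> \<le> 3 * K * (\<eta> * \<beta>) + 7 * K * (a\<^sup>2 * \<beta>) + 9 * K * (\<beta> * \<beta>)"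
    using n1 n2 n4 n5 n6 n7 n8 n9 n10 by linarith
  also have "\<dots> \<le> 9 * K * (\<eta> * \<beta>) + 9 * K * (a\<^sup>2 * \<beta>) + 9 * K * (\<beta> * \<beta>)"
    using k \<beta> \<eta> by (intro add_mono mult_right_mono) auto
  finally show ?thesis unfolding eq K_def N_def \<beta>_def by (simp add: algebra_simps)
qed

context local_control
begin

lemma realizable_lie_bracket:
  assumes X: "X \<in> S" and Z: "C_k 2 Z" and rZ: "realizable z (\<lambda>s y. s *\<^sub>R Z y)"
  shows "realizable z (\<lambda>s y. s *\<^sub>R lie_bracket X Z y)"
proof -
  have X2: "C_k 2 X" using smooth_S[OF X] by (simp add: smooth_def)
  have X1: "C_k 1 X" using smooth_S[OF X] by (simp add: smooth_def del: C_k.simps)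
  have linX: "linear (frechet_derivative X (at x))" and linZ: "linear (frechet_derivative Z (at x))" for x
    using X2 Z by (auto intro!: linear_frechet_derivative simp: numeral_2_eq_2)
  obtain r0 where r0: "r0 > 0"
    and Zr: "\<And>\<eta> e. \<eta> > 0 \<Longrightarrow> e > 0 \<Longrightarrow> \<exists>\<rho> \<psi>. realizes z r0 (\<lambda>s y. s *\<^sub>R Z y) \<eta> e \<rho> \<psi>"
    by (rule realizableE[OF rZ]) blast
  obtain h E where E: "local_flow_of X z r0 h E"
    using local_flow_of_exists[OF X1 r0, of z] by auto
  then have h: "h > 0" by (simp add: local_flow_of_def)
  obtain c where c: "c > 0" "\<And>t w. t\<in>{-h..h} \<Longrightarrow> w \<in> cball z r0 \<Longrightarrow> R (c * \<bar>t\<bar>) w (E t w)"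
    using R_flow[OF X E] by blast
  let ?B = "cball z (2 * r0)"
  obtain MX MZ where "C2_bound X ?B MX" "C2_bound Z ?B MZ"
    using C_2_cball_bound[OF X2] C_2_cball_bound[OF Z] by blast
  define M where "M = max MX MZ"
  have XB: "C2_bound X ?B M" and ZB: "C2_bound Z ?B M"
    by (rule C2_bound_mono[OF \<open>C2_bound X ?B MX\<close>], simp add: M_def)
      (rule C2_bound_mono[OF \<open>C2_bound Z ?B MZ\<close>], simp add: M_def)
  note M = C2_boundD(1)[OF XB] and XM = C2_boundD(2)[OF XB] and XL = C2_boundD(4)[OF XB]
    and ZM = C2_boundD(2)[OF ZB]
  \<comment> \<open>Three times the constant of \<open>lie_bracket_estimate\<close>: each of the
    three error terms is to be at most a third of \<eta> a |b|.\<close>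
  define K where "K = 27 * (M + 1) ^ 4"
  have K: "K > 0" using M by (simp add: K_def)
  show ?thesis
  proof (rule realizableI[of "r0 / 4"])
    fix \<eta> e :: real assume \<eta>: "\<eta> > 0" and e: "e > 0"
    \<comment> \<open>In order: the flow exists, a \<le> 1 as the estimate demands, the flow leg is
      no longer than r0 / 4, the error term satisfies K a^2 \<le> \<eta> a, and the leg costs a
      quarter of the budget.\<close>
    define a where "a = Min {h, 1, r0 / (4 * M), \<eta> / K, e / (4 * c)}"
    have a: "a > 0" "a \<le> h" "a \<le> 1" "a * M \<le> r0 / 4" "a * K \<le> \<eta>" "c * a \<le> e / 4"
    proof -
      show "a > 0" "a \<le> h" "a \<le> 1" using h r0 M \<eta> K e c by (simp_all add: a_def)
      have "a \<le> r0 / (4 * M)" "a \<le> \<eta> / K" "a \<le> e / (4 * c)" by (simp_all add: a_def)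
      then show "a * M \<le> r0 / 4" "a * K \<le> \<eta>" "c * a \<le> e / 4"
        using M K c by (simp_all add: pos_le_divide_eq mult_ac)
    qed
    \<comment> \<open>The accuracy of the motion along Z is divided by a when it is compared with
      |s| = a |b|, so it is chosen after a.\<close>
    define \<eta>' where "\<eta>' = min 1 (\<eta> * a / K)"
    have \<eta>': "\<eta>' > 0" "\<eta>' \<le> 1" "K * \<eta>' \<le> \<eta> * a"
    proof -
      show "\<eta>' > 0" "\<eta>' \<le> 1" using \<eta> a K by (simp_all add: \<eta>'_def)
      have "\<eta>' \<le> \<eta> * a / K" by (simp add: \<eta>'_def)
      then show "K * \<eta>' \<le> \<eta> * a" using K by (simp add: pos_le_divide_eq mult_ac)
    qed
    obtain \<rho>' \<psi> where "realizes z r0 (\<lambda>s y. s *\<^sub>R Z y) \<eta>' (e/4) \<rho>' \<psi>"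
      using Zr[of \<eta>' "e/4"] \<eta>' e by auto
    note \<rho>' = realizesD(1)[OF this] and cont = realizesD(2)[OF this]
      and \<psi> = realizesD(3)[OF this] and \<psi>R = realizesD(4)[OF this]
    define b0 where "b0 = Min {\<rho>', r0 / (4 * (M + 1)), \<eta> * a / K}"
    have b0: "b0 > 0" "b0 \<le> \<rho>'" "(M + 1) * b0 \<le> r0 / 4" "K * b0 \<le> \<eta> * a"
    proof -
      show "b0 > 0" "b0 \<le> \<rho>'" using \<rho>' r0 M \<eta> a K by (simp_all add: b0_def)
      have "b0 \<le> r0 / (4 * (M + 1))" "b0 \<le> \<eta> * a / K" by (simp_all add: b0_def)
      then show "(M + 1) * b0 \<le> r0 / 4" "K * b0 \<le> \<eta> * a"
        using M K by (simp_all add: pos_le_divide_eq mult_ac)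
    qed
    have near: "x' \<in> cball z (p + q)" if "x \<in> cball z p" "norm (x' - x) \<le> q" for x x' p q
      using that dist_triangle[of z x' x] by (simp add: dist_norm norm_minus_commute)
    have move: "norm (\<psi> b x - x) \<le> r0 / 4" if "\<bar>b\<bar> \<le> b0" "x \<in> cball z r0" for b x
    proof -
      have "x \<in> ?B" using that r0 by simp
      have "norm (\<psi> b x - x) \<le> norm (\<psi> b x - x - b *\<^sub>R Z x) + norm (b *\<^sub>R Z x)"
        using norm_triangle_ineq[of "\<psi> b x - x - b *\<^sub>R Z x" "b *\<^sub>R Z x"] by simp
      also have "\<dots> \<le> \<eta>' * \<bar>b\<bar> + \<bar>b\<bar> * M"
        using \<psi>[of b x] that b0 ZM[OF \<open>x \<in> ?B\<close>] by (intro add_mono) (auto intro!: mult_left_mono)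
      also have "\<dots> \<le> 1 * \<bar>b\<bar> + \<bar>b\<bar> * M" using \<eta>' M by (intro add_mono mult_right_mono) auto
      also have "\<dots> = (M + 1) * \<bar>b\<bar>" by (simp add: algebra_simps)
      also have "\<dots> \<le> (M + 1) * b0" using that M by (intro mult_left_mono) auto
      finally show ?thesis using b0 by simp
    qed
    have E0: "E 0 x = x" for x using E by (simp add: local_flow_of_def)
    have EM: "norm (E a x - x) \<le> M * a" "norm (E a x - x - a *\<^sub>R X x) \<le> M\<^sup>2 * a\<^sup>2" if "x \<in> cball z r0" for x
      using local_flow_expansion(1)[OF E M XM XL that, of 0 a]
        local_flow_expansion(2)[OF E M XM XL that, of a] a h by (auto simp: E0)
    define P where "P b y = \<psi> (- b) y" for b y
    define Q where "Q b y = E a (P b y)" for b y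
    \<comment> \<open>Each of the first three legs moves by at most r0 / 4. The radii grow from r0 /
      4 to r0 / 2, 3/4 r0 and r0, so every leg starts where \<psi> and the flow are under
      control.\<close>
    have PQ: "P b y \<in> cball z (r0 / 2)" "norm (Q b y - P b y) \<le> r0 / 4" "Q b y \<in> cball z (3 / 4 * r0)"
        "\<psi> b (Q b y) \<in> cball z r0"
      if b: "\<bar>b\<bar> \<le> b0" and y: "y \<in> cball z (r0 / 4)" for b y
    proof -
      have y': "y \<in> cball z r0" using y r0 by simp
      show P: "P b y \<in> cball z (r0 / 2)"
        using near[OF y move[of "- b" y]] b y' by (simp add: P_def)
      then have P': "P b y \<in> cball z r0" using r0 by simp
      show *: "norm (Q b y - P b y) \<le> r0 / 4"
        using EM(1)[OF P'] a(4) by (simp add: Q_def mult.commute)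
      show Q: "Q b y \<in> cball z (3 / 4 * r0)" using near[OF P *] by simp
      show "\<psi> b (Q b y) \<in> cball z r0"
        using near[OF Q move[OF b]] Q r0 by simp
    qed
    \<comment> \<open>The loop displaces by a b in the direction of the bracket, so the parameter s
      corresponds to b = s / a.\<close>
    have "realizes z (r0 / 4) (\<lambda>s y. s *\<^sub>R lie_bracket X Z y) \<eta> e (a * b0)
        (\<lambda>s y. E (- a) (\<psi> (s / a) (Q (s / a) y)))"
      unfolding realizes_def
    proof (intro conjI ballI)
      let ?D = "cball (0::real) (a * b0) \<times> cball z (r0 / 4)"
      have sa: "\<bar>s / a\<bar> \<le> b0" if "s \<in> cball 0 (a * b0)" for s
        using that a by (simp add: field_simps)
      have contE: "continuous_on UNIV (E t)" if "t \<in> {-h..h}" for t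
      proof -
        have "continuous_on UNIV (\<lambda>x. (\<lambda>(t, w). E t w) (t, x))"
          by (rule continuous_on_compose2[where t = "{-h..h} \<times> UNIV"])
            (use E that in \<open>auto simp: local_flow_of_def intro!: continuous_intros\<close>)
        then show ?thesis by simp
      qed
      have cP: "continuous_on ?D (\<lambda>p. (\<lambda>(s, y). \<psi> s y) (- (fst p / a), snd p))"
      proof (rule continuous_on_compose2[OF cont])
        show "continuous_on ?D (\<lambda>p. (- (fst p / a), snd p))"
          using a by (intro continuous_intros) auto
        show "(\<lambda>p. (- (fst p / a), snd p)) ` ?D \<subseteq> cball 0 \<rho>' \<times> cball z r0"
        proof (rule image_subsetI)
          fix p :: "real \<times> 'a" assume "p \<in> ?D"
          then show "(- (fst p / a), snd p) \<in> cball 0 \<rho>' \<times> cball z r0"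
            using sa[of "fst p"] b0(2) r0 by (cases p) simp
        qed
      qed
      have cQ: "continuous_on ?D (\<lambda>p. Q (fst p / a) (snd p))"
        unfolding Q_def P_def
        by (rule continuous_on_compose2[OF contE[of a] cP[simplified case_prod_conv]]) (use a in auto)
      have "continuous_on ?D (\<lambda>p. (\<lambda>(s, y). \<psi> s y) (fst p / a, Q (fst p / a) (snd p)))"
      proof (rule continuous_on_compose2[OF cont])
        show "continuous_on ?D (\<lambda>p. (fst p / a, Q (fst p / a) (snd p)))"
          using a by (intro continuous_intros cQ) auto
        show "(\<lambda>p. (fst p / a, Q (fst p / a) (snd p))) ` ?D \<subseteq> cball 0 \<rho>' \<times> cball z r0"
        proof (rule image_subsetI)
          fix p :: "real \<times> 'a" assume "p \<in> ?D"
          then show "(fst p / a, Q (fst p / a) (snd p)) \<in> cball 0 \<rho>' \<times> cball z r0"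
            using sa[of "fst p"] PQ(3)[of "fst p / a" "snd p"] b0(2) r0 by (cases p) simp
        qed
      qed
      then have c3: "continuous_on ?D (\<lambda>p. \<psi> (fst p / a) (Q (fst p / a) (snd p)))" by simp
      have "continuous_on ?D (\<lambda>p. E (- a) (\<psi> (fst p / a) (Q (fst p / a) (snd p))))"
        by (rule continuous_on_compose2[OF contE[of "- a"] c3]) (use a in auto)
      then show "continuous_on ?D (\<lambda>(s, y). E (- a) (\<psi> (s / a) (Q (s / a) y)))"
        by (simp add: case_prod_unfold)
      fix s :: real and y assume s: "s \<in> cball 0 (a * b0)" and y: "y \<in> cball z (r0 / 4)"
      define b where "b = s / a"
      have b: "\<bar>b\<bar> \<le> b0" "s = a * b" using sa[OF s] a by (auto simp: b_def)
      let ?w = "P b y" and ?v = "Q b y" and ?v' = "\<psi> b (Q b y)"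
      note pq = PQ[OF b(1) y]
      have wr: "?w \<in> cball z r0" and vr: "?v \<in> cball z r0" and yr: "y \<in> cball z r0"
        using pq r0 y by auto
      have inB: "x \<in> ?B" if "x \<in> cball z r0" for x using that r0 by simp
      have br: "b \<in> cball 0 \<rho>'" "- b \<in> cball 0 \<rho>'" using b b0 by auto
      let ?d = "?v' - ?v"
      have "norm (E (- a) ?v' - y - (a * b) *\<^sub>R lie_bracket X Z y)
        \<le> 9 * (M + 1) ^ 4 * \<bar>b\<bar> * (\<eta>' + a\<^sup>2 + \<bar>b\<bar>)"
      proof (rule lie_bracket_estimate[OF XB ZB, where w = ?w and v = ?v and d = ?d])
        show "norm (?w - y + b *\<^sub>R Z y) \<le> \<eta>' * \<bar>b\<bar>" using \<psi>[OF br(2) yr] by (simp add: P_def)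
        show "norm (?d - b *\<^sub>R Z ?v) \<le> \<eta>' * \<bar>b\<bar>" using \<psi>[OF br(1) vr] by simp
        show "norm (?v - ?w - a *\<^sub>R X ?w) \<le> M\<^sup>2 * a\<^sup>2" "norm (?v - ?w) \<le> M * a"
          using EM[OF wr] by (simp_all add: Q_def)
        show "norm (E (- a) ?v' - ?w - ?d + a *\<^sub>R frechet_derivative X (at ?w) ?d)
          \<le> a * (4 * M * (norm ?d)\<^sup>2 + 4 * M\<^sup>2 * a * norm ?d)"
          using local_flow_pull_back[OF E XB linX wr _ a(2), of ?d] a vr pq(4)
          by (simp add: Q_def)
      qed (use linX linZ inB wr vr yr a \<eta>' in auto)
      also have "\<dots> = \<bar>b\<bar> * (K * \<eta>' + K * a\<^sup>2 + K * \<bar>b\<bar>) / 3"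
        by (simp add: K_def algebra_simps)
      also have "\<dots> \<le> \<bar>b\<bar> * (\<eta> * a + \<eta> * a + \<eta> * a) / 3"
      proof -
        have "K * a\<^sup>2 \<le> \<eta> * a" using mult_right_mono[OF a(5), of a] a(1) by (simp add: power2_eq_square mult_ac)
        moreover have "K * \<bar>b\<bar> \<le> \<eta> * a" using order_trans[OF mult_left_mono[OF b(1)] b0(4)] K by simp
        ultimately show ?thesis using \<eta>' by (intro divide_right_mono mult_left_mono add_mono) auto
      qed
      also have "\<dots> = \<eta> * norm s" using a b by (simp add: abs_mult)
      finally show "norm (E (- a) (\<psi> (s / a) (Q (s / a) y)) - y - s *\<^sub>R lie_bracket X Z y) \<le> \<eta> * norm s"
        using b a by simp
      have ah: "a \<in> {-h..h}" "- a \<in> {-h..h}" using a h by auto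
      \<comment> \<open>Two legs along Z at e / 4 each, and two along X at c a \<le> e / 4
        each.\<close>
      have "R (e / 4 + c * a + e / 4 + c * a) y (E (- a) ?v')"
        using R_trans[OF R_trans[OF R_trans[OF \<psi>R[OF br(2) yr] c(2)[OF ah(1) wr[unfolded P_def]]]
              \<psi>R[OF br(1) vr, unfolded Q_def P_def]] c(2)[OF ah(2) pq(4)[unfolded Q_def P_def]]] a
        by (simp add: Q_def P_def)
      then show "R e y (E (- a) (\<psi> (s / a) (Q (s / a) y)))"
        unfolding b_def by (rule R_mono) (use a(6) in linarith)
    qed (use a b0 in auto)
    then show "\<exists>\<rho> \<psi>. realizes z (r0 / 4) (\<lambda>s y. s *\<^sub>R lie_bracket X Z y) \<eta> e \<rho> \<psi>" by blast
  qed (use r0 in auto)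
qed

end

lemma C_1_local_bounds:
  fixes X Y :: "'a::euclidean_space \<Rightarrow> 'b::real_normed_vector"
  assumes "C_k 1 X" "C_k 1 Y"
  shows "\<exists>M>0. \<forall>x\<in>cball z r. \<forall>y\<in>cball z r. norm (X x) \<le> M \<and> norm (Y y - Y x) \<le> M * norm (y - x)"
proof -
  obtain M1 where M1: "M1 > 0" "\<And>x. x \<in> cball z r \<Longrightarrow> norm (X x) \<le> M1"
    using C_k_cball_bound[OF assms(1), of z r] by metis
  obtain M2 where M2: "M2 > 0"
      "\<And>x y. x \<in> cball z r \<Longrightarrow> y \<in> cball z r \<Longrightarrow> norm (Y y - Y x) \<le> M2 * norm (y - x)"
    using C_k_cball_bound[OF assms(2), of z r] by metis
  show ?thesis
  proof (intro exI[of _ "M1 + M2"] conjI ballI)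
    fix x y assume xy: "x \<in> cball z r" "y \<in> cball z r"
    show "norm (X x) \<le> M1 + M2" using M1 M2 xy by fastforce
    have "norm (Y y - Y x) \<le> M2 * norm (y - x)" using M2 xy by blast
    also have "\<dots> \<le> (M1 + M2) * norm (y - x)" using M1 by (intro mult_right_mono) auto
    finally show "norm (Y y - Y x) \<le> (M1 + M2) * norm (y - x)" .
  qed (use M1 M2 in auto)
qed

context local_control
begin

lemma realizable_left_normed:
  assumes "Z \<in> left_normed_brackets S"
  shows "realizable z (\<lambda>s y. s *\<^sub>R Z y)"
  using assms
proof induction
  case (gen X)
  then show ?case by (rule realizable_generator)
next
  case zero
  then show ?case by (simp add: realizable_zero)
next
  case (add X Y)
  have X1: "C_k 1 X" and Y1: "C_k 1 Y"
    using smooth_left_normed_brackets[OF smooth_S] add.hyps by (auto simp: smooth_def simp del: C_k.simps)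
  have "realizable z (\<lambda>s y. s *\<^sub>R X y + s *\<^sub>R Y y)"
  proof (rule realizable_add[OF add.IH])
    fix r
    obtain M where M: "M > 0" "\<And>x y. x\<in>cball z r \<Longrightarrow> y\<in>cball z r \<Longrightarrow> norm (X x) \<le> M \<and> norm (Y y - Y x) \<le> M * norm (y - x)"
      using C_1_local_bounds[OF X1 Y1, of z r] by blast
    show "\<exists>M>0. \<forall>x\<in>cball z r. \<forall>y\<in>cball z r. \<forall>s::real. norm (s *\<^sub>R X x) \<le> M * norm s \<and>
      norm (s *\<^sub>R Y y - s *\<^sub>R Y x) \<le> M * norm s * norm (y - x)"
    proof (intro exI[of _ M] conjI ballI allI M(1))
      fix x y and s :: real assume xy: "x \<in> cball z r" "y \<in> cball z r"
      show "norm (s *\<^sub>R X x) \<le> M * norm s"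
        using mult_left_mono[of "norm (X x)" M "\<bar>s\<bar>"] M(2)[OF xy] by (simp add: mult.commute)
      show "norm (s *\<^sub>R Y y - s *\<^sub>R Y x) \<le> M * norm s * norm (y - x)"
        using mult_left_mono[of "norm (Y y - Y x)" "M * norm (y - x)" "\<bar>s\<bar>"] M(2)[OF xy]
        by (simp add: mult_ac flip: scaleR_diff_right)
    qed
  qed
  then show ?case by (simp add: scaleR_add_right)
next
  case (scale X c)
  have "realizable z (\<lambda>s y. (s * c) *\<^sub>R X y)"
    by (rule realizable_compose[OF scale.IH bounded_linear_mult_left])
  then show ?case by simp
next
  case (bracket X Z)
  then show ?case
    using smooth_left_normed_brackets[OF smooth_S bracket.hyps(2)]
    by (intro realizable_lie_bracket) (auto simp: smooth_def)
qed

text \<open>The values at z of \<open>left_normed_brackets\<close> already form a subspace, so every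
  vector is the value at z of a realizable field. Near z the fields chosen for the basis vectors act
  almost like translations.\<close>

lemma local_controllability:
  assumes span: "span {X z | X. X \<in> lie_algebra_generated S} = UNIV" and e: "e > 0"
  obtains \<delta> where "\<delta> > 0" "\<And>x y. x \<in> ball z \<delta> \<Longrightarrow> y \<in> ball z \<delta> \<Longrightarrow> R e x y"
proof -
  have "subspace {X z | X. X \<in> left_normed_brackets S}"
    unfolding subspace_def
    by (auto intro: left_normed_brackets.zero left_normed_brackets.add left_normed_brackets.scale)
  moreover have "{X z | X. X \<in> lie_algebra_generated S} \<subseteq> {X z | X. X \<in> left_normed_brackets S}"
    using lie_algebra_generated_left_normed[OF smooth_S] by auto
  ultimately have "UNIV \<subseteq> {X z | X. X \<in> left_normed_brackets S}"
    unfolding span[symmetric] by (intro span_minimal)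
  note sub = this
  have ex: "\<exists>X. X \<in> left_normed_brackets S \<and> X z = v" for v
  proof -
    have "v \<in> {X z | X. X \<in> left_normed_brackets S}" by (rule subsetD[OF sub UNIV_I])
    then show ?thesis by auto
  qed
  define F where "F v = (SOME X. X \<in> left_normed_brackets S \<and> X z = v)" for v
  have F: "F v \<in> left_normed_brackets S" "F v z = v" for v
    using someI_ex[OF ex[of v]] by (simp_all add: F_def)
  have F1: "C_k 1 (F v)" for v
    using smooth_left_normed_brackets[OF smooth_S F(1)[of v]] by (simp add: smooth_def del: C_k.simps)
  \<comment> \<open>Subsets of the basis allow an induction that adds one coordinate at a time; the
    parameter is the full vector from the outset, so that both summands share it.\<close>
  have "realizable z (\<lambda>(s::'a) y. \<Sum>b\<in>T. (s \<bullet> b) *\<^sub>R F b y)" if "T \<subseteq> Basis" for T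
    using finite_subset[OF that finite_Basis] that
  proof (induction T)
    case empty
    show ?case by (simp add: realizable_zero)
  next
    case (insert b T)
    have b: "norm b = 1" using insert by auto
    have sb: "\<bar>s \<bullet> b\<bar> \<le> norm s" for s using Cauchy_Schwarz_ineq2[of s b] b by simp
    have "realizable z (\<lambda>(s::'a) y. (s \<bullet> b) *\<^sub>R F b y)"
      by (rule realizable_compose[OF realizable_left_normed[OF F(1)] bounded_linear_inner_left])
    then have "realizable z (\<lambda>(s::'a) y. (s \<bullet> b) *\<^sub>R F b y + (\<Sum>b\<in>T. (s \<bullet> b) *\<^sub>R F b y))"
    proof (rule realizable_add)
      show "realizable z (\<lambda>(s::'a) y. \<Sum>b\<in>T. (s \<bullet> b) *\<^sub>R F b y)" using insert by auto
      fix r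
      have "\<forall>c. \<exists>M>0. \<forall>x\<in>cball z r. \<forall>y\<in>cball z r. norm (F b x) \<le> M \<and> norm (F c y - F c x) \<le> M * norm (y - x)"
        using C_1_local_bounds[OF F1 F1] by blast
      then obtain M where M: "\<And>c. M c > 0" "\<And>c x. x\<in>cball z r \<Longrightarrow> norm (F b x) \<le> M c"
          "\<And>c x y. x\<in>cball z r \<Longrightarrow> y\<in>cball z r \<Longrightarrow> norm (F c y - F c x) \<le> M c * norm (y - x)"
        by metis
      define N where "N = M b + (\<Sum>c\<in>T. M c)"
      have sN: "(\<Sum>c\<in>T. M c) \<ge> 0" using M(1) by (meson less_imp_le sum_nonneg)
      have N: "N > 0" "M b \<le> N" "(\<Sum>c\<in>T. M c) \<le> N" using sN M(1)[of b] by (auto simp: N_def)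
      show "\<exists>M>0. \<forall>x\<in>cball z r. \<forall>y\<in>cball z r. \<forall>s. norm ((s \<bullet> b) *\<^sub>R F b x) \<le> M * norm s \<and>
        norm ((\<Sum>b\<in>T. (s \<bullet> b) *\<^sub>R F b y) - (\<Sum>b\<in>T. (s \<bullet> b) *\<^sub>R F b x)) \<le> M * norm s * norm (y - x)"
      proof (intro exI[of _ N] conjI ballI allI N(1))
        fix x y s assume xy: "x \<in> cball z r" "y \<in> cball z r"
        have "\<bar>s \<bullet> b\<bar> * norm (F b x) \<le> norm s * N"
          using sb M(2)[OF xy(1), of b] N by (intro mult_mono) auto
        then show "norm ((s \<bullet> b) *\<^sub>R F b x) \<le> N * norm s" by (simp add: mult.commute)
        have "norm ((\<Sum>b\<in>T. (s \<bullet> b) *\<^sub>R F b y) - (\<Sum>b\<in>T. (s \<bullet> b) *\<^sub>R F b x))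
          = norm (\<Sum>c\<in>T. (s \<bullet> c) *\<^sub>R (F c y - F c x))"
          by (simp add: scaleR_diff_right sum_subtractf)
        also have "\<dots> \<le> (\<Sum>c\<in>T. norm s * (M c * norm (y - x)))"
        proof (rule sum_norm_le)
          fix c assume "c \<in> T"
          then have "\<bar>s \<bullet> c\<bar> \<le> norm s" using insert.prems Basis_le_norm by blast
          then show "norm ((s \<bullet> c) *\<^sub>R (F c y - F c x)) \<le> norm s * (M c * norm (y - x))"
            using M(3)[OF xy, of c] by (auto intro!: mult_mono)
        qed
        also have "\<dots> = (\<Sum>c\<in>T. M c) * (norm s * norm (y - x))"
          unfolding sum_distrib_right by (simp add: mult_ac)
        also have "\<dots> \<le> N * (norm s * norm (y - x))" using N by (intro mult_right_mono) auto
        finally show "norm ((\<Sum>b\<in>T. (s \<bullet> b) *\<^sub>R F b y) - (\<Sum>b\<in>T. (s \<bullet> b) *\<^sub>R F b x)) \<le> N * norm s * norm (y - x)"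
          by (simp add: mult.assoc)
      qed
    qed
    then show ?case using insert by simp
  qed
  from this[OF subset_refl] obtain r where r: "r > 0"
    and rr: "\<And>\<eta> e. \<eta> > 0 \<Longrightarrow> e > 0 \<Longrightarrow> \<exists>\<rho> \<psi>. realizes z r (\<lambda>(s::'a) y. \<Sum>b\<in>Basis. (s \<bullet> b) *\<^sub>R F b y) \<eta> e \<rho> \<psi>"
    by (rule realizableE) blast
  \<comment> \<open>Accuracy 1/4 here and 1/4 from the variation of the fields near z, controlled by
    \<open>d\<close>, add up to the 1/2 in \<open>near\<close>.\<close>
  obtain \<rho> \<psi> where "realizes z r (\<lambda>(s::'a) y. \<Sum>b\<in>Basis. (s \<bullet> b) *\<^sub>R F b y) (1/4) e \<rho> \<psi>"
    using rr[of "1/4" e] e by auto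
  note \<rho> = realizesD(1)[OF this] and cont = realizesD(2)[OF this]
    and \<psi> = realizesD(3)[OF this] and \<psi>R = realizesD(4)[OF this]
  define G where "G y = (\<Sum>b\<in>Basis. norm (F b y - b))" for y
  have "continuous_on UNIV G"
    unfolding G_def by (intro continuous_intros C_k_continuous[OF F1])
  then have "isCont G z" by (simp add: continuous_on_eq_continuous_at)
  then obtain d where d0: "d > 0" "\<And>y. dist y z < d \<Longrightarrow> dist (G y) (G z) < 1/4"
    unfolding continuous_at_eps_delta by (meson zero_less_divide_1_iff zero_less_numeral)
  have "G z = 0" by (simp add: G_def F(2))
  then have d: "d > 0" "\<And>y. dist y z < d \<Longrightarrow> (\<Sum>b\<in>Basis. norm (F b y - b)) < 1/4"
    using d0 unfolding G_def[symmetric] by (simp_all add: dist_real_def) (metis abs_ge_self mult_right_mono order_le_less_trans zero_le_numeral)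
  \<comment> \<open>\<delta> \<le> \<rho> / 4 gives |y - x| \<le> \<rho> / 2; with the factor 1/2 of
    \<open>near\<close> this keeps \<open>?g\<close> inside the ball of radius \<rho>.\<close>
  define \<delta> where "\<delta> = Min {r, d, \<rho> / 4}"
  have \<delta>: "\<delta> > 0" "\<delta> \<le> r" "\<delta> \<le> d" "\<delta> \<le> \<rho> / 4" using r d \<rho> by (auto simp: \<delta>_def)
  show ?thesis
  proof (rule that[OF \<delta>(1)])
    fix x y assume x: "x \<in> ball z \<delta>" and y: "y \<in> ball z \<delta>"
    have xr: "x \<in> cball z r" using x \<delta> by auto
    have near: "norm (\<psi> s x - x - s) \<le> norm s / 2" if s: "s \<in> cball 0 \<rho>" for s
    proof -
      have eq: "(\<Sum>b\<in>Basis. (s \<bullet> b) *\<^sub>R F b x) - s = (\<Sum>b\<in>Basis. (s \<bullet> b) *\<^sub>R (F b x - b))"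
        by (simp add: scaleR_diff_right sum_subtractf euclidean_representation)
      have "norm ((\<Sum>b\<in>Basis. (s \<bullet> b) *\<^sub>R F b x) - s) \<le> (\<Sum>b\<in>Basis. norm s * norm (F b x - b))"
        unfolding eq by (rule sum_norm_le) (auto intro!: mult_right_mono Basis_le_norm)
      also have "\<dots> = norm s * (\<Sum>b\<in>Basis. norm (F b x - b))" by (simp add: sum_distrib_left)
      also have "\<dots> \<le> norm s * (1/4)"
        using d(2)[of x] x \<delta> by (intro mult_left_mono) (auto simp: dist_commute)
      finally have "norm ((\<Sum>b\<in>Basis. (s \<bullet> b) *\<^sub>R F b x) - s) \<le> norm s / 4" by simp
      moreover note \<psi>[OF s xr]
      ultimately show ?thesis
        using norm_triangle_ineq[of "\<psi> s x - x - (\<Sum>b\<in>Basis. (s \<bullet> b) *\<^sub>R F b x)" "(\<Sum>b\<in>Basis. (s \<bullet> b) *\<^sub>R F b x) - s"]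
        by simp
    qed
    \<comment> \<open>A fixed point of \<open>?g\<close> is exactly a parameter s with \<psi> s x =
      y.\<close>
    let ?g = "\<lambda>s. (y - x) - (\<psi> s x - x - s)"
    obtain s where s: "s \<in> cball 0 \<rho>" "?g s = s"
    proof (rule brouwer[of "cball (0::'a) \<rho>" ?g])
      have "continuous_on (cball 0 \<rho>) (\<lambda>s. (\<lambda>(s, y). \<psi> s y) (s, x))"
        by (rule continuous_on_compose2[OF cont]) (use xr in \<open>auto intro!: continuous_intros\<close>)
      then show "continuous_on (cball 0 \<rho>) ?g" by (auto intro!: continuous_intros)
      show "?g \<in> cball 0 \<rho> \<rightarrow> cball 0 \<rho>"
      proof
        fix s assume s: "s \<in> cball (0::'a) \<rho>"
        have "norm (y - x) \<le> dist z x + dist z y" using dist_triangle3[of x y z] by (simp add: dist_norm norm_minus_commute)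
        then have "norm (y - x) \<le> \<rho> / 2" using x y \<delta> by auto
        then have "norm (?g s) \<le> \<rho>"
          using near[OF s] s norm_triangle_ineq4[of "y - x" "\<psi> s x - x - s"] by auto
        then show "?g s \<in> cball 0 \<rho>" by simp
      qed
    qed (use \<rho> in auto)
    then have "\<psi> s x = y" by (simp add: algebra_simps)
    then show "R e x y" using \<psi>R[OF s(1) xr] by simp
  qed
qed

end

section \<open>Trajectories and their costs\<close>

text \<open>An integral over the whole line with an indicator, so that intervals can be split and
  shifted within one measure space. Values in \<open>ennreal\<close> dispense with integrability
  conditions.\<close>

definition nn_cost :: "(real \<Rightarrow> ennreal) \<Rightarrow> real \<Rightarrow> real \<Rightarrow> ennreal" where
  "nn_cost g a b = (\<integral>\<^sup>+ s. g s * indicator {a..b} s \<partial>lebesgue)"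

lemma AE_lebesgue_neq: "AE s in lebesgue. s \<noteq> (c::real)"
proof (rule AE_I')
  show "{c} \<in> null_sets lebesgue" by (simp flip: negligible_iff_null_sets)
qed auto

text \<open>The common end point b is a null set. Measurability is asked of the product with the
  indicator only, because trajectories and controls are arbitrary outside their interval.\<close>

lemma nn_cost_split:
  assumes "a \<le> b" "b \<le> c"
    and "(\<lambda>s. g s * indicator {a..c} s) \<in> borel_measurable lebesgue"
  shows "nn_cost g a c = nn_cost g a b + nn_cost g b c"
proof -
  have m: "(\<lambda>s. g s * indicator {p..q} s) \<in> borel_measurable lebesgue" if "a \<le> p" "q \<le> c" for p q
  proof -
    have "(\<lambda>s. (g s * indicator {a..c} s) * indicator {p..q} s) \<in> borel_measurable lebesgue"
      by (intro borel_measurable_times_ennreal[OF assms(3)] borel_measurable_indicator) auto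
    moreover have "(\<lambda>s. (g s * indicator {a..c} s) * indicator {p..q} s) = (\<lambda>s. g s * indicator {p..q} s)"
      using that by (auto simp: indicator_def)
    ultimately show ?thesis by simp
  qed
  have "nn_cost g a c = (\<integral>\<^sup>+ s. g s * indicator {a..b} s + g s * indicator {b..c} s \<partial>lebesgue)"
    unfolding nn_cost_def
  proof (rule nn_integral_cong_AE)
    show "AE s in lebesgue. g s * indicator {a..c} s = g s * indicator {a..b} s + g s * indicator {b..c} s"
      using AE_lebesgue_neq[of b] by eventually_elim (use assms in \<open>auto simp: indicator_def\<close>)
  qed
  also have "\<dots> = nn_cost g a b + nn_cost g b c"
    unfolding nn_cost_def using assms by (intro nn_integral_add m) auto
  finally show ?thesis .
qed

lemma nn_cost_cong:
  assumes "\<And>s. a < s \<Longrightarrow> s < b \<Longrightarrow> g s = h s"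
  shows "nn_cost g a b = nn_cost h a b"
  unfolding nn_cost_def
proof (rule nn_integral_cong_AE)
  show "AE s in lebesgue. g s * indicator {a..b} s = h s * indicator {a..b} s"
    using AE_lebesgue_neq[of a] AE_lebesgue_neq[of b]
    by eventually_elim (use assms in \<open>auto simp: indicator_def\<close>)
qed

lemma nn_cost_mono:
  "(\<And>s. s \<in> {a..b} \<Longrightarrow> g s \<le> h s) \<Longrightarrow> nn_cost g a b \<le> nn_cost h a b"
  unfolding nn_cost_def by (intro nn_integral_mono) (auto simp: indicator_def)

lemma nn_cost_const: "a \<le> b \<Longrightarrow> nn_cost (\<lambda>s. c) a b = c * ennreal (b - a)"
  by (simp add: nn_cost_def nn_integral_cmult_indicator)

lemma lebesgue_shift: "distr lebesgue lebesgue (\<lambda>x. x + (k::real)) = lebesgue"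
  using lebesgue_real_affine[of 1 k] by (simp add: density_1 add.commute)

lemma measurable_lebesgue_shift: "(\<lambda>x. x + (k::real)) \<in> lebesgue \<rightarrow>\<^sub>M lebesgue"
  using lebesgue_affine_measurable[of "\<lambda>_::real. 1" k] by (simp add: add.commute)

lemma indicator_shift: "indicator {a - k..b - k} s = indicator {a..b} (s + k)" for s k :: real
  by (auto simp: indicator_def)

lemma nn_cost_shift:
  assumes "(\<lambda>s. g s * indicator {a..b} s) \<in> borel_measurable lebesgue"
  shows "nn_cost (\<lambda>s. g (s + k)) (a - k) (b - k) = nn_cost g a b"
proof -
  have "nn_cost g a b = (\<integral>\<^sup>+ s. g s * indicator {a..b} s \<partial>distr lebesgue lebesgue (\<lambda>x. x + k))"
    by (simp add: nn_cost_def lebesgue_shift)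
  also have "\<dots> = (\<integral>\<^sup>+ s. g (s + k) * indicator {a..b} (s + k) \<partial>lebesgue)"
    by (rule nn_integral_distr[OF measurable_lebesgue_shift]) (use assms in simp)
  finally show ?thesis by (simp add: nn_cost_def indicator_shift)
qed

section \<open>Absolutely continuous curves\<close>

definition ac_modulus :: "real \<Rightarrow> real \<Rightarrow> (real \<Rightarrow> 'a::real_normed_vector) \<Rightarrow> real \<Rightarrow> real \<Rightarrow> bool" where
  "ac_modulus a b g e d \<longleftrightarrow> (\<forall>(n::nat) (s::nat \<Rightarrow> real) t.
        (\<forall>i<n. a \<le> s i \<and> s i \<le> t i \<and> t i \<le> b) \<and>
        disjoint_family_on (\<lambda>i. {s i<..<t i}) {..<n} \<and> (\<Sum>i<n. t i - s i) < d
        \<longrightarrow> (\<Sum>i<n. norm (g (t i) - g (s i))) < e)"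

lemma absolutely_continuous_iff:
  "absolutely_continuous_on_Icc a b g \<longleftrightarrow> (\<forall>e>0. \<exists>d>0. ac_modulus a b g e d)"
  by (simp add: absolutely_continuous_on_Icc_def ac_modulus_def)

lemma ac_modulusI:
  assumes "\<And>(n::nat) s t. (\<And>i. i < n \<Longrightarrow> a \<le> s i \<and> s i \<le> t i \<and> t i \<le> b) \<Longrightarrow>
    disjoint_family_on (\<lambda>i. {s i<..<t i}) {..<n} \<Longrightarrow> (\<Sum>i<n. t i - s i) < d \<Longrightarrow>
    (\<Sum>i<n. norm (g (t i) - g (s i))) < e"
  shows "ac_modulus a b g e d"
  unfolding ac_modulus_def by (intro allI impI assms) auto

lemma ac_modulusD:
  fixes n :: nat
  assumes m: "ac_modulus a b g e d" and st: "\<And>i. i < n \<Longrightarrow> a \<le> s i \<and> s i \<le> t i \<and> t i \<le> b"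
    and disj: "disjoint_family_on (\<lambda>i. {s i<..<t i}) {..<n}" and len: "(\<Sum>i<n. t i - s i) < d"
  shows "(\<Sum>i<n. norm (g (t i) - g (s i))) < e"
  by (rule m[unfolded ac_modulus_def, THEN spec, THEN spec, THEN spec, THEN mp]) (use st disj len in blast)

lemma absolutely_continuous_subset:
  assumes "absolutely_continuous_on_Icc a b g" "a \<le> a'" "b' \<le> b"
  shows "absolutely_continuous_on_Icc a' b' g"
proof -
  have "ac_modulus a' b' g e d" if m: "ac_modulus a b g e d" for e d
  proof (rule ac_modulusI)
    fix n :: nat and s t
    assume st: "\<And>i. i < n \<Longrightarrow> a' \<le> s i \<and> s i \<le> t i \<and> t i \<le> b'"
      and "disjoint_family_on (\<lambda>i. {s i<..<t i}) {..<n}" "(\<Sum>i<n. t i - s i) < d"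
    then show "(\<Sum>i<n. norm (g (t i) - g (s i))) < e"
      by (intro ac_modulusD[OF m]) (use assms st in fastforce)+
  qed
  then show ?thesis using assms(1) unfolding absolutely_continuous_iff by blast
qed

lemma absolutely_continuous_shift:
  assumes "absolutely_continuous_on_Icc a b g"
  shows "absolutely_continuous_on_Icc (a - k) (b - k) (\<lambda>s. g (s + k))"
proof -
  have "ac_modulus (a - k) (b - k) (\<lambda>s. g (s + k)) e d" if m: "ac_modulus a b g e d" for e d
  proof (rule ac_modulusI)
    fix n :: nat and s t
    assume st: "\<And>i. i < n \<Longrightarrow> a - k \<le> s i \<and> s i \<le> t i \<and> t i \<le> b - k"
      and disj: "disjoint_family_on (\<lambda>i. {s i<..<t i}) {..<n}" and len: "(\<Sum>i<n. t i - s i) < d"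
    show "(\<Sum>i<n. norm (g (t i + k) - g (s i + k))) < e"
    proof (rule ac_modulusD[OF m])
      show "disjoint_family_on (\<lambda>i. {s i + k<..<t i + k}) {..<n}"
        unfolding disjoint_family_on_def
      proof (intro ballI impI equals0I)
        fix i j x assume ij: "i \<in> {..<n}" "j \<in> {..<n}" "i \<noteq> j"
          and "x \<in> {s i + k<..<t i + k} \<inter> {s j + k<..<t j + k}"
        then have "x - k \<in> {s i<..<t i} \<inter> {s j<..<t j}" by auto
        then show False using disj ij unfolding disjoint_family_on_def by blast
      qed
    qed (use st len in \<open>fastforce+\<close>)
  qed
  then show ?thesis using assms unfolding absolutely_continuous_iff by blast
qed

text \<open>Sums of increments of h are dominated by those of g. This one rule covers Lipschitz
  curves (g the identity), congruence on the interval (M = 1) and test functions along a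
  trajectory.\<close>

lemma absolutely_continuous_compose:
  assumes ac: "absolutely_continuous_on_Icc a b g" and M: "M > 0"
    and lip: "\<And>s t. s \<in> {a..b} \<Longrightarrow> t \<in> {a..b} \<Longrightarrow> norm (h t - h s) \<le> M * norm (g t - g s)"
  shows "absolutely_continuous_on_Icc a b h"
  unfolding absolutely_continuous_iff
proof (intro allI impI)
  fix e :: real assume "e > 0"
  then have "e / M > 0" using M by simp
  then obtain d where d: "d > 0" "ac_modulus a b g (e / M) d"
    using ac unfolding absolutely_continuous_iff by blast
  have "ac_modulus a b h e d"
  proof (rule ac_modulusI)
    fix n :: nat and s t
    assume st: "\<And>i. i < n \<Longrightarrow> a \<le> s i \<and> s i \<le> t i \<and> t i \<le> b"
      and disj: "disjoint_family_on (\<lambda>i. {s i<..<t i}) {..<n}" "(\<Sum>i<n. t i - s i) < d"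
    have "(\<Sum>i<n. norm (h (t i) - h (s i))) \<le> (\<Sum>i<n. M * norm (g (t i) - g (s i)))"
    proof (rule sum_mono)
      fix i assume "i \<in> {..<n}"
      then have "a \<le> s i \<and> s i \<le> t i \<and> t i \<le> b" using st by blast
      then show "norm (h (t i) - h (s i)) \<le> M * norm (g (t i) - g (s i))" by (intro lip) auto
    qed
    also have "\<dots> = M * (\<Sum>i<n. norm (g (t i) - g (s i)))" by (simp add: sum_distrib_left)
    also have "\<dots> < M * (e / M)" by (rule mult_strict_left_mono[OF ac_modulusD[OF d(2) st disj] M])
    finally show "(\<Sum>i<n. norm (h (t i) - h (s i))) < e" using M by simp
  qed
  then show "\<exists>d>0. ac_modulus a b h e d" using d(1) by blast
qed

lemma absolutely_continuous_cong:
  assumes "absolutely_continuous_on_Icc a b g" "\<And>s. s \<in> {a..b} \<Longrightarrow> g s = h s"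
  shows "absolutely_continuous_on_Icc a b h"
  by (rule absolutely_continuous_compose[OF assms(1), of 1]) (simp_all add: assms(2)[symmetric])

lemma absolutely_continuous_id: "absolutely_continuous_on_Icc a b (\<lambda>s::real. s)"
  unfolding absolutely_continuous_iff
proof (intro allI impI)
  fix e :: real assume "e > 0"
  moreover have "ac_modulus a b (\<lambda>s::real. s) e e"
  proof (rule ac_modulusI)
    fix n :: nat and s t
    assume st: "\<And>i. i < n \<Longrightarrow> a \<le> s i \<and> s i \<le> t i \<and> t i \<le> b" and len: "(\<Sum>i<n. t i - s i) < e"
    have "(\<Sum>i<n. norm (t i - s i)) = (\<Sum>i<n. t i - s i)" using st by (intro sum.cong) auto
    then show "(\<Sum>i<n. norm (t i - s i)) < e" using len by simp
  qed
  ultimately show "\<exists>d>0. ac_modulus a b (\<lambda>s. s) e d" by blast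
qed

lemma absolutely_continuous_lipschitz:
  assumes "\<And>s t. s \<in> {a..b} \<Longrightarrow> t \<in> {a..b} \<Longrightarrow> norm (g t - g s) \<le> M * \<bar>t - s\<bar>" and "M > 0"
  shows "absolutely_continuous_on_Icc a b g"
  by (rule absolutely_continuous_compose[OF absolutely_continuous_id assms(2)]) (use assms(1) in simp)

text \<open>Every interval of a family is cut at b by min and max. The two truncated families stay
  disjoint and get no longer, and the triangle inequality through g b recovers the
  increments.\<close>

lemma absolutely_continuous_concat:
  assumes ab: "absolutely_continuous_on_Icc a b g" and bc: "absolutely_continuous_on_Icc b c g"
    and "a \<le> b" "b \<le> c"
  shows "absolutely_continuous_on_Icc a c g"
  unfolding absolutely_continuous_iff
proof (intro allI impI)
  fix e :: real assume "e > 0"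
  then have "e / 2 > 0" by simp
  then obtain d1 d2 where d: "d1 > 0" "d2 > 0"
    and d1: "ac_modulus a b g (e / 2) d1" and d2: "ac_modulus b c g (e / 2) d2"
    using ab bc unfolding absolutely_continuous_iff by metis
  have "ac_modulus a c g e (min d1 d2)"
  proof (rule ac_modulusI)
    fix n :: nat and s t
    assume st: "\<And>i. i < n \<Longrightarrow> a \<le> s i \<and> s i \<le> t i \<and> t i \<le> c"
      and fam: "disjoint_family_on (\<lambda>i. {s i<..<t i}) {..<n}" and len: "(\<Sum>i<n. t i - s i) < min d1 d2"
    have disj: "{s i<..<t i} \<inter> {s j<..<t j} = {}" if "i < n" "j < n" "i \<noteq> j" for i j
      using fam that by (simp add: disjoint_family_on_def)
    have A: "(\<Sum>i<n. norm (g (min (t i) b) - g (min (s i) b))) < e / 2"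
    proof (rule ac_modulusD[OF d1])
      show "disjoint_family_on (\<lambda>i. {min (s i) b<..<min (t i) b}) {..<n}"
        unfolding disjoint_family_on_def
      proof (intro ballI impI equals0I)
        fix i j x assume ij: "i \<in> {..<n}" "j \<in> {..<n}" "i \<noteq> j"
          and "x \<in> {min (s i) b<..<min (t i) b} \<inter> {min (s j) b<..<min (t j) b}"
        then have "x \<in> {s i<..<t i} \<inter> {s j<..<t j}" by (auto simp: min_def split: if_splits)
        then show False using disj ij by blast
      qed
      have "(\<Sum>i<n. min (t i) b - min (s i) b) \<le> (\<Sum>i<n. t i - s i)"
        using st by (intro sum_mono) (smt (verit) lessThan_iff)
      then show "(\<Sum>i<n. min (t i) b - min (s i) b) < d1" using len by simp
      fix i assume "i < n"
      from st[OF this] show "a \<le> min (s i) b \<and> min (s i) b \<le> min (t i) b \<and> min (t i) b \<le> b"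
        using assms by auto
    qed
    have B: "(\<Sum>i<n. norm (g (max (t i) b) - g (max (s i) b))) < e / 2"
    proof (rule ac_modulusD[OF d2])
      show "disjoint_family_on (\<lambda>i. {max (s i) b<..<max (t i) b}) {..<n}"
        unfolding disjoint_family_on_def
      proof (intro ballI impI equals0I)
        fix i j x assume ij: "i \<in> {..<n}" "j \<in> {..<n}" "i \<noteq> j"
          and "x \<in> {max (s i) b<..<max (t i) b} \<inter> {max (s j) b<..<max (t j) b}"
        then have "x \<in> {s i<..<t i} \<inter> {s j<..<t j}" by (auto simp: max_def split: if_splits)
        then show False using disj ij by blast
      qed
      have "(\<Sum>i<n. max (t i) b - max (s i) b) \<le> (\<Sum>i<n. t i - s i)"
        using st by (intro sum_mono) (smt (verit) lessThan_iff)
      then show "(\<Sum>i<n. max (t i) b - max (s i) b) < d2" using len by simp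
      fix i assume "i < n"
      from st[OF this] show "b \<le> max (s i) b \<and> max (s i) b \<le> max (t i) b \<and> max (t i) b \<le> c"
        using assms by auto
    qed
    have "(\<Sum>i<n. norm (g (t i) - g (s i))) \<le> (\<Sum>i<n. norm (g (min (t i) b) - g (min (s i) b)) + norm (g (max (t i) b) - g (max (s i) b)))"
    proof (rule sum_mono)
      fix i
      consider "t i \<le> b" "s i \<le> b" | "s i > b" "t i > b" | "s i \<le> b" "b < t i" | "t i \<le> b" "b < s i" by linarith
      then show "norm (g (t i) - g (s i)) \<le> norm (g (min (t i) b) - g (min (s i) b)) + norm (g (max (t i) b) - g (max (s i) b))"
      proof cases
        case 3
        then show ?thesis using norm_triangle_ineq[of "g b - g (s i)" "g (t i) - g b"] by (simp add: min_def max_def)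
      next
        case 4
        then show ?thesis using norm_triangle_ineq[of "g b - g (s i)" "g (t i) - g b"] by (simp add: min_def max_def)
      qed (auto simp: min_def max_def)
    qed
    also have "\<dots> < e" unfolding sum.distrib using A B by simp
    finally show "(\<Sum>i<n. norm (g (t i) - g (s i))) < e" .
  qed
  moreover have "min d1 d2 > 0" using d by simp
  ultimately show "\<exists>d>0. ac_modulus a c g e d" by blast
qed

lemma absolutely_continuous_imp_continuous:
  assumes "absolutely_continuous_on_Icc a b g"
  shows "continuous_on {a..b} g"
  unfolding continuous_on_iff
proof (intro ballI allI impI)
  fix x e :: real assume x: "x \<in> {a..b}" and "e > 0"
  then obtain d where d: "d > 0" "ac_modulus a b g e d"
    using assms unfolding absolutely_continuous_iff by blast
  show "\<exists>d>0. \<forall>y\<in>{a..b}. dist y x < d \<longrightarrow> dist (g y) (g x) < e"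
  proof (intro exI[of _ d] conjI ballI impI d(1))
    fix y assume y: "y \<in> {a..b}" "dist y x < d"
    \<comment> \<open>A family of one interval, its end points put in increasing order.\<close>
    have "(\<Sum>i<Suc 0. norm (g ((\<lambda>_. max x y) i) - g ((\<lambda>_. min x y) i))) < e"
      by (rule ac_modulusD[OF d(2)]) (use x y in \<open>auto simp: dist_real_def disjoint_family_on_def\<close>)
    then show "dist (g y) (g x) < e"
      by (auto simp: dist_norm norm_minus_commute max_def min_def split: if_splits)
  qed
qed

section \<open>Admissible pairs: restriction, translation, concatenation\<close>

lemma control_matrix_mult: "control_matrix f x *v u = (\<Sum>i\<in>UNIV. u $ i *\<^sub>R f i x)"
  by (simp add: vec_eq_iff control_matrix_def matrix_vector_mult_def mult.commute)

lemma control_matrix_axis: "control_matrix f x *v axis i c = c *\<^sub>R f i x"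
proof -
  have "control_matrix f x *v axis i c = (\<Sum>j\<in>UNIV. if j = i then c *\<^sub>R f j x else 0)"
    unfolding control_matrix_mult by (rule sum.cong) (auto simp: axis_def)
  then show ?thesis by simp
qed

lemma borel_measurable_times_indicator_lebesgue:
  fixes g :: "real \<Rightarrow> ennreal"
  assumes "g \<in> borel_measurable (lebesgue_on {a..b})"
  shows "(\<lambda>s. g s * indicator {a..b} s) \<in> borel_measurable lebesgue"
  by (rule borel_measurable_restrict_space_iff_ennreal[THEN iffD1, OF _ assms]) simp

text \<open>Extension by zero to the whole line makes both conditions compatible with restriction,
  translation and gluing, where the restricted measure would change from interval to
  interval.\<close>

lemma L2_on_iff:
  "L2_on {a..b} u \<longleftrightarrow> (\<lambda>s. indicator {a..b} s *\<^sub>R u s) \<in> borel_measurable lebesgue \<and>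
    nn_cost (\<lambda>s. ennreal ((norm (u s))\<^sup>2)) a b < \<infinity>"
proof -
  have m: "(\<lambda>s. (norm (u s))\<^sup>2) \<in> borel_measurable (lebesgue_on {a..b})"
    if "u \<in> borel_measurable (lebesgue_on {a..b})" using that by measurable
  have "L2_on {a..b} u \<longleftrightarrow> u \<in> borel_measurable (lebesgue_on {a..b}) \<and>
      (\<integral>\<^sup>+s. ennreal ((norm (u s))\<^sup>2) \<partial>lebesgue_on {a..b}) < \<infinity>"
    unfolding L2_on_def integrable_iff_bounded using m by auto
  then show ?thesis
    by (simp add: borel_measurable_restrict_space_iff nn_integral_restrict_space nn_cost_def)
qed

lemma L2_on_measurable:
  assumes "L2_on {a..b} u"
  shows "(\<lambda>s. ennreal ((norm (u s))\<^sup>2) * indicator {a..b} s) \<in> borel_measurable lebesgue"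
proof -
  have "u \<in> borel_measurable (lebesgue_on {a..b})" using assms by (simp add: L2_on_def)
  then have "(\<lambda>s. ennreal ((norm (u s))\<^sup>2)) \<in> borel_measurable (lebesgue_on {a..b})" by measurable
  then show ?thesis by (rule borel_measurable_times_indicator_lebesgue)
qed

lemma admissible_iff:
  "(\<gamma>, u) \<in> admissible f a b \<longleftrightarrow> absolutely_continuous_on_Icc a b \<gamma> \<and> L2_on {a..b} u \<and>
    (AE s in lebesgue. s \<in> {a..b} \<longrightarrow>
      (\<gamma> has_vector_derivative (control_matrix f (\<gamma> s) *v u s)) (at s within {a..b}))"
  by (simp add: admissible_def AE_restrict_space_iff)

lemma L2_on_subset:
  assumes "L2_on {a..b} u" "a \<le> a'" "b' \<le> b"
  shows "L2_on {a'..b'} u"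
proof -
  have m: "(\<lambda>s. indicator {a..b} s *\<^sub>R u s) \<in> borel_measurable lebesgue"
    and fin: "nn_cost (\<lambda>s. ennreal ((norm (u s))\<^sup>2)) a b < \<infinity>" using assms(1) by (auto simp: L2_on_iff)
  have "(\<lambda>s. indicator {a'..b'} s *\<^sub>R (indicator {a..b} s *\<^sub>R u s)) \<in> borel_measurable lebesgue"
    by (rule borel_measurable_scaleR[OF borel_measurable_indicator m]) simp
  moreover have "(\<lambda>s. indicator {a'..b'} s *\<^sub>R (indicator {a..b} s *\<^sub>R u s)) = (\<lambda>s. indicator {a'..b'} s *\<^sub>R u s)"
    using assms by (auto simp: indicator_def)
  moreover have "nn_cost (\<lambda>s. ennreal ((norm (u s))\<^sup>2)) a' b' \<le> nn_cost (\<lambda>s. ennreal ((norm (u s))\<^sup>2)) a b"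
    unfolding nn_cost_def using assms by (intro nn_integral_mono) (auto simp: indicator_def)
  ultimately show ?thesis using fin by (auto simp: L2_on_iff intro: le_less_trans)
qed

lemma admissible_subset:
  assumes "(\<gamma>, u) \<in> admissible f a b" "a \<le> a'" "b' \<le> b"
  shows "(\<gamma>, u) \<in> admissible f a' b'"
proof -
  have "AE s in lebesgue. s \<in> {a..b} \<longrightarrow>
      (\<gamma> has_vector_derivative (control_matrix f (\<gamma> s) *v u s)) (at s within {a..b})"
    using assms(1) by (simp add: admissible_iff)
  then have "AE s in lebesgue. s \<in> {a'..b'} \<longrightarrow>
      (\<gamma> has_vector_derivative (control_matrix f (\<gamma> s) *v u s)) (at s within {a'..b'})"
    by eventually_elim (use assms in \<open>auto intro: has_vector_derivative_within_subset\<close>)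
  then show ?thesis
    using assms absolutely_continuous_subset L2_on_subset by (auto simp: admissible_iff)
qed

lemma admissible_shift:
  assumes "(\<gamma>, u) \<in> admissible f a b"
  shows "(\<lambda>s. \<gamma> (s + k), \<lambda>s. u (s + k)) \<in> admissible f (a - k) (b - k)"
proof -
  have m: "(\<lambda>s. indicator {a..b} s *\<^sub>R u s) \<in> borel_measurable lebesgue"
    and fin: "nn_cost (\<lambda>s. ennreal ((norm (u s))\<^sup>2)) a b < \<infinity>" and L2: "L2_on {a..b} u"
    using assms(1) by (auto simp: L2_on_iff admissible_iff)
  have "(\<lambda>s. indicator {a..b} (s + k) *\<^sub>R u (s + k)) \<in> borel_measurable lebesgue"
    using measurable_compose[OF measurable_lebesgue_shift[of k] m] .
  then have 1: "L2_on {a - k..b - k} (\<lambda>s. u (s + k))"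
    using fin nn_cost_shift[OF L2_on_measurable[OF L2], of k] by (simp add: L2_on_iff indicator_shift)
  have "AE s in distr lebesgue lebesgue (\<lambda>x. x + k). s \<in> {a..b} \<longrightarrow>
      (\<gamma> has_vector_derivative (control_matrix f (\<gamma> s) *v u s)) (at s within {a..b})"
    using assms(1) unfolding admissible_iff lebesgue_shift by blast
  from AE_distrD[OF measurable_lebesgue_shift this]
  have "AE s in lebesgue. s \<in> {a - k..b - k} \<longrightarrow> ((\<lambda>s. \<gamma> (s + k)) has_vector_derivative
      (control_matrix f (\<gamma> (s + k)) *v u (s + k))) (at s within {a - k..b - k})"
  proof eventually_elim
    case (elim s)
    show ?case
    proof
      assume s: "s \<in> {a - k..b - k}"
      have im: "(\<lambda>s. s + k) ` {a - k..b - k} = {a..b}"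
        using image_add_atLeastAtMost'[of k "a - k" "b - k"] by simp
      have "(\<gamma> \<circ> (\<lambda>s. s + k) has_vector_derivative 1 *\<^sub>R (control_matrix f (\<gamma> (s + k)) *v u (s + k)))
          (at s within {a - k..b - k})"
        by (rule vector_diff_chain_within)
          (use elim s in \<open>auto simp: im intro!: derivative_eq_intros\<close>)
      then show "((\<lambda>s. \<gamma> (s + k)) has_vector_derivative
        (control_matrix f (\<gamma> (s + k)) *v u (s + k))) (at s within {a - k..b - k})" by (simp add: o_def)
    qed
  qed
  with 1 show ?thesis
    using assms absolutely_continuous_shift by (auto simp: admissible_iff)
qed

lemma admissible_concat:
  assumes 1: "(\<gamma>1, u1) \<in> admissible f a b" and 2: "(\<gamma>2, u2) \<in> admissible f b c"
    and eq: "\<gamma>1 b = \<gamma>2 b" and ab: "a \<le> b" "b \<le> c"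
  defines "\<gamma> \<equiv> \<lambda>s. if s \<le> b then \<gamma>1 s else \<gamma>2 s" and "u \<equiv> \<lambda>s. if s \<le> b then u1 s else u2 s"
  shows "(\<gamma>, u) \<in> admissible f a c"
  unfolding admissible_iff
proof (intro conjI)
  show "absolutely_continuous_on_Icc a c \<gamma>"
  proof (rule absolutely_continuous_concat[OF _ _ ab])
    show "absolutely_continuous_on_Icc a b \<gamma>" "absolutely_continuous_on_Icc b c \<gamma>"
      using 1 2 eq unfolding admissible_iff
      by (auto elim!: absolutely_continuous_cong simp: \<gamma>_def)
  qed
  have m1: "(\<lambda>s. indicator {a..b} s *\<^sub>R u1 s) \<in> borel_measurable lebesgue"
    and f1: "nn_cost (\<lambda>s. ennreal ((norm (u1 s))\<^sup>2)) a b < \<infinity>"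
    using 1 by (auto simp: L2_on_iff admissible_iff)
  have m2: "(\<lambda>s. indicator {b..c} s *\<^sub>R u2 s) \<in> borel_measurable lebesgue"
    and f2: "nn_cost (\<lambda>s. ennreal ((norm (u2 s))\<^sup>2)) b c < \<infinity>"
    using 2 by (auto simp: L2_on_iff admissible_iff)
  \<comment> \<open>The half-open interval counts the value at b only once, in agreement with the
    convention s \<le> b in the glued control.\<close>
  have "(\<lambda>s. indicator {a..b} s *\<^sub>R u1 s + indicator {b<..c} s *\<^sub>R (indicator {b..c} s *\<^sub>R u2 s)) \<in> borel_measurable lebesgue"
    by (rule borel_measurable_add[OF m1 borel_measurable_scaleR[OF borel_measurable_indicator m2]]) simp
  also have "(\<lambda>s. indicator {a..b} s *\<^sub>R u1 s + indicator {b<..c} s *\<^sub>R (indicator {b..c} s *\<^sub>R u2 s)) =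
    (\<lambda>s. indicator {a..c} s *\<^sub>R u s)"
    using ab by (auto simp: indicator_def u_def)
  finally have m: "(\<lambda>s. indicator {a..c} s *\<^sub>R u s) \<in> borel_measurable lebesgue" .
  then have "u \<in> borel_measurable (lebesgue_on {a..c})" by (simp add: borel_measurable_restrict_space_iff)
  then have "(\<lambda>s. ennreal ((norm (u s))\<^sup>2)) \<in> borel_measurable (lebesgue_on {a..c})" by measurable
  then have "(\<lambda>s. ennreal ((norm (u s))\<^sup>2) * indicator {a..c} s) \<in> borel_measurable lebesgue"
    by (rule borel_measurable_times_indicator_lebesgue)
  from nn_cost_split[OF ab this]
  have "nn_cost (\<lambda>s. ennreal ((norm (u s))\<^sup>2)) a c =
    nn_cost (\<lambda>s. ennreal ((norm (u1 s))\<^sup>2)) a b + nn_cost (\<lambda>s. ennreal ((norm (u2 s))\<^sup>2)) b c"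
    using nn_cost_cong[of a b "\<lambda>s. ennreal ((norm (u s))\<^sup>2)" "\<lambda>s. ennreal ((norm (u1 s))\<^sup>2)"]
      nn_cost_cong[of b c "\<lambda>s. ennreal ((norm (u s))\<^sup>2)" "\<lambda>s. ennreal ((norm (u2 s))\<^sup>2)"]
    by (simp add: u_def)
  with f1 f2 m show "L2_on {a..c} u" by (simp add: L2_on_iff)
  have "AE s in lebesgue. s \<in> {a..b} \<longrightarrow>
      (\<gamma>1 has_vector_derivative (control_matrix f (\<gamma>1 s) *v u1 s)) (at s within {a..b})"
    using 1 by (simp add: admissible_iff)
  moreover have "AE s in lebesgue. s \<in> {b..c} \<longrightarrow>
      (\<gamma>2 has_vector_derivative (control_matrix f (\<gamma>2 s) *v u2 s)) (at s within {b..c})"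
    using 2 by (simp add: admissible_iff)
  ultimately show "AE s in lebesgue. s \<in> {a..c} \<longrightarrow>
      (\<gamma> has_vector_derivative (control_matrix f (\<gamma> s) *v u s)) (at s within {a..c})"
    using AE_lebesgue_neq[of b]
  proof eventually_elim
    case (elim s)
    show ?case
    proof
      assume s: "s \<in> {a..c}"
      show "(\<gamma> has_vector_derivative (control_matrix f (\<gamma> s) *v u s)) (at s within {a..c})"
      \<comment> \<open>Away from b the glued curve coincides locally with one of the pieces, so the
        derivatives within the two intervals agree; s = b is excluded up to a null set.\<close>
      proof (cases "s < b")
        case True
        have "at s within {a..c} = at s within {a..b}"
          by (rule at_within_nhd[of s "{..<b}"]) (use True ab in auto)
        moreover have "(\<gamma> has_vector_derivative (control_matrix f (\<gamma>1 s) *v u1 s)) (at s within {a..b})"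
          by (rule has_vector_derivative_transform[of s "{a..b}" \<gamma> \<gamma>1]) (use elim s True in \<open>auto simp: \<gamma>_def\<close>)
        ultimately show ?thesis using True by (simp add: \<gamma>_def u_def)
      next
        case False
        then have sb: "s > b" using elim by auto
        have "at s within {a..c} = at s within {b..c}"
          by (rule at_within_nhd[of s "{b<..}"]) (use sb ab in auto)
        moreover have "(\<gamma> has_vector_derivative (control_matrix f (\<gamma>2 s) *v u2 s)) (at s within {b..c})"
          by (rule has_vector_derivative_transform[of s "{b..c}" \<gamma> \<gamma>2]) (use elim s sb eq in \<open>auto simp: \<gamma>_def\<close>)
        ultimately show ?thesis using sb by (simp add: \<gamma>_def u_def)
      qed
    qed
  qed
qed

lemma L2_on_const: "L2_on {a..b} (\<lambda>s. c)"
  unfolding L2_on_def by (auto intro!: integrable_const finite_measure.integrable_const finite_measure_lebesgue_on)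

lemma admissible_constant_control:
  assumes D: "\<And>s. s \<in> {a..b} \<Longrightarrow>
      (\<gamma> has_vector_derivative (control_matrix f (\<gamma> s) *v c)) (at s within {a..b})"
    and M: "\<And>s. s \<in> {a..b} \<Longrightarrow> norm (control_matrix f (\<gamma> s) *v c) \<le> M"
  shows "(\<gamma>, \<lambda>s. c) \<in> admissible f a b"
  unfolding admissible_iff
proof (intro conjI L2_on_const)
  show "absolutely_continuous_on_Icc a b \<gamma>"
  proof (rule absolutely_continuous_lipschitz[where M = "\<bar>M\<bar> + 1"])
    fix s t assume st: "s \<in> {a..b}" "t \<in> {a..b}"
    have "norm (\<gamma> t - \<gamma> s) \<le> (\<bar>M\<bar> + 1) * norm (t - s)"
    proof (rule differentiable_bound[where S = "{a..b}"])
      show "(\<gamma> has_derivative (\<lambda>h. h *\<^sub>R (control_matrix f (\<gamma> s) *v c))) (at s within {a..b})" if "s \<in> {a..b}" for s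
        using D[OF that] by (simp add: has_vector_derivative_def)
      show "onorm (\<lambda>h. h *\<^sub>R (control_matrix f (\<gamma> s) *v c)) \<le> \<bar>M\<bar> + 1" if "s \<in> {a..b}" for s
        using M[OF that] by (intro onorm_scaleR_left_le) auto
    qed (use st in auto)
    then show "norm (\<gamma> t - \<gamma> s) \<le> (\<bar>M\<bar> + 1) * \<bar>t - s\<bar>" by simp
  qed auto
qed (use D in auto)

lemma admissible_const: "(\<lambda>_. x, \<lambda>_. 0) \<in> admissible f a b"
  by (rule admissible_constant_control[where M = 0]) auto

section \<open>Connections between points and their costs\<close>

locale control_problem =
  fixes f :: "'m::finite \<Rightarrow> real^'d \<Rightarrow> real^'d" and L :: "real^'d \<Rightarrow> real^'m \<Rightarrow> real"
  assumes smooth_f: "smooth (f i)"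
    and L_cont: "continuous_on UNIV (\<lambda>(x, u). L x u)"
begin

text \<open>\<open>ennreal\<close> discards the negative part of L. Under L \<ge> 0, where this is
  compared with the Lax-Oleinik operator, it is the true cost.\<close>

abbreviation cost :: "(real \<Rightarrow> real^'d) \<Rightarrow> (real \<Rightarrow> real^'m) \<Rightarrow> real \<Rightarrow> real \<Rightarrow> ennreal" where
  "cost \<gamma> u a b \<equiv> nn_cost (\<lambda>s. ennreal (L (\<gamma> s) (u s))) a b"

text \<open>\<kappa> is any real bound for the cost rather than the cost itself. Infima and
  concatenations thereby become statements about real numbers, with trajectories and controls
  hidden.\<close>

definition conn :: "real \<Rightarrow> real^'d \<Rightarrow> real^'d \<Rightarrow> real \<Rightarrow> bool" where
  "conn t x y \<kappa> \<longleftrightarrow> 0 \<le> t \<and> 0 \<le> \<kappa> \<and> (\<exists>\<gamma> u. (\<gamma>, u) \<in> admissible f 0 t \<and> \<gamma> 0 = x \<and> \<gamma> t = y \<and>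
      cost \<gamma> u 0 t \<le> ennreal \<kappa>)"

lemma connI:
  assumes "(\<gamma>, u) \<in> admissible f 0 t" "cost \<gamma> u 0 t \<le> ennreal \<kappa>" "0 \<le> t" "0 \<le> \<kappa>" "\<gamma> 0 = x" "\<gamma> t = y"
  shows "conn t x y \<kappa>"
  using assms unfolding conn_def by blast

lemma cost_measurable:
  assumes "(\<gamma>, u) \<in> admissible f a b"
  shows "(\<lambda>s. ennreal (L (\<gamma> s) (u s)) * indicator {a..b} s) \<in> borel_measurable lebesgue"
proof -
  have "\<gamma> \<in> borel_measurable (lebesgue_on {a..b})"
    using assms by (intro continuous_imp_measurable_on_sets_lebesgue absolutely_continuous_imp_continuous)
      (auto simp: admissible_iff)
  moreover have "u \<in> borel_measurable (lebesgue_on {a..b})" using assms by (simp add: admissible_iff L2_on_def)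
  ultimately have "(\<lambda>s. (\<gamma> s, u s)) \<in> borel_measurable (lebesgue_on {a..b})"
    by (rule borel_measurable_Pair)
  from measurable_compose[OF this borel_measurable_continuous_onI[OF L_cont]]
  have "(\<lambda>s. L (\<gamma> s) (u s)) \<in> borel_measurable (lebesgue_on {a..b})" by simp
  then have "(\<lambda>s. ennreal (L (\<gamma> s) (u s))) \<in> borel_measurable (lebesgue_on {a..b})" by measurable
  then show ?thesis by (rule borel_measurable_times_indicator_lebesgue)
qed

lemma conn_refl: "conn 0 x x 0"
  unfolding conn_def
  by (intro conjI exI[of _ "\<lambda>_. x"] exI[of _ "\<lambda>_. 0"] admissible_const)
    (simp_all add: nn_cost_const)

lemma conn_wait:
  assumes "L x 0 = 0" "t \<ge> 0"
  shows "conn t x x 0"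
  unfolding conn_def
  by (intro conjI exI[of _ "\<lambda>_. x"] exI[of _ "\<lambda>_. 0"] admissible_const)
    (simp_all add: nn_cost_const assms)

lemma conn_trans:
  assumes "conn t1 x y \<kappa>1" "conn t2 y z \<kappa>2"
  shows "conn (t1 + t2) x z (\<kappa>1 + \<kappa>2)"
proof -
  obtain \<gamma>1 u1 where 1: "0 \<le> t1" "0 \<le> \<kappa>1" "(\<gamma>1, u1) \<in> admissible f 0 t1" "\<gamma>1 0 = x" "\<gamma>1 t1 = y"
      "cost \<gamma>1 u1 0 t1 \<le> ennreal \<kappa>1"
    using assms(1) unfolding conn_def by blast
  obtain \<gamma>2 u2 where 2: "0 \<le> t2" "0 \<le> \<kappa>2" "(\<gamma>2, u2) \<in> admissible f 0 t2" "\<gamma>2 0 = y" "\<gamma>2 t2 = z"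
      "cost \<gamma>2 u2 0 t2 \<le> ennreal \<kappa>2"
    using assms(2) unfolding conn_def by blast
  define \<gamma>3 u3 where "\<gamma>3 = (\<lambda>s. \<gamma>2 (s + - t1))" and "u3 = (\<lambda>s. u2 (s + - t1))"
  have 3: "(\<gamma>3, u3) \<in> admissible f t1 (t1 + t2)"
    using admissible_shift[OF 2(3), of "- t1"] by (simp add: \<gamma>3_def u3_def add.commute)
  have c3: "cost \<gamma>3 u3 t1 (t1 + t2) = cost \<gamma>2 u2 0 t2"
    using nn_cost_shift[OF cost_measurable[OF 2(3)], of "- t1"] by (simp add: \<gamma>3_def u3_def add.commute)
  define \<gamma> u where "\<gamma> = (\<lambda>s. if s \<le> t1 then \<gamma>1 s else \<gamma>3 s)" and "u = (\<lambda>s. if s \<le> t1 then u1 s else u3 s)"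
  have j: "\<gamma>1 t1 = \<gamma>3 t1" using 1 2 by (simp add: \<gamma>3_def)
  have adm: "(\<gamma>, u) \<in> admissible f 0 (t1 + t2)"
    unfolding \<gamma>_def u_def using admissible_concat[OF 1(3) 3 j] 1(1) 2(1) by simp
  have "cost \<gamma> u 0 (t1 + t2) = cost \<gamma> u 0 t1 + cost \<gamma> u t1 (t1 + t2)"
    by (rule nn_cost_split[OF _ _ cost_measurable[OF adm]]) (use 1 2 in auto)
  also have "cost \<gamma> u 0 t1 = cost \<gamma>1 u1 0 t1" by (rule nn_cost_cong) (simp add: \<gamma>_def u_def)
  also have "cost \<gamma> u t1 (t1 + t2) = cost \<gamma>3 u3 t1 (t1 + t2)" by (rule nn_cost_cong) (simp add: \<gamma>_def u_def)
  also have "cost \<gamma>1 u1 0 t1 + cost \<gamma>3 u3 t1 (t1 + t2) \<le> ennreal (\<kappa>1 + \<kappa>2)"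
    unfolding c3 using 1 2 by (simp add: ennreal_plus add_mono)
  finally have c: "cost \<gamma> u 0 (t1 + t2) \<le> ennreal (\<kappa>1 + \<kappa>2)" .
  have "\<gamma> 0 = x" using 1 by (simp add: \<gamma>_def)
  \<comment> \<open>For t2 = 0 the glued curve takes its end point from the first piece, hence the
    case distinction.\<close>
  moreover have "\<gamma> (t1 + t2) = z"
    using 1 2 j by (cases "t2 = 0") (simp_all add: \<gamma>_def \<gamma>3_def)
  ultimately show ?thesis using connI[OF adm c] 1 2 by simp
qed

text \<open>Cutting at time s splits the cost exactly. The pair is given, not merely a connection,
  so that a caller can choose s after looking at the trajectory, as
  \<open>conn_passes_near_rest\<close> does.\<close>

lemma admissible_conn:
  assumes adm: "(\<gamma>, u) \<in> admissible f 0 t" and cost: "cost \<gamma> u 0 t \<le> ennreal \<kappa>"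
    and s: "0 \<le> s" "s \<le> t" and "0 \<le> \<kappa>"
  obtains \<kappa>1 \<kappa>2 where "conn s (\<gamma> 0) (\<gamma> s) \<kappa>1" "conn (t - s) (\<gamma> s) (\<gamma> t) \<kappa>2" "\<kappa>1 + \<kappa>2 \<le> \<kappa>"
    "cost \<gamma> u 0 s = ennreal \<kappa>1"
proof -
  have a1: "(\<gamma>, u) \<in> admissible f 0 s" and a2: "(\<gamma>, u) \<in> admissible f s t"
    using admissible_subset[OF adm] s by auto
  have sum: "cost \<gamma> u 0 t = cost \<gamma> u 0 s + cost \<gamma> u s t"
    by (rule nn_cost_split[OF s cost_measurable[OF adm]])
  then have nt: "cost \<gamma> u 0 s \<noteq> top" "cost \<gamma> u s t \<noteq> top"
    using cost by (auto simp: top_unique)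
  obtain \<kappa>1 where \<kappa>1: "cost \<gamma> u 0 s = ennreal \<kappa>1" "0 \<le> \<kappa>1"
    using nt(1) by (cases "cost \<gamma> u 0 s") simp_all
  obtain \<kappa>2 where \<kappa>2: "cost \<gamma> u s t = ennreal \<kappa>2" "0 \<le> \<kappa>2"
    using nt(2) by (cases "cost \<gamma> u s t") simp_all
  note \<kappa> = \<kappa>1(1) \<kappa>2(1) \<kappa>1(2) \<kappa>2(2)
  have "ennreal (\<kappa>1 + \<kappa>2) = cost \<gamma> u 0 t" unfolding sum \<kappa>(1,2) by (rule ennreal_plus[OF \<kappa>(3,4)])
  then have "ennreal (\<kappa>1 + \<kappa>2) \<le> ennreal \<kappa>" using cost by (simp only:)
  then have le: "\<kappa>1 + \<kappa>2 \<le> \<kappa>" using ennreal_le_iff[OF \<open>0 \<le> \<kappa>\<close>] by blast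
  have c1: "conn s (\<gamma> 0) (\<gamma> s) \<kappa>1" by (rule connI[OF a1]) (use \<kappa> s in simp_all)
  have "cost (\<lambda>r. \<gamma> (r + s)) (\<lambda>r. u (r + s)) 0 (t - s) = ennreal \<kappa>2"
    using nn_cost_shift[OF cost_measurable[OF a2], of s] \<kappa> by simp
  moreover have "(\<lambda>r. \<gamma> (r + s), \<lambda>r. u (r + s)) \<in> admissible f 0 (t - s)"
    using admissible_shift[OF a2, of s] by simp
  ultimately have c2: "conn (t - s) (\<gamma> s) (\<gamma> t) \<kappa>2"
    using \<kappa> s by (intro connI[of "\<lambda>r. \<gamma> (r + s)" "\<lambda>r. u (r + s)"]) simp_all
  show ?thesis by (rule that[OF c1 c2 le \<kappa>(1)])
qed

lemma conn_split:
  assumes "conn t x y \<kappa>" "0 \<le> s" "s \<le> t"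
  obtains z \<kappa>1 \<kappa>2 where "conn s x z \<kappa>1" "conn (t - s) z y \<kappa>2" "\<kappa>1 + \<kappa>2 \<le> \<kappa>"
proof -
  obtain \<gamma> u where g: "0 \<le> \<kappa>" "(\<gamma>, u) \<in> admissible f 0 t" "\<gamma> 0 = x" "\<gamma> t = y" "cost \<gamma> u 0 t \<le> ennreal \<kappa>"
    using assms(1) unfolding conn_def by blast
  show ?thesis
    by (rule admissible_conn[OF g(2,5) assms(2,3) g(1)]) (use that g(3,4) in simp)
qed

text \<open>The time is bounded along with the cost, because a short connection will later have to
  fit into a prescribed total time, the rest of which is spent waiting.\<close>

definition reach :: "real \<Rightarrow> real^'d \<Rightarrow> real^'d \<Rightarrow> bool" where
  "reach e x y \<longleftrightarrow> (\<exists>t \<kappa>. conn t x y \<kappa> \<and> t \<le> e \<and> \<kappa> \<le> e)"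

lemma C_k_f: "C_k k (f i)"
  using smooth_f by (simp add: smooth_def)

lemma conn_constant_control:
  assumes "0 \<le> t" and D: "\<And>s. s \<in> {0..t} \<Longrightarrow>
      (\<gamma> has_vector_derivative (control_matrix f (\<gamma> s) *v v)) (at s within {0..t})"
    and B: "\<And>s. s \<in> {0..t} \<Longrightarrow> L (\<gamma> s) v \<le> B" and "0 \<le> B"
    and M: "\<And>s. s \<in> {0..t} \<Longrightarrow> norm (control_matrix f (\<gamma> s) *v v) \<le> M"
  shows "conn t (\<gamma> 0) (\<gamma> t) (B * t)"
proof -
  have "cost \<gamma> (\<lambda>_. v) 0 t \<le> nn_cost (\<lambda>s. ennreal B) 0 t"
    by (intro nn_cost_mono ennreal_leI B)
  also have "\<dots> = ennreal (B * t)" using assms by (simp add: nn_cost_const ennreal_mult)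
  finally show ?thesis
    using assms(1) \<open>0 \<le> B\<close> by (intro connI[OF admissible_constant_control[OF D M]]) simp_all
qed

lemma L_bounded:
  assumes "compact S"
  obtains B where "B > 0" "\<And>x. x \<in> S \<Longrightarrow> L x v \<le> B"
proof -
  have "continuous_on S (\<lambda>x. (\<lambda>(x, u). L x u) (x, v))"
    by (rule continuous_on_compose2[OF L_cont]) (auto intro!: continuous_intros)
  then have "bounded ((\<lambda>x. L x v) ` S)" using assms by (auto intro: compact_imp_bounded compact_continuous_image)
  then obtain B where B: "\<And>x. x \<in> S \<Longrightarrow> \<bar>L x v\<bar> \<le> B" unfolding bounded_iff by (metis imageI real_norm_def)
  show ?thesis
  proof (rule that[of "\<bar>B\<bar> + 1"])
    fix x assume "x \<in> S"
    from B[OF this] show "L x v \<le> \<bar>B\<bar> + 1" by linarith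
  qed auto
qed

text \<open>The system has no drift: the control e_i follows the flow of f_i, and -e_i runs through
  it backwards, so negative times are reached too.\<close>

lemma reach_flow:
  assumes E: "local_flow_of (f i) z r h E"
  shows "\<exists>c>0. \<forall>t\<in>{-h..h}. \<forall>w\<in>cball z r. reach (c * \<bar>t\<bar>) w (E t w)"
proof -
  have E0: "E 0 w = w" for w using E by (simp add: local_flow_of_def)
  have EB: "E t w \<in> cball z (2 * r)"
    and ED: "((\<lambda>s. E s w) has_vector_derivative f i (E t w)) (at t within {-h..h})"
    if "t \<in> {-h..h}" "w \<in> cball z r" for t w
    using E that by (auto simp: local_flow_of_def)
  obtain M where M: "\<And>x. x \<in> cball z (2 * r) \<Longrightarrow> norm (f i x) \<le> M"
    using C_k_cball_bound[OF C_k_f[of 1 i], of z "2 * r"] by metis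
  obtain B1 where B1: "B1 > 0" "\<And>x. x \<in> cball z (2 * r) \<Longrightarrow> L x (axis i 1) \<le> B1"
    using L_bounded[OF compact_cball] by metis
  obtain B2 where B2: "B2 > 0" "\<And>x. x \<in> cball z (2 * r) \<Longrightarrow> L x (axis i (-1)) \<le> B2"
    using L_bounded[OF compact_cball] by metis
  \<comment> \<open>The summand 1 accounts for the elapsed time; B1 and B2 bound the running cost of
    the two controls.\<close>
  define c where "c = 1 + B1 + B2"
  show ?thesis
  proof (intro exI[of _ c] conjI ballI)
    show "c > 0" using B1 B2 by (simp add: c_def)
    fix t w assume t: "t \<in> {-h..h}" and w: "w \<in> cball z r"
    have "conn \<bar>t\<bar> w (E t w) (c * \<bar>t\<bar>)"
    proof (cases "t \<ge> 0")
      case True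
      have sub: "{0..t} \<subseteq> {-h..h}" using t True by auto
      have "conn t (E 0 w) (E t w) (c * t)"
      proof (rule conn_constant_control[OF True, where v = "axis i 1" and M = M])
        fix s assume s: "s \<in> {0..t}"
        then have s': "s \<in> {-h..h}" using sub by blast
        show "((\<lambda>s. E s w) has_vector_derivative control_matrix f (E s w) *v axis i 1) (at s within {0..t})"
          using has_vector_derivative_within_subset[OF ED[OF s' w] sub] by (simp add: control_matrix_axis)
        show "L (E s w) (axis i 1) \<le> c" using B1 B2 EB[OF s' w] by (fastforce simp: c_def)
        show "norm (control_matrix f (E s w) *v axis i 1) \<le> M"
          using M[OF EB[OF s' w]] by (simp add: control_matrix_axis)
      qed (use B1 B2 in \<open>auto simp: c_def\<close>)
      then show ?thesis using True by (simp add: E0)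
    next
      case False
      then have t0: "0 \<le> - t" by simp
      have sub: "uminus ` {0..-t} \<subseteq> {-h..h}" using t False by auto
      have "conn (- t) (E (- 0) w) (E (- (- t)) w) (c * (- t))"
      proof (rule conn_constant_control[OF t0, where v = "axis i (-1)" and M = M])
        fix s assume s: "s \<in> {0..-t}"
        then have s': "- s \<in> {-h..h}" using sub by blast
        have "((\<lambda>s. E s w) \<circ> uminus has_vector_derivative (-1) *\<^sub>R f i (E (- s) w)) (at s within {0..-t})"
        proof (rule vector_diff_chain_within)
          show "((\<lambda>s. E s w) has_vector_derivative f i (E (- s) w)) (at (- s) within uminus ` {0..-t})"
            by (rule has_vector_derivative_within_subset[OF ED[OF s' w] sub])
        qed (auto intro!: derivative_eq_intros)
        then show "((\<lambda>s. E (- s) w) has_vector_derivative control_matrix f (E (- s) w) *v axis i (-1)) (at s within {0..-t})"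
          by (simp add: control_matrix_axis o_def)
        show "L (E (- s) w) (axis i (-1)) \<le> c" using B1 B2 EB[OF s' w] by (fastforce simp: c_def)
        show "norm (control_matrix f (E (- s) w) *v axis i (-1)) \<le> M"
          using M[OF EB[OF s' w]] by (simp add: control_matrix_axis)
      qed (use B1 B2 in \<open>auto simp: c_def\<close>)
      then show ?thesis using False by (simp add: E0)
    qed
    moreover have "\<bar>t\<bar> \<le> c * \<bar>t\<bar>" using B1 B2 by (simp add: c_def mult_le_cancel_right1)
    ultimately show "reach (c * \<bar>t\<bar>) w (E t w)" unfolding reach_def by blast
  qed
qed

sublocale local_control reach "range f"
proof
  show "reach 0 x x" for x unfolding reach_def using conn_refl by blast
  show "reach (e + e') x w" if "reach e x y" "reach e' y w" for e x y e' w
    using that conn_trans unfolding reach_def by (metis add_mono)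
  show "reach e' x y" if "reach e x y" "e \<le> e'" for e x y e'
    using that unfolding reach_def by (meson order_trans)
  show "smooth X" if "X \<in> range f" for X using that smooth_f by auto
  show "\<exists>c>0. \<forall>t\<in>{-h..h}. \<forall>w\<in>cball z r. reach (c * \<bar>t\<bar>) w (E t w)"
    if "X \<in> range f" "local_flow_of X z r h E" for X z r h E
    using that reach_flow by blast
qed

end

section \<open>Integration along absolutely continuous curves\<close>

lemma ac_modulus_finite:
  assumes m: "ac_modulus a b g e d" and P: "finite P"
    and st: "\<And>i. i \<in> P \<Longrightarrow> a \<le> s i \<and> s i \<le> t i \<and> t i \<le> b"
    and disj: "disjoint_family_on (\<lambda>i. {s i<..<t i}) P" and len: "(\<Sum>i\<in>P. t i - s i) < d"
  shows "(\<Sum>i\<in>P. norm (g (t i) - g (s i))) < e"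
proof -
  obtain h where h: "bij_betw h {0..<card P} P" using ex_bij_betw_nat_finite[OF P] by blast
  then have h': "bij_betw h {..<card P} P" by (simp add: lessThan_atLeast0)
  have hP: "h i \<in> P" if "i < card P" for i using h' that by (auto simp: bij_betw_def)
  have inj: "inj_on h {..<card P}" using h' by (simp add: bij_betw_def)
  have "(\<Sum>i<card P. norm (g (t (h i)) - g (s (h i)))) < e"
  proof (rule ac_modulusD[OF m])
    show "disjoint_family_on (\<lambda>i. {s (h i)<..<t (h i)}) {..<card P}"
      unfolding disjoint_family_on_def
    proof (intro ballI impI)
      fix i j assume ij: "i \<in> {..<card P}" "j \<in> {..<card P}" "i \<noteq> j"
      then have "h i \<noteq> h j" using inj by (auto dest: inj_onD)
      then show "{s (h i)<..<t (h i)} \<inter> {s (h j)<..<t (h j)} = {}"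
        using disj hP ij unfolding disjoint_family_on_def by blast
    qed
    show "(\<Sum>i<card P. t (h i) - s (h i)) < d"
      using len sum.reindex_bij_betw[OF h', of "\<lambda>i. t i - s i"] by simp
  qed (use st hP in blast)+
  then show ?thesis using sum.reindex_bij_betw[OF h', of "\<lambda>i. norm (g (t i) - g (s i))"] by simp
qed

text \<open>Riemann sums for a gauge are estimated directly. Pieces tagged at a point of
  differentiability obey the straddle inequality. The other tags lie in a null set covered by a thin
  open set, and over their pieces absolute continuity makes the increments of g small.\<close>

theorem fundamental_theorem_of_calculus_absolutely_continuous:
  fixes g :: "real \<Rightarrow> 'a::banach"
  assumes ac: "absolutely_continuous_on_Icc a b g" and ab: "a \<le> b"
    and D: "AE s in lebesgue. s \<in> {a..b} \<longrightarrow> (g has_vector_derivative g' s) (at s within {a..b})"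
  shows "(g' has_integral (g b - g a)) {a..b}"
proof (cases "a = b")
  case True
  then show ?thesis using has_integral_null_real[of a b g'] by simp
next
  case False
  then have "a < b" using ab by simp
  define N where "N = {s\<in>{a..b}. \<not> (g has_vector_derivative g' s) (at s within {a..b})}"
  obtain N' where N': "{s \<in> space lebesgue. \<not> (s \<in> {a..b} \<longrightarrow> (g has_vector_derivative g' s) (at s within {a..b}))} \<subseteq> N'"
      "emeasure lebesgue N' = 0" "N' \<in> sets lebesgue"
    by (rule AE_E[OF D])
  have "N \<subseteq> N'" using N'(1) by (auto simp: N_def)
  moreover have "negligible N'" using N'(2,3) by (simp add: negligible_iff_null_sets null_setsI)
  ultimately have N: "negligible N" by (rule negligible_subset[rotated])
  then have Nnull: "N \<in> null_sets lebesgue" by (simp add: negligible_iff_null_sets)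
  \<comment> \<open>With the value 0 on N, pieces tagged in N contribute nothing to the Riemann sum;
    only the increments of g over them remain.\<close>
  define h where "h s = (if s \<in> N then 0 else g' s)" for s
  have "(h has_integral (g b - g a)) {a..b}"
    unfolding has_integral_factor_content_real
  proof (intro allI impI)
    fix e :: real assume e: "e > 0"
    define \<eta> where "\<eta> = e / 2"
    have \<eta>: "\<eta> > 0" using e by (simp add: \<eta>_def)
    have "\<eta> * (b - a) > 0" using \<eta> \<open>a < b\<close> by simp
    then obtain \<delta> where \<delta>0: "\<delta> > 0" and \<delta>: "ac_modulus a b g (\<eta> * (b - a)) \<delta>"
      using ac unfolding absolutely_continuous_iff by blast
    obtain U where U: "open U" "N \<subseteq> U" "U - N \<in> lmeasurable" "emeasure lebesgue (U - N) < ennreal \<delta>"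
      using sets_lebesgue_outer_open[of N \<delta>] Nnull \<delta>0 by auto
    have UN: "U = (U - N) \<union> N" using U by auto
    have U': "U \<in> lmeasurable" by (subst UN) (rule fmeasurable.Un[OF U(3) negligible_imp_measurable[OF N]])
    have "emeasure lebesgue U = emeasure lebesgue (U - N)"
      by (subst UN) (rule emeasure_Un_null_set[OF fmeasurableD[OF U(3)] Nnull])
    then have "ennreal (measure lebesgue U) < ennreal \<delta>"
      using U(4) unfolding emeasure_eq_measure2[OF U', symmetric] by (simp only:)
    then have mU: "measure lebesgue U < \<delta>" by (simp add: ennreal_less_iff)
    \<comment> \<open>The gauge has two tasks: linear approximation of g at good tags, and
      confinement of the pieces to U at tags in N.\<close>
    have "\<exists>d>0. (x \<in> {a..b} - N \<longrightarrow> (\<forall>y\<in>{a..b}. norm (y - x) < d \<longrightarrow> norm (g y - g x - (y - x) *\<^sub>R g' x) \<le> \<eta> * norm (y - x))) \<and>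
      (x \<in> N \<longrightarrow> ball x d \<subseteq> U)" for x
    proof (cases "x \<in> N")
      case True
      then obtain d where "d > 0" "ball x d \<subseteq> U" using U(1,2) open_contains_ball by (metis subsetD)
      then show ?thesis using True by blast
    next
      case False
      show ?thesis
      proof (cases "x \<in> {a..b}")
        case True
        then have "(g has_vector_derivative g' x) (at x within {a..b})" using False by (simp add: N_def)
        then show ?thesis
          using False \<eta> unfolding has_vector_derivative_def has_derivative_within_alt by blast
      next
        case xab: False
        show ?thesis using False xab by (intro exI[of _ 1]) auto
      qed
    qed
    then obtain d where d0: "\<And>x. d x > 0"
      and d: "\<And>x y. x \<in> {a..b} - N \<Longrightarrow> y \<in> {a..b} \<Longrightarrow> norm (y - x) < d x \<Longrightarrow> norm (g y - g x - (y - x) *\<^sub>R g' x) \<le> \<eta> * norm (y - x)"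
      and dU: "\<And>x. x \<in> N \<Longrightarrow> ball x (d x) \<subseteq> U"
      by metis
    show "\<exists>d. gauge d \<and> (\<forall>p. p tagged_division_of {a..b} \<and> d fine p \<longrightarrow>
        norm ((\<Sum>(x, k)\<in>p. measure lborel k *\<^sub>R h x) - (g b - g a)) \<le> e * measure lborel {a..b})"
    proof (intro exI[of _ "\<lambda>x. ball x (d x)"] conjI allI impI)
      show "gauge (\<lambda>x. ball x (d x))" using d0 gauge_ball_dependent by blast
      fix p assume p: "p tagged_division_of {a..b} \<and> (\<lambda>x. ball x (d x)) fine p"
      then have pt: "p tagged_division_of {a..b}" and pf: "(\<lambda>x. ball x (d x)) fine p" by auto
      have fin: "finite p" using pt by (rule tagged_division_of_finite)
      have K: "\<exists>u v. K = {u..v} \<and> u \<le> v \<and> x \<in> K \<and> K \<subseteq> {a..b} \<and> Inf K = u \<and> Sup K = v \<and> K \<subseteq> ball x (d x)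
          \<and> interior K = {u<..<v}"
        if xK: "(x, K) \<in> p" for x K
      proof -
        have 1: "x \<in> K" "K \<subseteq> {a..b}" using tagged_division_ofD[OF pt] xK by auto
        obtain u v where K: "K = cbox u v" using tagged_division_ofD(4)[OF pt xK] by auto
        have "u \<le> v" using 1 K by auto
        moreover have "K \<subseteq> ball x (d x)" using pf xK unfolding fine_def by blast
        ultimately show ?thesis using 1 K by (intro exI[of _ u] exI[of _ v]) (auto simp: interior_atLeastAtMost_real)
      qed
      define l r where "l = (\<lambda>i::real \<times> real set. Inf (snd i))" and "r = (\<lambda>i::real \<times> real set. Sup (snd i))"
      have lr: "snd i = {l i..r i}" "l i \<le> r i" "fst i \<in> snd i" "a \<le> l i" "r i \<le> b" "{l i..r i} \<subseteq> ball (fst i) (d (fst i))"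
          "interior (snd i) = {l i<..<r i}"
        if "i \<in> p" for i
        using K[of "fst i" "snd i"] that unfolding l_def r_def by (auto simp: subset_iff)
      have ba: "b - a = (\<Sum>i\<in>p. r i - l i)" "g b - g a = (\<Sum>i\<in>p. g (r i) - g (l i))"
        using additive_tagged_division_1[OF ab pt, of "\<lambda>x. x"] additive_tagged_division_1[OF ab pt, of g]
        by (simp_all add: l_def r_def split_def)
      define q where "q = {i\<in>p. fst i \<in> N}"
      have q: "finite q" "q \<subseteq> p" using fin by (auto simp: q_def)
      have disj: "disjoint_family_on (\<lambda>i. {l i<..<r i}) q"
        unfolding disjoint_family_on_def
      proof (intro ballI impI)
        fix i j assume "i \<in> q" "j \<in> q" "i \<noteq> j"
        then have ij: "i \<in> p" "j \<in> p" "i \<noteq> j" using q by auto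
        have "interior (snd i) \<inter> interior (snd j) = {}"
          using tagged_division_ofD(5)[OF pt, of "fst i" "snd i" "fst j" "snd j"] ij by (metis prod.collapse)
        then show "{l i<..<r i} \<inter> {l j<..<r j} = {}" using lr(7) ij by simp
      qed
      have "(\<Sum>i\<in>q. r i - l i) = (\<Sum>i\<in>q. measure lebesgue {l i<..<r i})"
        using lr(2) q by (intro sum.cong) auto
      also have "\<dots> = measure lebesgue (\<Union>i\<in>q. {l i<..<r i})"
        using q lr(2) by (intro measure_finite_Union[symmetric] disj) auto
      also have "\<dots> \<le> measure lebesgue U"
      proof (rule measure_mono_fmeasurable[OF _ _ U'])
        show "(\<Union>i\<in>q. {l i<..<r i}) \<subseteq> U"
        proof (rule UN_least)
          fix i assume "i \<in> q"
          then have i: "i \<in> p" "fst i \<in> N" by (auto simp: q_def)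
          have "{l i<..<r i} \<subseteq> {l i..r i}" by auto
          also note lr(6)[OF i(1)]
          also note dU[OF i(2)]
          finally show "{l i<..<r i} \<subseteq> U" .
        qed
        show "(\<Union>i\<in>q. {l i<..<r i}) \<in> sets lebesgue" using q by (intro sets.finite_UN) auto
      qed
      finally have "(\<Sum>i\<in>q. r i - l i) < \<delta>" using mU by simp
      then have A: "(\<Sum>i\<in>q. norm (g (r i) - g (l i))) < \<eta> * (b - a)"
      proof (intro ac_modulus_finite[OF \<delta> q(1) _ disj])
        fix i assume "i \<in> q"
        then have "i \<in> p" using q by blast
        then show "a \<le> l i \<and> l i \<le> r i \<and> r i \<le> b" using lr(2,4,5) by blast
      qed
      have B: "norm ((r i - l i) *\<^sub>R h (fst i) - (g (r i) - g (l i))) \<le> \<eta> * (r i - l i)" if "i \<in> p - q" for i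
      proof -
        have i: "i \<in> p" "fst i \<notin> N" using that by (auto simp: q_def)
        let ?x = "fst i"
        have x: "?x \<in> {a..b} - N" "l i \<le> ?x" "?x \<le> r i" using lr[OF i(1)] i by auto
        have u: "l i \<in> {a..b}" "norm (l i - ?x) < d ?x" and v: "r i \<in> {a..b}" "norm (r i - ?x) < d ?x"
          using lr(2,4,5,6)[OF i(1)] by (auto simp: subset_iff dist_real_def norm_minus_commute)
        \<comment> \<open>Both end points are compared with the tag between them, and their
          distances to it add up to the length of the piece.\<close>
        have "(r i - l i) *\<^sub>R h ?x - (g (r i) - g (l i)) =
            (g (l i) - g ?x - (l i - ?x) *\<^sub>R g' ?x) - (g (r i) - g ?x - (r i - ?x) *\<^sub>R g' ?x)"
          using i by (simp add: h_def algebra_simps)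
        also have "norm \<dots> \<le> \<eta> * norm (l i - ?x) + \<eta> * norm (r i - ?x)"
          by (rule order_trans[OF norm_triangle_ineq4 add_mono[OF d[OF x(1) u] d[OF x(1) v]]])
        also have "\<dots> = \<eta> * (r i - l i)" using x by (simp add: algebra_simps)
        finally show ?thesis .
      qed
      have h0: "h (fst i) = 0" if "i \<in> q" for i using that by (simp add: h_def q_def)
      have "(\<Sum>(x, k)\<in>p. measure lborel k *\<^sub>R h x) = (\<Sum>i\<in>p. (r i - l i) *\<^sub>R h (fst i))"
        using lr(1,2) by (intro sum.cong) (auto simp: split_def)
      then have "norm ((\<Sum>(x, k)\<in>p. measure lborel k *\<^sub>R h x) - (g b - g a)) =
          norm (\<Sum>i\<in>p. (r i - l i) *\<^sub>R h (fst i) - (g (r i) - g (l i)))"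
        unfolding ba(2) by (simp add: sum_subtractf)
      also have "\<dots> \<le> (\<Sum>i\<in>p. norm ((r i - l i) *\<^sub>R h (fst i) - (g (r i) - g (l i))))" by (rule norm_sum)
      also have "\<dots> = (\<Sum>i\<in>p - q. norm ((r i - l i) *\<^sub>R h (fst i) - (g (r i) - g (l i)))) +
          (\<Sum>i\<in>q. norm ((r i - l i) *\<^sub>R h (fst i) - (g (r i) - g (l i))))"
        by (rule sum.subset_diff[OF q(2) fin])
      also have "\<dots> \<le> (\<Sum>i\<in>p - q. \<eta> * (r i - l i)) + (\<Sum>i\<in>q. norm (g (r i) - g (l i)))"
        using B by (intro add_mono sum_mono) (auto simp: h0 norm_minus_commute)
      also have "(\<Sum>i\<in>p - q. \<eta> * (r i - l i)) \<le> (\<Sum>i\<in>p. \<eta> * (r i - l i))"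
        using lr(2) \<eta> by (intro sum_mono2 fin) auto
      also have "(\<Sum>i\<in>p. \<eta> * (r i - l i)) = \<eta> * (b - a)" unfolding ba(1) by (simp add: sum_distrib_left)
      finally show "norm ((\<Sum>(x, k)\<in>p. measure lborel k *\<^sub>R h x) - (g b - g a)) \<le> e * measure lborel {a..b}"
        using A \<open>a < b\<close> by (simp add: \<eta>_def field_simps)
    qed
  qed
  then show ?thesis
    by (rule has_integral_spike[OF N, rotated]) (simp add: h_def)
qed

text \<open>The image of the trajectory is compact, so \<phi> is Lipschitz on a ball around it and
  \<phi> along \<gamma> is absolutely continuous. It serves for test functions and, in
  \<open>trajectory_stays_near\<close>, for a linear functional.\<close>

lemma has_integral_along_trajectory:
  fixes \<phi> :: "real^'d \<Rightarrow> real"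
  assumes adm: "(\<gamma>, u) \<in> admissible f a b" and ab: "a \<le> b" and \<phi>: "C_k 1 \<phi>"
  shows "((\<lambda>s. frechet_derivative \<phi> (at (\<gamma> s)) (control_matrix f (\<gamma> s) *v u s)) has_integral (\<phi> (\<gamma> b) - \<phi> (\<gamma> a))) {a..b}"
proof (rule fundamental_theorem_of_calculus_absolutely_continuous[OF _ ab])
  have ac: "absolutely_continuous_on_Icc a b \<gamma>" using adm by (simp add: admissible_iff)
  have bd: "bounded (\<gamma> ` {a..b})"
    by (intro compact_imp_bounded compact_continuous_image absolutely_continuous_imp_continuous[OF ac]) auto
  obtain R where "\<forall>x\<in>\<gamma> ` {a..b}. norm x \<le> R" using bd unfolding bounded_iff by (rule exE)
  then have R: "\<gamma> ` {a..b} \<subseteq> cball 0 R" by auto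
  obtain M where M: "M > 0" "\<And>x y. x \<in> cball 0 R \<Longrightarrow> y \<in> cball 0 R \<Longrightarrow> norm (\<phi> y - \<phi> x) \<le> M * norm (y - x)"
    by (rule C_k_cball_bound[OF \<phi>, of 0 R], rule that)
  show "absolutely_continuous_on_Icc a b (\<lambda>s. \<phi> (\<gamma> s))"
    by (rule absolutely_continuous_compose[OF ac M(1)], rule M(2)) (use R in blast)+
  have D: "(\<phi> has_derivative frechet_derivative \<phi> (at x)) (at x)" for x
    using C_k_has_derivative[of 0 \<phi>] \<phi> by simp
  have "AE s in lebesgue. s \<in> {a..b} \<longrightarrow>
      (\<gamma> has_vector_derivative (control_matrix f (\<gamma> s) *v u s)) (at s within {a..b})"
    using adm by (simp add: admissible_iff)
  then show "AE s in lebesgue. s \<in> {a..b} \<longrightarrow> ((\<lambda>s. \<phi> (\<gamma> s)) has_vector_derivative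
      frechet_derivative \<phi> (at (\<gamma> s)) (control_matrix f (\<gamma> s) *v u s)) (at s within {a..b})"
  proof eventually_elim
    case (elim s)
    show ?case
    proof
      assume s: "s \<in> {a..b}"
      have "((\<lambda>s. \<phi> (\<gamma> s)) has_derivative
          (\<lambda>h. frechet_derivative \<phi> (at (\<gamma> s)) (h *\<^sub>R (control_matrix f (\<gamma> s) *v u s)))) (at s within {a..b})"
        by (rule has_derivative_compose[OF _ D]) (use elim s in \<open>simp add: has_vector_derivative_def\<close>)
      then show "((\<lambda>s. \<phi> (\<gamma> s)) has_vector_derivative
          frechet_derivative \<phi> (at (\<gamma> s)) (control_matrix f (\<gamma> s) *v u s)) (at s within {a..b})"
        by (simp add: has_vector_derivative_def linear_scale[OF has_derivative_linear[OF D]])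
    qed
  qed
qed

text \<open>The bridge between the gauge integral, in which the fundamental theorem is stated, and
  the costs in \<open>ennreal\<close>. Only g is turned into an integrable function on the line; h
  is just compared with it.\<close>

lemma has_integral_le_nn_cost:
  assumes h: "(h has_integral I) {a..b}"
    and le: "\<And>s. s \<in> {a..b} \<Longrightarrow> h s \<le> g s" and g0: "\<And>s. 0 \<le> g s"
    and m: "(\<lambda>s. ennreal (g s) * indicator {a..b} s) \<in> borel_measurable lebesgue"
    and c: "nn_cost (\<lambda>s. ennreal (g s)) a b \<le> ennreal \<kappa>" and \<kappa>: "0 \<le> \<kappa>"
  shows "I \<le> \<kappa>"
proof -
  define G where "G s = g s * indicator {a..b} s" for s
  have eG: "ennreal (G s) = ennreal (g s) * indicator {a..b} s" for s
    by (auto simp: G_def indicator_def)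
  have G0: "0 \<le> G s" for s using g0 by (simp add: G_def)
  have "(\<lambda>s. enn2real (ennreal (G s))) \<in> borel_measurable lebesgue"
    unfolding eG using m by (rule measurable_compose) simp
  then have mG: "G \<in> borel_measurable lebesgue" using G0 by simp
  have nG: "(\<integral>\<^sup>+s. ennreal (G s) \<partial>lebesgue) \<le> ennreal \<kappa>" using c by (simp add: nn_cost_def eG)
  then obtain k where k: "(\<integral>\<^sup>+s. ennreal (G s) \<partial>lebesgue) = ennreal k" "0 \<le> k"
    by (cases "\<integral>\<^sup>+s. ennreal (G s) \<partial>lebesgue") (auto simp: top_unique)
  have 1: "(G has_integral k) UNIV"
    using has_integral_iff_nn_integral_lebesgue[of G k] mG G0 k by simp
  have 2: "((\<lambda>s. if s \<in> {a..b} then h s else 0) has_integral I) UNIV"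
    using h by (simp only: has_integral_restrict_UNIV)
  have "I \<le> k"
    by (rule has_integral_le[OF 2 1]) (use le in \<open>auto simp: G_def\<close>)
  moreover have "k \<le> \<kappa>" using nG k \<kappa> by simp
  ultimately show ?thesis by simp
qed

section \<open>Long-time limit of the Lax-Oleinik semigroup\<close>

lemma ext_integral_nonneg:
  assumes "\<And>s. 0 \<le> g s"
  shows "ext_integral (lebesgue_on {a..b}) g = enn2ereal (nn_cost (\<lambda>s. ennreal (g s)) a b)"
proof -
  have "ennreal (- g s) = 0" for s using assms[of s] by (simp add: ennreal_neg)
  then show ?thesis
    by (simp add: ext_integral_def nn_cost_def nn_integral_restrict_space zero_ennreal.rep_eq)
qed

text \<open>What the argument extracts from the standing assumptions: \<open>quadratic\<close>
  follows from strong convexity, the minimum at u = 0 and L(x,0) \<ge> 0, and it in turn yields L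
  \<ge> 0. The set K and the gap k0 come from (L3').\<close>

locale coercive_control_problem = control_problem f L
  for f :: "'m::finite \<Rightarrow> real^'d \<Rightarrow> real^'d" and L :: "real^'d \<Rightarrow> real^'m \<Rightarrow> real" +
  fixes l k0 :: real and K :: "(real^'d) set"
  assumes chow: "chow_condition f"
    and l: "l > 0" and quadratic: "(norm u)\<^sup>2 \<le> 2 * l * L x u"
    and L_ge: "L x 0 \<le> L x u"
    and rest_exists: "\<exists>a. L a 0 = 0"
    and K: "compact K" and k0: "k0 > 0" and L_outside: "x \<notin> K \<Longrightarrow> k0 \<le> L x 0"
begin

lemma L_nonneg: "0 \<le> L x u"
proof -
  have "0 \<le> 2 * l * L x u" using quadratic[of u x] by (meson order_trans zero_le_power2)
  then show ?thesis using l by (simp add: zero_le_mult_iff)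
qed

lemma L_rest_continuous: "continuous_on S (\<lambda>x. L x v)"
proof -
  have "continuous_on S (\<lambda>x. (\<lambda>(x, u). L x u) (x, v))"
    by (rule continuous_on_compose2[OF L_cont]) (auto intro!: continuous_intros)
  then show ?thesis by simp
qed

lemma conn_local:
  assumes "e > 0"
  obtains \<delta> where "\<delta> > 0"
    "\<And>x y. x \<in> ball z \<delta> \<Longrightarrow> y \<in> ball z \<delta> \<Longrightarrow> \<exists>t \<kappa>. conn t x y \<kappa> \<and> t \<le> e \<and> \<kappa> \<le> e"
proof -
  have "span {X z | X. X \<in> lie_algebra_generated (range f)} = UNIV"
    using chow by (simp add: chow_condition_def)
  then obtain \<delta> where "\<delta> > 0" "\<And>x y. x \<in> ball z \<delta> \<Longrightarrow> y \<in> ball z \<delta> \<Longrightarrow> reach e x y"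
    using local_controllability[OF _ assms, of z] by blast
  then show ?thesis using that[of \<delta>] unfolding reach_def by blast
qed

lemma conn_exists: "\<exists>t \<kappa>. conn t x y \<kappa>"
proof -
  \<comment> \<open>Reversing a trajectory changes its cost, so the relation is symmetrised. Its
    classes are open by local controllability, and the whole space is connected.\<close>
  define Q where "Q x y \<longleftrightarrow> (\<exists>t \<kappa>. conn t x y \<kappa>) \<and> (\<exists>t \<kappa>. conn t y x \<kappa>)" for x y
  have "Q x y"
  proof (rule connected_equivalence_relation[where S = UNIV and R = Q])
    show "Q x z" if "Q x y" "Q y z" for x y z
      using that conn_trans unfolding Q_def by blast
    show "\<exists>T. openin (top_of_set UNIV) T \<and> a \<in> T \<and> (\<forall>x\<in>T. Q a x)" for a
    proof -
      obtain \<delta> where d: "\<delta> > 0"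
        "\<And>x y. x \<in> ball a \<delta> \<Longrightarrow> y \<in> ball a \<delta> \<Longrightarrow> \<exists>t \<kappa>. conn t x y \<kappa> \<and> t \<le> 1 \<and> \<kappa> \<le> 1"
        using conn_local[of 1 a] by auto
      then have "Q a x" if "x \<in> ball a \<delta>" for x
        using d(2)[of a x] d(2)[of x a] that centre_in_ball[of a \<delta>] unfolding Q_def by blast
      then show ?thesis using d(1) by (intro exI[of _ "ball a \<delta>"]) auto
    qed
  qed (auto simp: Q_def)
  then show ?thesis by (simp add: Q_def)
qed

section \<open>The cost of arriving from the rest set\<close>

definition rest :: "(real^'d) set" where "rest = {a. L a 0 = 0}"

definition D :: "real^'d \<Rightarrow> real" where
  "D x = Inf {\<kappa>. \<exists>a\<in>rest. \<exists>t. conn t a x \<kappa>}"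

lemma conn_nonneg: "conn t x y \<kappa> \<Longrightarrow> 0 \<le> \<kappa> \<and> 0 \<le> t"
  by (simp add: conn_def)

lemma D_costs: "{\<kappa>. \<exists>a\<in>rest. \<exists>t. conn t a x \<kappa>} \<noteq> {}" "bdd_below {\<kappa>. \<exists>a\<in>rest. \<exists>t. conn t a x \<kappa>}"
proof -
  obtain a where "a \<in> rest" using rest_exists by (auto simp: rest_def)
  then show "{\<kappa>. \<exists>a\<in>rest. \<exists>t. conn t a x \<kappa>} \<noteq> {}" using conn_exists[of a x] by blast
  show "bdd_below {\<kappa>. \<exists>a\<in>rest. \<exists>t. conn t a x \<kappa>}"
    by (rule bdd_belowI[of _ 0]) (use conn_nonneg in blast)
qed

lemma D_le: "a \<in> rest \<Longrightarrow> conn t a x \<kappa> \<Longrightarrow> D x \<le> \<kappa>"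
  unfolding D_def by (rule cInf_lower[OF _ D_costs(2)]) blast

lemma D_nonneg: "0 \<le> D x"
  unfolding D_def by (rule cInf_greatest[OF D_costs(1)]) (use conn_nonneg in blast)

lemma D_approx:
  assumes "e > 0"
  obtains a t \<kappa> where "a \<in> rest" "conn t a x \<kappa>" "\<kappa> < D x + e"
proof -
  have "Inf {\<kappa>. \<exists>a\<in>rest. \<exists>t. conn t a x \<kappa>} < D x + e" using assms by (simp add: D_def)
  then obtain \<kappa> where "\<kappa> \<in> {\<kappa>. \<exists>a\<in>rest. \<exists>t. conn t a x \<kappa>}" "\<kappa> < D x + e"
    using cInf_lessD[OF D_costs(1)] by blast
  then show ?thesis using that by blast
qed

lemma D_triangle:
  assumes "conn t x y \<kappa>"
  shows "D y \<le> D x + \<kappa>"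
proof (rule field_le_epsilon)
  fix e :: real assume "e > 0"
  then obtain a s \<kappa>' where a: "a \<in> rest" "conn s a x \<kappa>'" "\<kappa>' < D x + e" by (rule D_approx)
  have "D y \<le> \<kappa>' + \<kappa>" by (rule D_le[OF a(1) conn_trans[OF a(2) assms]])
  then show "D y \<le> D x + \<kappa> + e" using a(3) by simp
qed

lemma D_local:
  assumes "e > 0"
  obtains \<delta> where "\<delta> > 0"
    "\<And>x. x \<in> ball z \<delta> \<Longrightarrow> \<bar>D x - D z\<bar> \<le> e \<and> (\<exists>t \<kappa>. conn t z x \<kappa> \<and> t \<le> e \<and> \<kappa> \<le> e)"
proof -
  obtain \<delta> where d: "\<delta> > 0"
    "\<And>x y. x \<in> ball z \<delta> \<Longrightarrow> y \<in> ball z \<delta> \<Longrightarrow> \<exists>t \<kappa>. conn t x y \<kappa> \<and> t \<le> e \<and> \<kappa> \<le> e"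
    using conn_local[OF assms, of z] by auto
  show ?thesis
  proof (rule that[OF d(1)])
    fix x assume x: "x \<in> ball z \<delta>"
    have z: "z \<in> ball z \<delta>" using d(1) by simp
    obtain t \<kappa> where 1: "conn t z x \<kappa>" "t \<le> e" "\<kappa> \<le> e" using d(2)[OF z x] by blast
    obtain t' \<kappa>' where 2: "conn t' x z \<kappa>'" "t' \<le> e" "\<kappa>' \<le> e" using d(2)[OF x z] by blast
    have "\<bar>D x - D z\<bar> \<le> e" using D_triangle[OF 1(1)] D_triangle[OF 2(1)] 1(3) 2(3) by linarith
    then show "\<bar>D x - D z\<bar> \<le> e \<and> (\<exists>t \<kappa>. conn t z x \<kappa> \<and> t \<le> e \<and> \<kappa> \<le> e)" using 1 by blast
  qed
qed

lemma D_continuous: "continuous_on S D"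
proof -
  have "isCont D z" for z
    unfolding continuous_at_eps_delta
  proof (intro allI impI)
    fix e :: real assume "e > 0"
    then have "e / 2 > 0" by simp
    then obtain \<delta> where "\<delta> > 0" "\<And>x. x \<in> ball z \<delta> \<Longrightarrow> \<bar>D x - D z\<bar> \<le> e / 2"
      by (rule D_local) blast
    then show "\<exists>d>0. \<forall>x. dist x z < d \<longrightarrow> dist (D x) (D z) < e"
      using \<open>e > 0\<close> by (intro exI[of _ \<delta>]) (force simp: dist_real_def dist_commute)
  qed
  then show ?thesis by (simp add: continuous_at_imp_continuous_on)
qed

text \<open>Outside the open set where D < e no point is at rest, so the running cost has a positive
  minimum on the compact remainder of K; outside K it is at least k0.\<close>

lemma rest_near:
  assumes "e > 0"
  obtains k where "k > 0" "\<And>p. L p 0 < k \<Longrightarrow> D p \<le> e"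
proof -
  have D0: "D a = 0" if "a \<in> rest" for a
    using D_le[OF that conn_wait[of a 0]] that D_nonneg[of a] by (simp add: rest_def)
  define U where "U = {p. D p < e}"
  have "open U" unfolding U_def by (intro open_Collect_less D_continuous continuous_on_const)
  then have c: "compact (K - U)" using K by (rule compact_diff[rotated])
  have pos: "0 < L p 0" if "p \<notin> U" for p
  proof -
    have "p \<notin> rest" using that D0 assms by (auto simp: U_def)
    then show ?thesis using L_nonneg[of p 0] by (simp add: rest_def less_le)
  qed
  show ?thesis
  proof (cases "K - U = {}")
    case True
    show ?thesis
    proof (rule that[OF k0])
      fix p assume "L p 0 < k0"
      then have "p \<in> K" using L_outside by (meson not_less)
      then show "D p \<le> e" using True by (auto simp: U_def)
    qed
  next
    case False
    obtain p0 where p0: "p0 \<in> K - U" "\<And>p. p \<in> K - U \<Longrightarrow> L p0 0 \<le> L p 0"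
      using continuous_attains_inf[OF c False L_rest_continuous[of _ 0]] by blast
    show ?thesis
    proof (rule that[of "min k0 (L p0 0)"])
      show "min k0 (L p0 0) > 0" using k0 pos[of p0] p0 by auto
      fix p assume p: "L p 0 < min k0 (L p0 0)"
      then have "p \<in> K" using L_outside[of p] by fastforce
      then have "p \<in> U" using p0(2)[of p] p by fastforce
      then show "D p \<le> e" by (simp add: U_def)
    qed
  qed
qed

lemma conn_passes_near_rest:
  assumes "conn t y x \<kappa>" and less: "\<kappa> < k * t"
  obtains p s \<kappa>' where "conn s p x \<kappa>'" "\<kappa>' \<le> \<kappa>" "L p 0 < k"
proof -
  obtain \<gamma> u where g: "0 \<le> \<kappa>" "0 \<le> t" "(\<gamma>, u) \<in> admissible f 0 t" "\<gamma> 0 = y" "\<gamma> t = x" "cost \<gamma> u 0 t \<le> ennreal \<kappa>"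
    using assms(1) unfolding conn_def by blast
  have "\<exists>s\<in>{0..t}. L (\<gamma> s) 0 < k"
  proof (rule ccontr)
    assume "\<not> ?thesis"
    then have k: "k \<le> L (\<gamma> s) 0" if "s \<in> {0..t}" for s using that by (meson not_less)
    \<comment> \<open>The sign of k matters because \<open>ennreal\<close> sends negative numbers to
      0.\<close>
    have kt: "0 < k * t" using g(1) less by simp
    then have "0 \<le> k" using g(2) by (simp add: zero_less_mult_iff)
    have "ennreal (k * t) = nn_cost (\<lambda>s. ennreal k) 0 t"
      using \<open>0 \<le> k\<close> g(2) by (simp add: nn_cost_const ennreal_mult)
    also have "\<dots> \<le> cost \<gamma> u 0 t"
      by (intro nn_cost_mono ennreal_leI) (use k L_ge in \<open>blast intro: order_trans\<close>)
    also note g(6)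
    finally have "k * t \<le> \<kappa>" using ennreal_le_iff[OF g(1)] by blast
    then show False using less by simp
  qed
  then obtain s where s: "0 \<le> s" "s \<le> t" "L (\<gamma> s) 0 < k" by auto
  obtain \<kappa>1 \<kappa>2 where "conn s (\<gamma> 0) (\<gamma> s) \<kappa>1" "conn (t - s) (\<gamma> s) (\<gamma> t) \<kappa>2" "\<kappa>1 + \<kappa>2 \<le> \<kappa>"
    using admissible_conn[OF g(3,6) s(1,2) g(1)] by blast
  moreover from this have "\<kappa>2 \<le> \<kappa>" using conn_nonneg by force
  ultimately show ?thesis using that s(3) g(5) by metis
qed

section \<open>The Lax-Oleinik operator in terms of connections\<close>

lemma lax_oleinik_le:
  assumes "conn t y x \<kappa>" "t > 0"
  shows "lax_oleinik f L t \<phi> x \<le> ereal (\<phi> y + \<kappa>)"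
proof -
  obtain \<gamma> u where g: "0 \<le> \<kappa>" "0 \<le> t" "(\<gamma>, u) \<in> admissible f 0 t" "\<gamma> 0 = y" "\<gamma> t = x" "cost \<gamma> u 0 t \<le> ennreal \<kappa>"
    using assms(1) unfolding conn_def by blast
  have "lax_oleinik f L t \<phi> x \<le> ereal (\<phi> (\<gamma> 0)) + ext_integral (lebesgue_on {0..t}) (\<lambda>s. L (\<gamma> s) (u s))"
    unfolding lax_oleinik_def using assms(2) g(3,5)
    by (auto simp: admissible_to_def intro!: INF_lower2[of "(\<gamma>, u)"])
  also have "\<dots> \<le> ereal (\<phi> (\<gamma> 0)) + ereal \<kappa>"
  proof (rule add_left_mono)
    have "enn2ereal (cost \<gamma> u 0 t) \<le> enn2ereal (ennreal \<kappa>)" using g(6) by (simp add: less_eq_ennreal.rep_eq)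
    then show "ext_integral (lebesgue_on {0..t}) (\<lambda>s. L (\<gamma> s) (u s)) \<le> ereal \<kappa>"
      using g(1) by (simp add: ext_integral_nonneg[OF L_nonneg])
  qed
  finally show ?thesis using g(4) by simp
qed

lemma lax_oleinik_less:
  assumes "lax_oleinik f L t \<phi> x < ereal r" "t > 0"
  obtains y \<kappa> where "conn t y x \<kappa>" "\<phi> y + \<kappa> < r"
proof -
  obtain \<gamma> u where g: "(\<gamma>, u) \<in> admissible_to f 0 t x"
      "ereal (\<phi> (\<gamma> 0)) + ext_integral (lebesgue_on {0..t}) (\<lambda>s. L (\<gamma> s) (u s)) < ereal r"
    using assms unfolding lax_oleinik_def by (auto simp: INF_less_iff)
  have adm: "(\<gamma>, u) \<in> admissible f 0 t" "\<gamma> t = x" using g(1) by (auto simp: admissible_to_def)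
  have less: "ereal (\<phi> (\<gamma> 0)) + enn2ereal (cost \<gamma> u 0 t) < ereal r"
    using g(2) by (simp add: ext_integral_nonneg[OF L_nonneg])
  then have "cost \<gamma> u 0 t \<noteq> top" by auto
  then obtain \<kappa> where \<kappa>: "cost \<gamma> u 0 t = ennreal \<kappa>" "0 \<le> \<kappa>" by (cases "cost \<gamma> u 0 t") simp_all
  have "\<phi> (\<gamma> 0) + \<kappa> < r" using less \<kappa> by simp
  moreover have "conn t (\<gamma> 0) x \<kappa>" by (rule connI[OF adm(1)]) (use \<kappa> assms(2) adm(2) in simp_all)
  ultimately show ?thesis using that by blast
qed

lemma lax_oleinik_D:
  assumes "t \<ge> 0"
  shows "lax_oleinik f L t D x = ereal (D x)"
proof (cases "t = 0")
  case True
  then show ?thesis by (simp add: lax_oleinik_def)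
next
  case False
  then have t: "t > 0" using assms by simp
  show ?thesis
  proof (rule antisym)
    show "lax_oleinik f L t D x \<le> ereal (D x)"
    proof (rule ereal_le_epsilon2)
      fix e :: real assume "e > 0"
      then obtain a t0 \<kappa> where a: "a \<in> rest" "conn t0 a x \<kappa>" "\<kappa> < D x + e" by (rule D_approx)
      have t0: "t0 \<ge> 0" using conn_nonneg[OF a(2)] by simp
      have w: "conn t a a 0" by (rule conn_wait) (use a(1) t in \<open>auto simp: rest_def\<close>)
      \<comment> \<open>The prolonged trajectory is cut at time t0: the last leg then has length
        exactly t, and the first one starts in the rest set, so D z \<le> \<kappa>1.\<close>
      have "conn (t + t0) a x \<kappa>" using conn_trans[OF w a(2)] by simp
      then obtain z \<kappa>1 \<kappa>2 where z: "conn t0 a z \<kappa>1" "conn (t + t0 - t0) z x \<kappa>2" "\<kappa>1 + \<kappa>2 \<le> \<kappa>"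
        by (rule conn_split) (use t0 t in auto)
      have "lax_oleinik f L t D x \<le> ereal (D z + \<kappa>2)" using lax_oleinik_le[OF _ t] z(2) by simp
      also have "\<dots> \<le> ereal (D x + e)" using D_le[OF a(1) z(1)] z(3) a(3) by simp
      finally show "lax_oleinik f L t D x \<le> ereal (D x) + ereal e" by simp
    qed
    show "ereal (D x) \<le> lax_oleinik f L t D x"
    proof (rule ccontr)
      assume "\<not> ?thesis"
      then have "lax_oleinik f L t D x < ereal (D x)" by simp
      then obtain y \<kappa> where "conn t y x \<kappa>" "D y + \<kappa> < D x" by (rule lax_oleinik_less[OF _ t])
      then show False using D_triangle by fastforce
    qed
  qed
qed

lemma lax_oleinik_tendsto_D:
  assumes chi0: "\<And>x. 0 \<le> chi x" and chi_rest: "\<And>a. a \<in> rest \<Longrightarrow> chi a = 0"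
  shows "ereal_uniform_limit (cball 0 R) (\<lambda>t. lax_oleinik f L t chi) D at_top"
  unfolding ereal_uniform_limit_def
proof (intro allI impI)
  fix e :: real assume e: "e > 0"
  have upper: "\<exists>\<tau>. \<forall>t\<ge>\<tau>. \<forall>x\<in>cball 0 R. lax_oleinik f L t chi x \<le> ereal (D x + e / 2)"
  proof -
    have "\<exists>\<delta> \<tau>. \<delta> > 0 \<and> (\<forall>t\<ge>\<tau>. \<forall>x\<in>ball z \<delta>. lax_oleinik f L t chi x \<le> ereal (D x + e / 2))" for z
    proof -
      \<comment> \<open>Three errors of size e' occur: the choice of \<kappa>, the connection from z
        to x and the change of D. Together they stay below e / 2.\<close>
      define e' where "e' = e / 8"
      have e': "e' > 0" using e by (simp add: e'_def)
      obtain a t0 \<kappa> where a: "a \<in> rest" "conn t0 a z \<kappa>" "\<kappa> < D z + e'" using e' by (rule D_approx)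
      obtain \<delta> where d: "\<delta> > 0"
        "\<And>x. x \<in> ball z \<delta> \<Longrightarrow> \<bar>D x - D z\<bar> \<le> e' \<and> (\<exists>t \<kappa>. conn t z x \<kappa> \<and> t \<le> e' \<and> \<kappa> \<le> e')"
        using e' by (rule D_local) blast
      have "lax_oleinik f L t chi x \<le> ereal (D x + e / 2)" if t: "t \<ge> t0 + e' + 1" and x: "x \<in> ball z \<delta>" for t x
      proof -
        obtain t' \<kappa>' where 1: "conn t' z x \<kappa>'" "t' \<le> e'" "\<kappa>' \<le> e'" and 2: "\<bar>D x - D z\<bar> \<le> e'"
          using d(2)[OF x] by blast
        \<comment> \<open>Waiting fills up the total time to exactly t; t' \<le> e' ensures that the
          waiting time is nonnegative for all x in the ball.\<close>
        have "conn (t - t0 - t') a a 0"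
          by (rule conn_wait) (use a(1) t 1 in \<open>auto simp: rest_def\<close>)
        from conn_trans[OF conn_trans[OF this a(2)] 1(1)]
        have "conn t a x (\<kappa> + \<kappa>')" by simp
        moreover have "t > 0" using t e' conn_nonneg[OF a(2)] by simp
        ultimately have "lax_oleinik f L t chi x \<le> ereal (chi a + (\<kappa> + \<kappa>'))" by (rule lax_oleinik_le)
        also have "chi a + (\<kappa> + \<kappa>') \<le> D x + e / 2"
          using chi_rest[OF a(1)] a(3) 1(3) 2 e unfolding e'_def by linarith
        finally show ?thesis by simp
      qed
      then show ?thesis using d(1) by blast
    qed
    then obtain \<delta> \<tau> where d: "\<And>z. \<delta> z > 0"
      and \<tau>: "\<And>z t x. t \<ge> \<tau> z \<Longrightarrow> x \<in> ball z (\<delta> z) \<Longrightarrow> lax_oleinik f L t chi x \<le> ereal (D x + e / 2)"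
      by metis
    obtain C where C: "C \<subseteq> cball 0 R" "finite C" "cball 0 R \<subseteq> (\<Union>z\<in>C. ball z (\<delta> z))"
    proof (rule compactE_image[of "cball (0::real^'d) R" "cball 0 R" "\<lambda>z. ball z (\<delta> z)"])
      show "cball 0 R \<subseteq> (\<Union>z\<in>cball 0 R. ball z (\<delta> z))" using d by force
    qed auto
    \<comment> \<open>The sum of the absolute values exceeds each of the finitely many thresholds,
      also when C is empty.\<close>
    show ?thesis
    proof (intro exI[of _ "\<Sum>z\<in>C. \<bar>\<tau> z\<bar>"] allI impI ballI)
      fix t and x :: "real^'d" assume t: "(\<Sum>z\<in>C. \<bar>\<tau> z\<bar>) \<le> t" and x: "x \<in> cball 0 R"
      obtain z where z: "z \<in> C" "x \<in> ball z (\<delta> z)" using C(3) x by blast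
      have "\<tau> z \<le> \<bar>\<tau> z\<bar>" by simp
      also have "\<dots> \<le> (\<Sum>z\<in>C. \<bar>\<tau> z\<bar>)" by (rule member_le_sum[OF z(1)]) (use C in auto)
      finally show "lax_oleinik f L t chi x \<le> ereal (D x + e / 2)" using t z(2) by (intro \<tau>) auto
    qed
  qed
  have lower: "\<exists>\<tau>. \<forall>t\<ge>\<tau>. \<forall>x\<in>cball 0 R. ereal (D x - e / 2) \<le> lax_oleinik f L t chi x"
  proof -
    have "bounded (D ` cball 0 R)"
      by (intro compact_imp_bounded compact_continuous_image D_continuous) auto
    then obtain C where C: "\<And>x. x \<in> cball 0 R \<Longrightarrow> \<bar>D x\<bar> \<le> C" unfolding bounded_iff by (metis imageI real_norm_def)
    have "e / 4 > 0" using e by simp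
    then obtain k where k: "k > 0" "\<And>p. L p 0 < k \<Longrightarrow> D p \<le> e / 4" by (rule rest_near) blast
    \<comment> \<open>Beyond this time k t > C \<ge> D x, so a trajectory cheaper than D x must
      somewhere have running cost at rest below k.\<close>
    show ?thesis
    proof (intro exI[of _ "\<bar>C\<bar> / k + 1"] allI impI ballI)
      fix t and x :: "real^'d" assume t: "\<bar>C\<bar> / k + 1 \<le> t" and x: "x \<in> cball 0 R"
      have "\<bar>C\<bar> / k \<ge> 0" using k by simp
      then have "t > 0" using t by linarith
      have kt: "C < k * t" using t k by (simp add: field_simps)
      show "ereal (D x - e / 2) \<le> lax_oleinik f L t chi x"
      proof (rule ccontr)
        assume "\<not> ?thesis"
        then have "lax_oleinik f L t chi x < ereal (D x - e / 2)" by simp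
        then obtain y \<kappa> where y: "conn t y x \<kappa>" "chi y + \<kappa> < D x - e / 2" by (rule lax_oleinik_less[OF _ \<open>t > 0\<close>])
        have "\<kappa> < k * t" using y(2) chi0[of y] C[OF x] kt e by linarith
        then obtain p s \<kappa>' where p: "conn s p x \<kappa>'" "\<kappa>' \<le> \<kappa>" "L p 0 < k"
          by (rule conn_passes_near_rest[OF y(1)])
        have "D x \<le> D p + \<kappa>'" by (rule D_triangle[OF p(1)])
        then show False using k(2)[OF p(3)] p(2) y(2) chi0[of y] e by linarith
      qed
    qed
  qed
  obtain \<tau>1 where \<tau>1: "\<And>t x. t \<ge> \<tau>1 \<Longrightarrow> x \<in> cball 0 R \<Longrightarrow> lax_oleinik f L t chi x \<le> ereal (D x + e / 2)"
    using upper by blast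
  obtain \<tau>2 where \<tau>2: "\<And>t x. t \<ge> \<tau>2 \<Longrightarrow> x \<in> cball 0 R \<Longrightarrow> ereal (D x - e / 2) \<le> lax_oleinik f L t chi x"
    using lower by blast
  show "\<forall>\<^sub>F t in at_top. \<forall>x\<in>cball 0 R. \<bar>lax_oleinik f L t chi x - ereal (D x)\<bar> < ereal e"
    using eventually_ge_at_top[of \<tau>1] eventually_ge_at_top[of \<tau>2]
  proof eventually_elim
    case (elim t)
    show ?case
    proof
      fix x :: "real^'d" assume x: "x \<in> cball 0 R"
      have "lax_oleinik f L t chi x \<le> ereal (D x + e / 2)" "ereal (D x - e / 2) \<le> lax_oleinik f L t chi x"
        using \<tau>1[OF elim(1) x] \<tau>2[OF elim(2) x] by auto
      then show "\<bar>lax_oleinik f L t chi x - ereal (D x)\<bar> < ereal e"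
        using e by (cases "lax_oleinik f L t chi x") (auto simp: abs_less_iff)
    qed
  qed
qed

end

section \<open>The Hamilton-Jacobi equation\<close>

text \<open>Riesz representation in coordinates; uniqueness of the representing vector gives meaning
  to the definite description in \<open>gradient\<close>.\<close>

lemma frechet_derivative_gradient:
  fixes \<phi> :: "'a::euclidean_space \<Rightarrow> real"
  assumes "\<phi> differentiable (at x)"
  shows "frechet_derivative \<phi> (at x) v = gradient \<phi> x \<bullet> v"
proof -
  have D: "(\<phi> has_derivative frechet_derivative \<phi> (at x)) (at x)"
    using assms by (simp add: frechet_derivative_works)
  define p where "p = (\<Sum>b\<in>Basis. frechet_derivative \<phi> (at x) b *\<^sub>R b)"
  have eq: "frechet_derivative \<phi> (at x) v = p \<bullet> v" for v
    unfolding frechet_derivative_Basis[OF assms, of v] p_def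
    by (simp add: inner_sum_left mult.commute inner_commute[of v])
  have "GDERIV \<phi> x :> p"
    using D unfolding gderiv_def eq[abs_def] by (simp add: inner_commute)
  moreover have "q = p" if "GDERIV \<phi> x :> q" for q
  proof -
    have "(\<lambda>h. h \<bullet> q) = (\<lambda>h. h \<bullet> p)"
      using that \<open>GDERIV \<phi> x :> p\<close> unfolding gderiv_def by (rule has_derivative_unique)
    then have "(q - p) \<bullet> q = (q - p) \<bullet> p" by meson
    then have "(q - p) \<bullet> (q - p) = 0" by (simp add: inner_diff_right)
    then show ?thesis by simp
  qed
  ultimately have "gradient \<phi> x = p" unfolding gradient_def by (rule the_equality)
  then show ?thesis by (simp add: eq)
qed

lemma C_k_id: "C_k k (\<lambda>x. x)"
proof (cases k)
  case (Suc k')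
  show ?thesis unfolding Suc by (rule C_k_SucI[where g' = "\<lambda>_ v. v"]) (auto intro: C_k_const)
qed simp

context control_problem
begin

lemma C_k_control_matrix: "C_k k (\<lambda>y. control_matrix f y *v u)"
  unfolding control_matrix_mult by (intro C_k_sum C_k_bounded_linear[OF bounded_linear_scaleR_right] C_k_f)

lemma control_matrix_bound:
  obtains M where "M > 0" "\<And>y u. y \<in> cball z r \<Longrightarrow> norm (control_matrix f y *v u) \<le> M * norm u"
proof -
  have "\<exists>M. \<forall>y\<in>cball z r. norm (f i y) \<le> M" for i
    by (rule C_k_cball_bound[OF C_k_f[of 1 i], of z r]) blast
  then obtain M where M: "\<And>i y. y \<in> cball z r \<Longrightarrow> norm (f i y) \<le> M i" by metis
  define S where "S = (\<Sum>i\<in>UNIV. \<bar>M i\<bar>)"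
  have S: "S \<ge> 0" by (simp add: S_def sum_nonneg)
  show ?thesis
  proof (rule that[of "S + 1"])
    show "S + 1 > 0" using S by simp
    fix y u assume y: "y \<in> cball z r"
    have "norm (control_matrix f y *v u) \<le> (\<Sum>i\<in>UNIV. norm u * \<bar>M i\<bar>)"
      unfolding control_matrix_mult
    proof (rule sum_norm_le)
      fix i
      have "norm (f i y) \<le> \<bar>M i\<bar>" using M[OF y, of i] by linarith
      then show "norm (u $ i *\<^sub>R f i y) \<le> norm u * \<bar>M i\<bar>"
        using component_le_norm_cart[of u i] by (auto intro: mult_mono)
    qed
    also have "\<dots> = S * norm u" by (simp add: S_def sum_distrib_left mult.commute)
    also have "\<dots> \<le> (S + 1) * norm u" by (intro mult_right_mono) auto
    finally show "norm (control_matrix f y *v u) \<le> (S + 1) * norm u" .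
  qed
qed

lemma directional_bound:
  fixes \<phi> :: "real^'d \<Rightarrow> real"
  assumes \<phi>: "C_k 1 \<phi>"
  obtains M where "M > 0" "\<And>y u. y \<in> cball z r \<Longrightarrow> \<bar>frechet_derivative \<phi> (at y) (control_matrix f y *v u)\<bar> \<le> M * norm u"
proof -
  obtain M1 where M1: "M1 > 0" "\<And>y v. y \<in> cball z r \<Longrightarrow> norm (frechet_derivative \<phi> (at y) v) \<le> M1 * norm v"
    by (rule C_k_cball_bound[OF \<phi>, of z r], rule that)
  obtain M2 where M2: "M2 > 0" "\<And>y u. y \<in> cball z r \<Longrightarrow> norm (control_matrix f y *v u) \<le> M2 * norm u"
    by (rule control_matrix_bound[of z r], rule that)
  show ?thesis
  proof (rule that[of "M1 * M2"])
    show "M1 * M2 > 0" using M1(1) M2(1) by simp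
    fix y u assume y: "y \<in> cball z r"
    have "\<bar>frechet_derivative \<phi> (at y) (control_matrix f y *v u)\<bar> \<le> M1 * norm (control_matrix f y *v u)"
      using M1(2)[OF y, of "control_matrix f y *v u"] by simp
    also have "\<dots> \<le> M1 * (M2 * norm u)" using M1(1) M2(2)[OF y] by (intro mult_left_mono) auto
    finally show "\<bar>frechet_derivative \<phi> (at y) (control_matrix f y *v u)\<bar> \<le> M1 * M2 * norm u"
      by (simp add: mult.assoc)
  qed
qed

end

context coercive_control_problem
begin

text \<open>D counts the cost of arriving, so the test trajectory has to end at x: the flow of the
  constant control is followed from E (-t) x to x, and the contact condition is used at the starting
  point.\<close>

lemma viscosity_subsolution_D: "viscosity_subsolution (hamiltonian f L) D"
  unfolding viscosity_subsolution_def
proof (intro allI impI)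
  fix \<phi> x assume "C_k 1 \<phi> \<and> (\<forall>\<^sub>F y in nhds x. D y - \<phi> y \<le> D x - \<phi> x)"
  then have \<phi>: "C_k 1 \<phi>" and max: "\<forall>\<^sub>F y in nhds x. D y - \<phi> y \<le> D x - \<phi> x" by auto
  have diff: "\<phi> differentiable (at y)" for y using \<phi> by simp
  show "hamiltonian f L x (gradient \<phi> x) \<le> 0"
    unfolding hamiltonian_def
  proof (rule SUP_least)
    fix u :: "real^'m"
    define X where "X y = control_matrix f y *v u" for y
    have X1: "C_k 1 X" unfolding X_def[abs_def] by (rule C_k_control_matrix)
    obtain h E where E: "local_flow_of X x 1 h E" using local_flow_of_exists[OF X1, of 1 x] by auto
    have h: "h > 0" and E0: "\<And>w. E 0 w = w" using E by (auto simp: local_flow_of_def)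
    have x1: "x \<in> cball x 1" by simp
    have EB: "E t x \<in> cball x 2" and ED: "((\<lambda>s. E s x) has_vector_derivative X (E t x)) (at t within {-h..h})"
      if "t \<in> {-h..h}" for t
      using E that x1 by (auto simp: local_flow_of_def)
    have Econt: "continuous_on {-h..h} (\<lambda>s. E s x)"
      using ED by (rule continuous_on_vector_derivative)
    obtain M where M: "\<And>y. y \<in> cball x 2 \<Longrightarrow> norm (X y) \<le> M"
      by (rule C_k_cball_bound[OF X1, of x 2]) (rule that)
    let ?p = "frechet_derivative \<phi> (at x) (X x)"
    have "?p \<le> L x u + e" if e: "e > 0" for e
    proof -
      \<comment> \<open>One half for the variation of the running cost near x, one half for the
        first order expansion of \<phi> along the flow.\<close>
      define e' where "e' = e / 2"
      have e': "e' > 0" using e by (simp add: e'_def)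
      have "isCont (\<lambda>y. L y u) x" using L_rest_continuous[of UNIV u] by (simp add: continuous_on_eq_continuous_at)
      then obtain r1 where r1: "r1 > 0" "\<And>y. dist y x < r1 \<Longrightarrow> \<bar>L y u - L x u\<bar> < e'"
        unfolding continuous_at_eps_delta using e' by (auto simp: dist_real_def)
      obtain r2 where r2: "r2 > 0" "\<And>y. dist y x < r2 \<Longrightarrow> D y - \<phi> y \<le> D x - \<phi> x"
        using max unfolding eventually_nhds_metric by blast
      have "\<exists>d>0. \<forall>s\<in>{-h..h}. dist s 0 < d \<longrightarrow> dist (E s x) (E 0 x) < min r1 r2"
        using Econt[unfolded continuous_on_iff, rule_format, of 0 "min r1 r2"] h r1(1) r2(1) by auto
      then obtain d1 where d1: "d1 > 0" "\<And>s. s \<in> {-h..h} \<Longrightarrow> \<bar>s\<bar> < d1 \<Longrightarrow> dist (E s x) x < r1 \<and> dist (E s x) x < r2"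
        by (auto simp: E0)
      have D\<phi>: "(\<phi> has_derivative frechet_derivative \<phi> (at x)) (at (E 0 x))"
        using diff[of x] by (simp add: E0 frechet_derivative_works)
      have "((\<lambda>s. \<phi> (E s x)) has_derivative (\<lambda>s. frechet_derivative \<phi> (at x) (s *\<^sub>R X (E 0 x)))) (at 0 within {-h..h})"
        by (rule has_derivative_compose[where f = "\<lambda>s. E s x" and x = 0 and g = \<phi>, OF _ D\<phi>])
          (use ED[of 0] h in \<open>simp add: has_vector_derivative_def\<close>)
      then have "((\<lambda>s. \<phi> (E s x)) has_derivative (\<lambda>s. s * ?p)) (at 0 within {-h..h})"
        by (simp add: E0 linear_scale[OF linear_frechet_derivative[OF diff]])
      then obtain d2 where d2: "d2 > 0" "\<And>s. s \<in> {-h..h} \<Longrightarrow> \<bar>s\<bar> < d2 \<Longrightarrow> \<bar>\<phi> (E s x) - \<phi> x - s * ?p\<bar> \<le> e' * \<bar>s\<bar>"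
        unfolding has_derivative_within_alt using e' by (auto simp: E0)
      define t where "t = Min {h, d1 / 2, d2 / 2}"
      have t: "t > 0" "t \<le> h" "t < d1" "t < d2" using h d1(1) d2(1) by (auto simp: t_def)
      have tm: "- t \<in> {-h..h}" using t by auto
      have Lc: "0 \<le> L x u + e'" using L_nonneg[of x u] e' by simp
      have sub: "(\<lambda>s. s + - t) ` {0..t} \<subseteq> {-h..h}" using t by auto
      have "conn t ((\<lambda>s. E (s + - t) x) 0) ((\<lambda>s. E (s + - t) x) t) ((L x u + e') * t)"
      proof (rule conn_constant_control[where v = u and M = M])
        fix s assume s: "s \<in> {0..t}"
        then have s': "s + - t \<in> {-h..h}" using sub by blast
        have "((\<lambda>s. E s x) \<circ> (\<lambda>s. s + - t) has_vector_derivative 1 *\<^sub>R X (E (s + - t) x)) (at s within {0..t})"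
        proof (rule vector_diff_chain_within)
          show "((\<lambda>s. E s x) has_vector_derivative X (E (s + - t) x)) (at (s + - t) within (\<lambda>s. s + - t) ` {0..t})"
            by (rule has_vector_derivative_within_subset[OF ED[OF s'] sub])
        qed (auto intro!: derivative_eq_intros)
        then show "((\<lambda>s. E (s + - t) x) has_vector_derivative control_matrix f (E (s + - t) x) *v u) (at s within {0..t})"
          by (simp add: o_def X_def)
        have "dist (E (s + - t) x) x < r1" using d1(2)[OF s'] s t by auto
        then show "L (E (s + - t) x) u \<le> L x u + e'" using r1(2) by fastforce
        show "norm (control_matrix f (E (s + - t) x) *v u) \<le> M" using M[OF EB[OF s']] by (simp add: X_def)
      qed (use t Lc in auto)
      then have "conn t (E (- t) x) x ((L x u + e') * t)" by (simp add: E0)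
      from D_triangle[OF this] have 1: "D x \<le> D (E (- t) x) + (L x u + e') * t" .
      have "D (E (- t) x) - \<phi> (E (- t) x) \<le> D x - \<phi> x"
        using r2(2) d1(2)[OF tm] t by simp
      then have 2: "\<phi> x - \<phi> (E (- t) x) \<le> (L x u + e') * t" using 1 by linarith
      have "\<bar>\<phi> (E (- t) x) - \<phi> x - (- t) * ?p\<bar> \<le> e' * \<bar>- t\<bar>" using d2(2)[OF tm] t by simp
      then have "t * ?p \<le> \<phi> x - \<phi> (E (- t) x) + e' * t" using t by (simp add: abs_le_iff)
      also have "\<dots> \<le> t * (L x u + e)" using 2 by (simp add: e'_def algebra_simps)
      finally show ?thesis using t(1) by simp
    qed
    then have "?p \<le> L x u" by (rule field_le_epsilon)
    then show "ereal (gradient \<phi> x \<bullet> (control_matrix f x *v u) - L x u) \<le> 0"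
      by (simp add: frechet_derivative_gradient[OF diff, symmetric] X_def)
  qed
qed

text \<open>By Young's inequality M |u| \<le> c |u|^2 / 2 + M^2 / (2 c), and |u|^2 \<le> 2 l L. The
  distance covered in a time t at cost \<kappa> is thus at most c l \<kappa> + M^2 t / (2 c), as
  long as the speed bound M is valid.\<close>

lemma trajectory_stays_near:
  assumes r: "r > 0" and E0: "0 \<le> E0"
  obtains t0 where "t0 > 0" "\<And>t \<gamma> u \<kappa> s. 0 \<le> t \<Longrightarrow> t \<le> t0 \<Longrightarrow> (\<gamma>, u) \<in> admissible f 0 t \<Longrightarrow> \<gamma> t = x \<Longrightarrow>
    cost \<gamma> u 0 t \<le> ennreal \<kappa> \<Longrightarrow> 0 \<le> \<kappa> \<Longrightarrow> \<kappa> \<le> E0 \<Longrightarrow> s \<in> {0..t} \<Longrightarrow> dist (\<gamma> s) x < r"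
proof -
  obtain M where M: "M > 0" "\<And>y u. y \<in> cball x r \<Longrightarrow> norm (control_matrix f y *v u) \<le> M * norm u"
    by (rule control_matrix_bound[of x r], rule that)
  \<comment> \<open>c makes the cost term at most r / 4, then t0 does the same for the time term.
    The added 1 avoids a vanishing denominator when E0 = 0.\<close>
  define c where "c = r / (4 * (l * E0 + 1))"
  have lE: "0 \<le> l * E0" using l E0 by simp
  have c: "c > 0" using r lE by (simp add: c_def)
  have cE: "c * l * E0 \<le> r / 4"
    using r lE by (simp add: c_def field_simps)
  define t0 where "t0 = r * c / (2 * (M\<^sup>2 + 1))"
  have M1: "M\<^sup>2 + 1 > 0" by (simp add: add_nonneg_pos)
  have t0: "t0 > 0" using r c M1 by (simp add: t0_def)
  have t0M: "M\<^sup>2 / (2 * c) * t0 \<le> r / 4"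
    using r c M1 by (simp add: t0_def field_simps)
  show ?thesis
  proof (rule that[OF t0])
    fix t \<gamma> u \<kappa> s assume t: "0 \<le> t" "t \<le> t0" and adm: "(\<gamma>, u) \<in> admissible f 0 t" and \<gamma>t: "\<gamma> t = x"
      and cost: "cost \<gamma> u 0 t \<le> ennreal \<kappa>" and \<kappa>: "0 \<le> \<kappa>" "\<kappa> \<le> E0" and s: "s \<in> {0..t}"
    show "dist (\<gamma> s) x < r"
    proof (rule ccontr)
      assume "\<not> dist (\<gamma> s) x < r"
      then have far: "r \<le> dist (\<gamma> s) x" by simp
      have "continuous_on {0..t} \<gamma>" using adm by (intro absolutely_continuous_imp_continuous) (simp add: admissible_iff)
      then have cont: "continuous_on {s'..t} (\<lambda>s. dist (\<gamma> s) x)" if "0 \<le> s'" for s'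
        using that by (intro continuous_on_dist continuous_on_const) (auto elim: continuous_on_subset)
      have hit: "\<exists>s''\<ge>s'. s'' \<le> t \<and> dist (\<gamma> s'') x = r" if "0 \<le> s'" "s' \<le> t" "r \<le> dist (\<gamma> s') x" for s'
        using IVT2'[of "\<lambda>s. dist (\<gamma> s) x" t r s'] that cont[of s'] \<gamma>t r by auto
      define S where "S = {s'\<in>{s..t}. dist (\<gamma> s') x = r}"
      have "S \<noteq> {}" using hit[of s] s far by (auto simp: S_def)
      moreover have "compact S"
      proof -
        have "closed S" unfolding S_def
          using continuous_closed_preimage_constant[OF cont[of s] closed_atLeastAtMost, of r] s by simp
        then have "compact ({s..t} \<inter> S)" by (intro compact_Int_closed) auto
        moreover have "{s..t} \<inter> S = S" by (auto simp: S_def)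
        ultimately show ?thesis by simp
      qed
      ultimately obtain s0 where s0: "s0 \<in> S" "\<And>s'. s' \<in> S \<Longrightarrow> s' \<le> s0"
        using compact_attains_sup by metis
      have s0': "0 \<le> s0" "s0 \<le> t" "dist (\<gamma> s0) x = r" using s0(1) s by (auto simp: S_def)
      have near: "\<gamma> s' \<in> cball x r" if "s' \<in> {s0..t}" for s'
      proof (rule ccontr)
        assume "\<gamma> s' \<notin> cball x r"
        then have gt: "r < dist (\<gamma> s') x" by (simp add: dist_commute)
        have "\<exists>s''\<ge>s'. s'' \<le> t \<and> dist (\<gamma> s'') x = r"
          by (rule hit) (use gt that s0' in auto)
        then obtain s'' where s'': "s'' \<ge> s'" "s'' \<le> t" "dist (\<gamma> s'') x = r" by blast
        moreover from this have "s'' \<in> S" using that s0(1) by (auto simp: S_def)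
        ultimately have "s'' = s'" using s0(2)[of s''] that by auto
        then show False using gt s''(3) by simp
      qed
      \<comment> \<open>Projecting onto the unit vector from \<gamma> s0 to x reduces the
        displacement to a scalar integral of value exactly r.\<close>
      define e where "e = (1 / r) *\<^sub>R (x - \<gamma> s0)"
      have ne: "norm e = 1" using s0'(3) r by (simp add: e_def dist_norm norm_minus_commute)
      have Ce: "C_k 1 (\<lambda>y. y \<bullet> e)" by (rule C_k_bounded_linear[OF bounded_linear_inner_left C_k_id])
      have fe: "frechet_derivative (\<lambda>y. y \<bullet> e) (at y) = (\<lambda>v. v \<bullet> e)" for y
        by (rule frechet_derivative_at[symmetric]) (auto intro!: derivative_eq_intros)
      have adm0: "(\<gamma>, u) \<in> admissible f s0 t" by (rule admissible_subset[OF adm]) (use s0' in auto)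
      define I where "I = (\<gamma> t \<bullet> e - \<gamma> s0 \<bullet> e)"
      have "((\<lambda>s. (control_matrix f (\<gamma> s) *v u s) \<bullet> e) has_integral I) {s0..t}"
        using has_integral_along_trajectory[OF adm0 s0'(2) Ce] unfolding fe I_def .
      moreover have Ir: "I = r"
      proof -
        have "I = (x - \<gamma> s0) \<bullet> e" unfolding I_def \<gamma>t by (simp add: inner_diff_left)
        also have "\<dots> = (norm (x - \<gamma> s0))\<^sup>2 / r" by (simp add: e_def power2_norm_eq_inner)
        also have "\<dots> = r" using s0'(3) r by (simp add: dist_norm norm_minus_commute power2_eq_square)
        finally show ?thesis .
      qed
      ultimately have h1: "((\<lambda>s. (control_matrix f (\<gamma> s) *v u s) \<bullet> e) has_integral r) {s0..t}" by simp
      have "((\<lambda>s. (control_matrix f (\<gamma> s) *v u s) \<bullet> e - M\<^sup>2 / (2 * c)) has_integral (r - (t - s0) * (M\<^sup>2 / (2 * c)))) {s0..t}"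
        using has_integral_diff[OF h1 has_integral_const_real[of "M\<^sup>2 / (2 * c)" s0 t]] s0' by simp
      \<comment> \<open>After division by c l, Young's inequality says that the integrand is below
        L, so the integral can be compared with the cost.\<close>
      from has_integral_divide[OF this, of "c * l"]
      have h2: "((\<lambda>s. ((control_matrix f (\<gamma> s) *v u s) \<bullet> e - M\<^sup>2 / (2 * c)) / (c * l)) has_integral
          (r - (t - s0) * (M\<^sup>2 / (2 * c))) / (c * l)) {s0..t}" .
      have "(r - (t - s0) * (M\<^sup>2 / (2 * c))) / (c * l) \<le> \<kappa>"
      proof (rule has_integral_le_nn_cost[OF h2 _ _ cost_measurable[OF adm0] _ \<kappa>(1)])
        show "0 \<le> L (\<gamma> s) (u s)" for s by (rule L_nonneg)
        have "cost \<gamma> u 0 t = cost \<gamma> u 0 s0 + cost \<gamma> u s0 t"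
          by (rule nn_cost_split[OF s0'(1,2) cost_measurable[OF adm]])
        then have "cost \<gamma> u s0 t \<le> cost \<gamma> u 0 t" by simp
        then show "cost \<gamma> u s0 t \<le> ennreal \<kappa>" using cost by (rule order_trans)
        fix s' assume s': "s' \<in> {s0..t}"
        let ?n = "norm (u s')"
        have "(control_matrix f (\<gamma> s') *v u s') \<bullet> e \<le> norm (control_matrix f (\<gamma> s') *v u s') * norm e"
          by (rule norm_cauchy_schwarz)
        also have "\<dots> \<le> M * ?n" using M(2)[OF near[OF s'], of "u s'"] ne by simp
        also have "\<dots> \<le> c / 2 * ?n\<^sup>2 + M\<^sup>2 / (2 * c)"
        proof -
          have "0 \<le> (c * ?n - M)\<^sup>2 / (2 * c)" using c by simp
          also have "(c * ?n - M)\<^sup>2 / (2 * c) = c / 2 * ?n\<^sup>2 + M\<^sup>2 / (2 * c) - M * ?n"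
            using c by (simp add: power2_eq_square field_simps)
          finally show ?thesis by simp
        qed
        also have "c / 2 * ?n\<^sup>2 \<le> c / 2 * (2 * l * L (\<gamma> s') (u s'))"
          using c quadratic by (intro mult_left_mono) auto
        finally show "((control_matrix f (\<gamma> s') *v u s') \<bullet> e - M\<^sup>2 / (2 * c)) / (c * l) \<le> L (\<gamma> s') (u s')"
          using c l by (simp add: divide_le_eq mult_ac)
      qed
      then have "r - (t - s0) * (M\<^sup>2 / (2 * c)) \<le> \<kappa> * (c * l)" using c l by (simp add: divide_le_eq)
      also have "\<dots> \<le> E0 * (c * l)" using \<kappa> c l by (intro mult_right_mono) auto
      also have "\<dots> \<le> r / 4" using cE by (simp add: mult_ac)
      finally have 1: "r - (t - s0) * (M\<^sup>2 / (2 * c)) \<le> r / 4" .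
      have "(t - s0) * (M\<^sup>2 / (2 * c)) \<le> t0 * (M\<^sup>2 / (2 * c))"
        using t s0' c by (intro mult_right_mono) auto
      also have "\<dots> \<le> r / 4" using t0M by (simp add: mult.commute)
      finally show False using 1 r by simp
    qed
  qed
qed

text \<open>The controls are not confined to a compact set. For bounded u the strict inequality
  spreads from x to a neighbourhood by uniform continuity; for large u the quadratic growth of L
  beats the linear term, whatever happens at x.\<close>

lemma negative_hamiltonian_region:
  fixes \<phi> :: "real^'d \<Rightarrow> real"
  assumes \<phi>: "C_k 1 \<phi>" and \<eta>: "\<eta> > 0"
    and neg: "\<And>u. 2 * \<eta> \<le> L x u - frechet_derivative \<phi> (at x) (control_matrix f x *v u)"
  obtains r where "r > 0"
    "\<And>y u. dist y x < r \<Longrightarrow> \<eta> \<le> L y u - frechet_derivative \<phi> (at y) (control_matrix f y *v u)"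
proof -
  obtain C where C: "C > 0" "\<And>y u. y \<in> cball x 1 \<Longrightarrow> \<bar>frechet_derivative \<phi> (at y) (control_matrix f y *v u)\<bar> \<le> C * norm u"
    by (rule directional_bound[OF \<phi>, of x 1], rule that)
  \<comment> \<open>For |u| > Kb \<ge> 1 one has |u|^2 \<ge> 2 l (C + \<eta>) |u| \<ge> 2 l (C |u| +
    \<eta>), hence L \<ge> C |u| + \<eta>.\<close>
  define Kb where "Kb = 2 * l * (C + \<eta>) + 1"
  have Kb: "Kb \<ge> 1" using l C(1) \<eta> by (simp add: Kb_def)
  define \<Psi> where "\<Psi> = (\<lambda>(y, u). L y u - frechet_derivative \<phi> (at y) (control_matrix f y *v u))"
  have diff: "\<phi> differentiable (at y)" for y using \<phi> by simp
  \<comment> \<open>Joint continuity in (y, u) becomes visible in coordinates: each summand is a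
    component of u times a continuous function of y.\<close>
  have eq: "frechet_derivative \<phi> (at y) (control_matrix f y *v u) = (\<Sum>i\<in>UNIV. u $ i * frechet_derivative \<phi> (at y) (f i y))" for y u
  proof -
    interpret linear "frechet_derivative \<phi> (at y)" by (rule linear_frechet_derivative[OF diff])
    show ?thesis unfolding control_matrix_mult by (simp add: sum scale)
  qed
  have ci: "continuous_on UNIV (\<lambda>y. frechet_derivative \<phi> (at y) (f i y))" for i
    using C_k_directional[of 0 \<phi> "f i"] \<phi> C_k_f[of 0 i] by simp
  let ?S = "cball x 1 \<times> cball (0::real^'m) Kb"
  have "continuous_on ?S \<Psi>"
  proof -
    have "continuous_on ?S (\<lambda>p. (\<lambda>(x, u). L x u) p - (\<Sum>i\<in>UNIV. snd p $ i * frechet_derivative \<phi> (at (fst p)) (f i (fst p))))"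
      by (intro continuous_on_diff continuous_on_sum continuous_on_mult continuous_on_subset[OF L_cont]
          continuous_on_compose2[OF ci continuous_on_fst] continuous_on_component continuous_on_snd continuous_on_id) auto
    then show ?thesis by (simp add: \<Psi>_def eq case_prod_unfold)
  qed
  then have "uniformly_continuous_on ?S \<Psi>"
    by (rule compact_uniformly_continuous) (intro compact_Times compact_cball)
  then obtain \<delta> where \<delta>: "\<delta> > 0" "\<And>p q. p \<in> ?S \<Longrightarrow> q \<in> ?S \<Longrightarrow> dist q p < \<delta> \<Longrightarrow> dist (\<Psi> q) (\<Psi> p) < \<eta>"
    using \<eta> unfolding uniformly_continuous_on_def by meson
  show ?thesis
  proof (rule that[of "min 1 \<delta>"])
    show "min 1 \<delta> > 0" using \<delta> by simp
    fix y u assume y: "dist y x < min 1 \<delta>"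
    then have y1: "y \<in> cball x 1" by (simp add: dist_commute)
    show "\<eta> \<le> L y u - frechet_derivative \<phi> (at y) (control_matrix f y *v u)"
    proof (cases "norm u \<le> Kb")
      case True
      have "dist (\<Psi> (y, u)) (\<Psi> (x, u)) < \<eta>"
        by (rule \<delta>(2)) (use y y1 True in \<open>auto simp: dist_Pair_Pair\<close>)
      then show ?thesis using neg[of u] by (simp add: \<Psi>_def dist_real_def)
    next
      case False
      define n where "n = norm u"
      have n: "n > Kb" "n \<ge> 1" using False Kb by (auto simp: n_def)
      have "2 * l * (C * n + \<eta>) \<le> 2 * l * ((C + \<eta>) * n)"
        using l \<eta> n by (intro mult_left_mono) (auto simp: algebra_simps)
      also have "\<dots> \<le> n * n" using n by (simp add: Kb_def)
      also have "\<dots> \<le> 2 * l * L y u" using quadratic[of u y] by (simp add: n_def power2_eq_square)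
      finally have "C * n + \<eta> \<le> L y u" using l by simp
      then show ?thesis using C(2)[OF y1, of u] by (simp add: n_def abs_le_iff)
    qed
  qed
qed

lemma viscosity_supersolution_D: "viscosity_supersolution (hamiltonian f L) D"
  unfolding viscosity_supersolution_def
proof (intro allI impI)
  fix \<phi> x assume "C_k 1 \<phi> \<and> (\<forall>\<^sub>F y in nhds x. D x - \<phi> x \<le> D y - \<phi> y)"
  then have \<phi>: "C_k 1 \<phi>" and min: "\<forall>\<^sub>F y in nhds x. D x - \<phi> x \<le> D y - \<phi> y" by auto
  have diff: "\<phi> differentiable (at y)" for y using \<phi> by simp
  show "0 \<le> hamiltonian f L x (gradient \<phi> x)"
  proof (rule ccontr)
    assume "\<not> ?thesis"
    then have "hamiltonian f L x (gradient \<phi> x) < 0" by simp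
    then obtain q where q: "hamiltonian f L x (gradient \<phi> x) < ereal q" "ereal q < 0"
      using ereal_dense2 by blast
    \<comment> \<open>The margin at x is 2 \<eta>; half of it survives on a neighbourhood.\<close>
    define \<eta> where "\<eta> = - q / 2"
    have \<eta>: "\<eta> > 0" using q(2) by (simp add: \<eta>_def)
    have neg: "2 * \<eta> \<le> L x u - frechet_derivative \<phi> (at x) (control_matrix f x *v u)" for u
    proof -
      have "ereal (gradient \<phi> x \<bullet> (control_matrix f x *v u) - L x u) \<le> hamiltonian f L x (gradient \<phi> x)"
        unfolding hamiltonian_def by (rule SUP_upper) simp
      then have "ereal (gradient \<phi> x \<bullet> (control_matrix f x *v u) - L x u) < ereal q" using q(1) by (rule order.strict_trans1)
      then show ?thesis by (simp add: frechet_derivative_gradient[OF diff] \<eta>_def)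
    qed
    obtain r1 where r1: "r1 > 0"
      "\<And>y u. dist y x < r1 \<Longrightarrow> \<eta> \<le> L y u - frechet_derivative \<phi> (at y) (control_matrix f y *v u)"
      by (rule negative_hamiltonian_region[OF \<phi> \<eta> neg], rule that)
    obtain r2 where r2: "r2 > 0" "\<And>y. dist y x < r2 \<Longrightarrow> D x - \<phi> x \<le> D y - \<phi> y"
      using min unfolding eventually_nhds_metric by blast
    define r where "r = min r1 r2"
    have r: "r > 0" using r1 r2 by (simp add: r_def)
    have E0: "0 \<le> D x + \<eta>" using D_nonneg[of x] \<eta> by simp
    obtain t0 where t0: "t0 > 0" "\<And>t \<gamma> u \<kappa> s. 0 \<le> t \<Longrightarrow> t \<le> t0 \<Longrightarrow> (\<gamma>, u) \<in> admissible f 0 t \<Longrightarrow> \<gamma> t = x \<Longrightarrow>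
      cost \<gamma> u 0 t \<le> ennreal \<kappa> \<Longrightarrow> 0 \<le> \<kappa> \<Longrightarrow> \<kappa> \<le> D x + \<eta> \<Longrightarrow> s \<in> {0..t} \<Longrightarrow> dist (\<gamma> s) x < r"
      by (rule trajectory_stays_near[OF r E0, of x], rule that)
    \<comment> \<open>The bound t \<le> 1 keeps the cost of the almost optimal trajectory below D x
      + \<eta>, for which t0 was chosen.\<close>
    define t where "t = min t0 1"
    have t: "t > 0" "t \<le> t0" "t \<le> 1" using t0 by (auto simp: t_def)
    \<comment> \<open>The trajectory is optimal up to \<eta> t / 2, half of the gain \<eta> t that
      the strict inequality yields when integrated; the contact condition then makes the two
      incompatible.\<close>
    have "lax_oleinik f L t D x < ereal (D x + \<eta> * t / 2)"
      using lax_oleinik_D[of t x] t \<eta> by simp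
    then obtain y \<kappa> where y: "conn t y x \<kappa>" "D y + \<kappa> < D x + \<eta> * t / 2" by (rule lax_oleinik_less[OF _ t(1)])
    obtain \<gamma> u where g: "0 \<le> \<kappa>" "(\<gamma>, u) \<in> admissible f 0 t" "\<gamma> 0 = y" "\<gamma> t = x" "cost \<gamma> u 0 t \<le> ennreal \<kappa>"
      using y(1) unfolding conn_def by blast
    have "\<eta> * t \<le> \<eta> * 1" using t \<eta> by (intro mult_left_mono) auto
    then have \<kappa>: "\<kappa> \<le> D x + \<eta>" using y(2) D_nonneg[of y] \<eta> by linarith
    have near: "dist (\<gamma> s) x < r" if "s \<in> {0..t}" for s
      using t0(2)[OF less_imp_le[OF t(1)] t(2) g(2,4,5,1) \<kappa> that] .
    have "((\<lambda>s. frechet_derivative \<phi> (at (\<gamma> s)) (control_matrix f (\<gamma> s) *v u s) + \<eta>) has_integral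
        (\<phi> (\<gamma> t) - \<phi> (\<gamma> 0) + t * \<eta>)) {0..t}"
      using has_integral_add[OF has_integral_along_trajectory[OF g(2) less_imp_le[OF t(1)] \<phi>] has_integral_const_real[of \<eta> 0 t]] t
      by simp
    then have "\<phi> (\<gamma> t) - \<phi> (\<gamma> 0) + t * \<eta> \<le> \<kappa>"
    proof (rule has_integral_le_nn_cost[OF _ _ _ cost_measurable[OF g(2)] g(5,1)])
      show "0 \<le> L (\<gamma> s) (u s)" for s by (rule L_nonneg)
      fix s assume "s \<in> {0..t}"
      then have "dist (\<gamma> s) x < r1" using near by (simp add: r_def)
      from r1(2)[OF this, of "u s"]
      show "frechet_derivative \<phi> (at (\<gamma> s)) (control_matrix f (\<gamma> s) *v u s) + \<eta> \<le> L (\<gamma> s) (u s)" by simp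
    qed
    then have 1: "\<phi> x - \<phi> y + t * \<eta> \<le> \<kappa>" using g(3,4) by simp
    have "dist y x < r2" using near[of 0] t g(3) by (simp add: r_def)
    from r2(2)[OF this] have "D x - D y \<le> \<phi> x - \<phi> y" by simp
    then have "t * \<eta> \<le> \<eta> * t / 2" using 1 y(2) by linarith
    then show False using t \<eta> by (simp add: mult.commute)
  qed
qed

lemma viscosity_solution_D: "viscosity_solution (hamiltonian f L) D"
  using D_continuous viscosity_subsolution_D viscosity_supersolution_D by (simp add: viscosity_solution_def)

end

section \<open>Growth of the Lagrangian and the critical solution\<close>

text \<open>The second derivative is integrated twice along the ray through u. The first derivative
  vanishes at 0 because 0 is a minimum.\<close>

lemma strongly_convex_growth:
  fixes L :: "'a::euclidean_space \<Rightarrow> 'b::euclidean_space \<Rightarrow> real"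
  assumes C2: "C_k 2 (\<lambda>(x, u). L x u)" and l: "l > 0"
    and conv: "\<And>u w. 1 / l * (norm w)\<^sup>2 \<le>
      frechet_derivative (\<lambda>v. frechet_derivative (L x) (at v) w) (at u) w"
    and min: "\<And>u. L x 0 \<le> L x u"
  shows "L x 0 + (norm u)\<^sup>2 / (2 * l) \<le> L x u"
proof -
  let ?G = "\<lambda>(x, u). L x u"
  have G2: "C_k (Suc (Suc 0)) ?G" using C2 by (simp add: numeral_2_eq_2)
  have P: "((\<lambda>v. (x, v)) has_derivative (\<lambda>w. (0, w))) (at v)" for v :: 'b
    by (auto intro!: derivative_eq_intros)
  have DL: "(L x has_derivative (\<lambda>w. frechet_derivative ?G (at (x, v)) (0, w))) (at v)" for v
    using has_derivative_compose[OF P C_k_has_derivative[OF G2, of "(x, v)"]] by simp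
  have fr: "frechet_derivative (L x) (at v) = (\<lambda>w. frechet_derivative ?G (at (x, v)) (0, w))" for v
    by (rule frechet_derivative_at[symmetric, OF DL])
  have D1: "(L x has_derivative frechet_derivative (L x) (at v)) (at v)" for v
    using DL[of v] unfolding fr .
  have D2: "((\<lambda>v. frechet_derivative (L x) (at v) w) has_derivative
      frechet_derivative (\<lambda>v. frechet_derivative (L x) (at v) w) (at v)) (at v)" for v w
  proof -
    have "C_k (Suc 0) (\<lambda>p. frechet_derivative ?G (at p) (0, w))" using G2 by simp
    from has_derivative_compose[OF P C_k_has_derivative[OF this, of "(x, v)"]]
    have "(\<lambda>v. frechet_derivative (L x) (at v) w) differentiable (at v)"
      unfolding fr differentiable_def by blast
    then show ?thesis by (simp add: frechet_derivative_works)
  qed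
  have ray: "((\<lambda>s. F (s *\<^sub>R u)) has_field_derivative F' u) (at s)"
    if "(F has_derivative F') (at (s *\<^sub>R u))" for F :: "'b \<Rightarrow> real" and F' s
  proof -
    have "((\<lambda>s. s *\<^sub>R u) has_derivative (\<lambda>h. h *\<^sub>R u)) (at s)" by (auto intro!: derivative_eq_intros)
    from has_derivative_compose[OF this that]
    show ?thesis by (simp add: has_field_derivative_def linear_scale[OF has_derivative_linear[OF that]] mult.commute[of _ "F' u"])
  qed
  \<comment> \<open>The derivative of L x along the ray. Subtracting the linear function with slope
    \<open>?q\<close> leaves a nondecreasing function that vanishes at 0.\<close>
  define g1 where "g1 s = frechet_derivative (L x) (at (s *\<^sub>R u)) u" for s
  have "frechet_derivative (L x) (at 0) = (\<lambda>h. 0)"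
    by (rule has_derivative_local_min[OF D1]) (simp add: min)
  then have g10: "g1 0 = 0" by (simp add: g1_def)
  let ?q = "(norm u)\<^sup>2 / l"
  have g1: "s * ?q \<le> g1 s" if "0 \<le> s" for s
  proof -
    have "g1 0 - 0 * ?q \<le> g1 s - s * ?q"
    proof (rule DERIV_nonneg_imp_nondecreasing[OF that, of "\<lambda>s. g1 s - s * ?q"], intro exI conjI)
      fix s
      show "((\<lambda>s. g1 s - s * ?q) has_real_derivative
          frechet_derivative (\<lambda>v. frechet_derivative (L x) (at v) u) (at (s *\<^sub>R u)) u - ?q) (at s)"
        unfolding g1_def by (rule DERIV_diff[OF ray[OF D2]]) (use l in \<open>auto intro!: derivative_eq_intros\<close>)
      show "0 \<le> frechet_derivative (\<lambda>v. frechet_derivative (L x) (at v) u) (at (s *\<^sub>R u)) u - ?q"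
        using conv[of u "s *\<^sub>R u"] by simp
    qed
    then show ?thesis using g10 by simp
  qed
  have "L x (0 *\<^sub>R u) - 0\<^sup>2 * ?q / 2 \<le> L x (1 *\<^sub>R u) - 1\<^sup>2 * ?q / 2"
  proof (rule DERIV_nonneg_imp_nondecreasing[of 0 1 "\<lambda>s. L x (s *\<^sub>R u) - s\<^sup>2 * ?q / 2"])
    fix s :: real assume s: "0 \<le> s"
    have "((\<lambda>s. L x (s *\<^sub>R u) - s\<^sup>2 * ?q / 2) has_real_derivative (g1 s - s * ?q)) (at s)"
      unfolding g1_def by (rule DERIV_diff[OF ray[OF D1]]) (use l in \<open>auto intro!: derivative_eq_intros\<close>)
    then show "\<exists>y. ((\<lambda>s. L x (s *\<^sub>R u) - s\<^sup>2 * ?q / 2) has_real_derivative y) (at s) \<and> 0 \<le> y"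
      using g1[OF s] by (intro exI[of _ "g1 s - s * ?q"]) simp
  qed simp
  then show ?thesis using l by (simp add: field_simps)
qed

lemma ext_integral_ge_0: "(\<And>s. 0 \<le> g s) \<Longrightarrow> 0 \<le> ext_integral M g"
  by (simp add: ext_integral_def ennreal_neg zero_ennreal.rep_eq)

section \<open>Sign of the critical solution and its zeros on the rest set\<close>

context coercive_control_problem
begin

lemma discounted_value_ge_0: "0 \<le> discounted_value f L lam x"
  unfolding discounted_value_def
  by (rule INF_greatest) (auto intro!: ext_integral_ge_0 mult_nonneg_nonneg L_nonneg)

lemma discounted_value_rest:
  assumes "a \<in> rest"
  shows "discounted_value f L lam a = 0"
proof (rule antisym[OF _ discounted_value_ge_0])
  have "(\<lambda>_. a, \<lambda>_. 0) \<in> admissible_discounted f lam a"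
    using admissible_const[of a f] by (simp add: admissible_discounted_def admissible_from_def)
  then have "discounted_value f L lam a \<le> ext_integral (lebesgue_on {0..}) (\<lambda>t. exp (- lam * t) * L a 0)"
    unfolding discounted_value_def by (rule INF_lower2) simp
  then show "discounted_value f L lam a \<le> 0"
    using assms by (simp add: rest_def ext_integral_def zero_ennreal.rep_eq)
qed

lemma critical_solution_bounds:
  assumes "critical_solution f L chi"
  shows "0 \<le> chi x" and "a \<in> rest \<Longrightarrow> chi a = 0"
proof -
  obtain lam :: "nat \<Rightarrow> real" where lim: "\<forall>R\<ge>0. ereal_uniform_limit (cball 0 R) (\<lambda>n. discounted_value f L (lam n)) chi sequentially"
    using assms unfolding critical_solution_def by blast
  have close: "\<exists>n. \<bar>discounted_value f L (lam n) x - ereal (chi x)\<bar> < ereal e" if e: "e > 0" for x e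
  proof -
    have "\<forall>\<^sub>F n in sequentially. \<forall>y\<in>cball 0 (norm x). \<bar>discounted_value f L (lam n) y - ereal (chi y)\<bar> < ereal e"
      using lim e unfolding ereal_uniform_limit_def by (meson norm_ge_zero)
    then obtain n where "\<forall>y\<in>cball 0 (norm x). \<bar>discounted_value f L (lam n) y - ereal (chi y)\<bar> < ereal e"
      using eventually_sequentially by auto
    then show ?thesis by (intro exI[of _ n]) simp
  qed
  show "0 \<le> chi x"
  proof (rule ccontr)
    assume "\<not> 0 \<le> chi x"
    then obtain n where n: "\<bar>discounted_value f L (lam n) x - ereal (chi x)\<bar> < ereal (- chi x)"
      using close[of "- chi x" x] by auto
    then show False using discounted_value_ge_0[of "lam n" x]
      by (cases "discounted_value f L (lam n) x") auto
  qed
  show "chi a = 0" if a: "a \<in> rest"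
  proof (rule ccontr)
    assume "chi a \<noteq> 0"
    then show False using close[of "\<bar>chi a\<bar>" a] by (simp add: discounted_value_rest[OF a])
  qed
qed

end

theorem theorem7p6:
  fixes f :: "'m::finite \<Rightarrow> real^'d \<Rightarrow> real^'d"
    and L :: "real^'d \<Rightarrow> real^'m \<Rightarrow> real"
    and chi :: "real^'d \<Rightarrow> real"
  assumes "\<And>i. smooth (f i)"
    and "assumption_F1 f"
    and "chow_condition f"
    and "C_k 2 (\<lambda>(x, u). L x u)"
    and "assumption_L1 L"
    and "assumption_L2 L"
    and "assumption_L3' L"
    and "critical_solution f L chi"
  shows "\<exists>chibar :: real^'d \<Rightarrow> real. continuous_on UNIV chibar \<and>
    (\<forall>R\<ge>0. ereal_uniform_limit (cball 0 R) (\<lambda>t. lax_oleinik f L t chi) chibar at_top) \<and>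
    (\<forall>t\<ge>0. \<forall>x. lax_oleinik f L t chibar x = ereal (chibar x)) \<and>
    viscosity_solution (hamiltonian f L) chibar"
proof -
  obtain l where l: "l > 0" and conv: "\<And>x u w. 1 / l * (norm w)\<^sup>2 \<le>
      frechet_derivative (\<lambda>v. frechet_derivative (L x) (at v) w) (at u) w"
    using \<open>assumption_L1 L\<close> unfolding assumption_L1_def by blast
  have L2: "L x 0 \<le> L x u" for x u using \<open>assumption_L2 L\<close> by (simp add: assumption_L2_def)
  obtain K where K: "compact K" "\<exists>x\<in>K. L x 0 = 0" "\<And>x. x \<in> K \<Longrightarrow> 0 \<le> L x 0"
    and INF: "0 < (INF x\<in>-K. ereal (L x 0))"
    using \<open>assumption_L3' L\<close> unfolding assumption_L3'_def by blast
  \<comment> \<open>The infimum is an extended real; a real number strictly between 0 and it serves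
    as the gap.\<close>
  obtain k0 where k0: "0 < ereal k0" "ereal k0 < (INF x\<in>-K. ereal (L x 0))"
    using ereal_dense2[OF INF] by blast
  have outside: "k0 \<le> L x 0" if "x \<notin> K" for x
  proof -
    have "ereal k0 < ereal (L x 0)"
      by (rule less_le_trans[OF k0(2)]) (use that in \<open>auto intro: INF_lower\<close>)
    then show ?thesis by simp
  qed
  interpret coercive_control_problem f L l k0 K
  proof
    show "smooth (f i)" for i by fact
    show "continuous_on UNIV (\<lambda>(x, u). L x u)" using \<open>C_k 2 _\<close> by (rule C_k_continuous)
    show "(norm u)\<^sup>2 \<le> 2 * l * L x u" for x u
    proof -
      \<comment> \<open>Inside K this is part of (L3'), outside it follows from the gap. The
        quadratic growth then holds without an additive constant.\<close>
      have "0 \<le> L x 0" using K(3)[of x] outside[of x] k0(1) by fastforce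
      then have "(norm u)\<^sup>2 / (2 * l) \<le> L x u"
        using strongly_convex_growth[OF \<open>C_k 2 _\<close> l conv L2, of x u] by linarith
      then show ?thesis using l by (simp add: field_simps)
    qed
  qed (use \<open>chow_condition f\<close> l L2 K k0 outside in auto)
  have "ereal_uniform_limit (cball 0 R) (\<lambda>t. lax_oleinik f L t chi) D at_top" for R
    using critical_solution_bounds[OF \<open>critical_solution f L chi\<close>] by (intro lax_oleinik_tendsto_D)
  then show ?thesis
    using D_continuous lax_oleinik_D viscosity_solution_D by (intro exI[of _ D]) simp
qed

end
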